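(* Consider a two-phase composite with isotropic phases $\mathsf L_j=\sigma_j\otimes I_2+r_j\mathsf T$, $j=1,2$, with $\sigma_1=\theta_1\sigma_0$, $\sigma_2=\theta_2\sigma_0$, where $\theta_1,\theta_2>0$, $\sigma_0$ is symmetric positive definite, and \[ |r_1-r_2|>|\theta_1-\theta_2|\sqrt{\det\sigma_0}. \] Then there are a real symmetric $2\times2$ matrix $L^*$ and a real number $t^*$ such that \[ \mathsf L^*=\sigma_1\otimes L^*+t^*\mathsf T,\qquad \det\sigma_1\det L^*=(t^*+A)^2+B, \] where, with $\Delta r=r_2-r_1$, \[ A=\frac{\det\sigma_2-\det\sigma_1+r_1^2-r_2^2}{2\Delta r}, \] \[ B=\frac{\big((\Delta r)^2-(\sqrt{\det\sigma_1}-\sqrt{\det\sigma_2})^2\big)\big((\sqrt{\det\sigma_1}+\sqrt{\det\sigma_2})^2-(\Delta r)^2\big)}{4(\Delta r)^2}. \]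
   Context: Let $R_\perp=\begin{pmatrix}0&-1\\1&0\end{pmatrix}$ and let $I_2$ be the $2\times2$ identity. Let $\mathcal T=\mathbb R^2\oplus\mathbb R^2$. Operators on $\mathcal T$ are written as $2\times2$ block matrices with real $2\times 2$ blocks, and $A\otimes B$ is the block matrix with blocks $A_{ij}B$. Put $\mathsf T=R_\perp\otimes R_\perp$. The phases $\mathsf L_j$ are assumed positive definite: $\sigma_j$ is a real symmetric positive definite $2\times2$ matrix and $r_j\in\mathbb R$ with $r_j^2<\det\sigma_j$. A two-phase composite is given by a measurable partition of the period cell $[0,1]^2=A_1\cup A_2$ (the microstructure) and the periodic tensor field $\mathsf L(x)=\mathsf L_j$ for $x\in A_j$. Its effective tensor $\mathsf L^*$ is defined by $\mathsf L^*E_0=\int_{[0,1]^2}\mathsf L(x)E(x)\,dx$ for $E_0\in\mathcal T$, where $E=E_0+(\nabla\varphi_1,\nabla\varphi_2)$ with $\varphi_1,\varphi_2\in H^1_{\rm per}$ is the unique such field for which both $\mathbb R^2$-components of $\mathsf L E$ are divergence-free. *)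

theory Defs
  imports "HOL-Analysis.Analysis"
begin

text \<open>
  For \<open>E \<in> \<real>\<^sup>2 \<oplus> \<real>\<^sup>2\<close>, \<open>E $ i\<close> is the \<open>i\<close>-th \<open>\<real>\<^sup>2\<close>-component of \<open>E\<close>;
  \<open>M $ i $ j\<close> is the block of \<open>M\<close> in block row \<open>i\<close> and block column \<open>j\<close>.
\<close>

type_synonym T_space = "(real^2)^2"

type_synonym T_op = "((real^2^2)^2)^2"

definition R_perp :: "real^2^2" where
  "R_perp = vector [vector [0, -1], vector [1, 0]]"

definition tensor :: "real^2^2 \<Rightarrow> real^2^2 \<Rightarrow> T_op"  (infixr "\<otimes>\<^sub>b" 75) where
  "A \<otimes>\<^sub>b B = (\<chi> i j. (A $ i $ j) *\<^sub>R B)"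

definition T_perp :: T_op where
  "T_perp = R_perp \<otimes>\<^sub>b R_perp"

definition op_apply :: "T_op \<Rightarrow> T_space \<Rightarrow> T_space" where
  "op_apply M E = (\<chi> i. \<Sum>j\<in>UNIV. (M $ i $ j) *v (E $ j))"

definition sym_pos_def :: "real^2^2 \<Rightarrow> bool" where
  "sym_pos_def S \<longleftrightarrow> transpose S = S \<and> (\<forall>v. v \<noteq> 0 \<longrightarrow> v \<bullet> (S *v v) > 0)"

definition period_cell :: "(real^2) set" where
  "period_cell = cbox 0 1"

abbreviation cell_measure :: "(real^2) measure" where
  "cell_measure \<equiv> lebesgue_on period_cell"

definition periodic :: "(real^2 \<Rightarrow> 'a) \<Rightarrow> bool" where
  "periodic f \<longleftrightarrow> (\<forall>x i. f (x + axis i 1) = f x)"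

definition partial_deriv :: "2 \<Rightarrow> (real^2 \<Rightarrow> real) \<Rightarrow> real^2 \<Rightarrow> real" where
  "partial_deriv i f x = frechet_derivative f (at x) (axis i 1)"

definition grad :: "(real^2 \<Rightarrow> real) \<Rightarrow> real^2 \<Rightarrow> real^2" where
  "grad f x = (\<chi> i. partial_deriv i f x)"

text \<open>A function is \<open>C\<^sup>\<infinity>\<close> iff all its iterated partial derivatives are differentiable everywhere.\<close>

definition smooth :: "(real^2 \<Rightarrow> real) \<Rightarrow> bool" where
  "smooth f \<longleftrightarrow> (\<forall>ks x. fold partial_deriv ks f differentiable (at x))"

definition L2_cell :: "(real^2 \<Rightarrow> 'a::euclidean_space) \<Rightarrow> bool" where
  "L2_cell f \<longleftrightarrow> f \<in> borel_measurable cell_measure \<and> integrable cell_measure (\<lambda>x. (norm (f x))\<^sup>2)"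

text \<open>
  \<open>H1_per_grad \<phi> g\<close>: \<open>\<phi> \<in> H\<^sup>1\<^sub>p\<^sub>e\<^sub>r\<close>, and \<open>g\<close> represents \<open>\<nabla>\<phi>\<close> on the period cell. Weak derivatives and
  divergences are those on the torus: test functions are smooth and periodic, so jumps across the
  boundary of the cell are not allowed.
\<close>

definition H1_per_grad :: "(real^2 \<Rightarrow> real) \<Rightarrow> (real^2 \<Rightarrow> real^2) \<Rightarrow> bool" where
  "H1_per_grad \<phi> g \<longleftrightarrow> periodic \<phi> \<and> L2_cell \<phi> \<and> L2_cell g \<and>
     (\<forall>\<psi>. smooth \<psi> \<and> periodic \<psi> \<longrightarrow>
        (\<forall>i. (LINT x|cell_measure. \<phi> x * partial_deriv i \<psi> x)
              = - (LINT x|cell_measure. g x $ i * \<psi> x)))"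

definition div_free :: "(real^2 \<Rightarrow> real^2) \<Rightarrow> bool" where
  "div_free J \<longleftrightarrow> L2_cell J \<and>
     (\<forall>\<psi>. smooth \<psi> \<and> periodic \<psi> \<longrightarrow> (LINT x|cell_measure. J x \<bullet> grad \<psi> x) = 0)"

text \<open>
  A periodic tensor field is given by its values on the period cell; nothing below
  looks at it elsewhere.
\<close>

definition two_phase :: "(real^2) set \<Rightarrow> T_op \<Rightarrow> T_op \<Rightarrow> real^2 \<Rightarrow> T_op" where
  "two_phase A1 L1 L2 x = (if x \<in> A1 then L1 else L2)"

definition cell_solution :: "(real^2 \<Rightarrow> T_op) \<Rightarrow> T_space \<Rightarrow> (real^2 \<Rightarrow> T_space) \<Rightarrow> bool" where
  "cell_solution L E0 E \<longleftrightarrow>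
     (\<exists>\<phi>1 \<phi>2 g1 g2. H1_per_grad \<phi>1 g1 \<and> H1_per_grad \<phi>2 g2 \<and>
        (\<forall>x. E x = E0 + vector [g1 x, g2 x])) \<and>
     (\<forall>i. div_free (\<lambda>x. op_apply (L x) (E x) $ i))"

text \<open>
  The field \<open>E\<close> is only determined almost everywhere. The requirement that a solution exists and
  that all solutions give the same average is the well-posedness implicit in the definition of
  the effective tensor; it is part of the description below, not an assumption on \<open>L\<close>.
\<close>

definition is_effective_tensor :: "(real^2 \<Rightarrow> T_op) \<Rightarrow> T_op \<Rightarrow> bool" where
  "is_effective_tensor L Leff \<longleftrightarrow>
     (\<forall>E0. (\<exists>E. cell_solution L E0 E) \<and>
           (\<forall>E. cell_solution L E0 E \<longrightarrow>
              op_apply Leff E0 = (LINT x|cell_measure. op_apply (L x) (E x))))"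

definition effective_tensor :: "(real^2 \<Rightarrow> T_op) \<Rightarrow> T_op" where
  "effective_tensor L = (THE Leff. is_effective_tensor L Leff)"

end

theory Submission
  imports Defs
begin

text \<open>
  Put \<open>Q = R\<^sub>\<perp> \<sigma>\<^sub>0\<close> and \<open>Q' = \<sigma>\<^sub>0 R\<^sub>\<perp>\<close>. Both phases satisfy \<open>\<L>\<^sub>j (Q \<otimes> I) = (Q' \<otimes> I) \<L>\<^sub>j\<close>, hence so does the
  effective tensor; with its symmetry this forces \<open>\<L>\<^sup>* = \<sigma>\<^sub>0 \<otimes> M + t T\<close>. The constants \<open>A\<close> and \<open>B\<close> are
  those with \<open>det \<sigma>\<^sub>j - (r\<^sub>j + A)\<^sup>2 = B\<close> for both phases. Since \<open>T\<close> maps gradients to divergence-free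
  fields, replacing \<open>\<L>\<^sub>j\<close> by \<open>N\<^sub>j = \<L>\<^sub>j + A T\<close> does not change the solutions of the cell problem and adds
  \<open>A T\<close> to the effective tensor. The shifted phases satisfy \<open>N\<^sub>j (C \<otimes> R\<^sub>\<perp>) N\<^sub>j = B (D \<otimes> R\<^sub>\<perp>)\<close> for
  suitable \<open>C\<close>, \<open>D\<close>. Rotation by \<open>R\<^sub>\<perp>\<close> exchanges gradients and divergence-free fields on the torus,
  so for every solution \<open>E\<close> the field \<open>(C \<otimes> R\<^sub>\<perp>) N E\<close> is again a solution; therefore the effective tensor
  inherits the identity, and this says \<open>det \<sigma>\<^sub>0 det M = (t + A)\<^sup>2 + B\<close>.

  The cell problem is solved by orthogonal projection in the energy inner product. Facts on weak
  gradients and divergence-free fields are read off from Fourier coefficients: gradients are the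
  mean-zero fields whose coefficient at each frequency \<open>k\<close> is parallel to \<open>k\<close>, divergence-free fields
  are those whose coefficient is orthogonal to \<open>k\<close>.
\<close>

section \<open>Square-integrable fields on the period cell\<close>

text \<open>The duality identity is an expansion. With R = \<open>R_perp\<close>, N = S \<otimes> I
  + \<rho> T and R^2 = -I, the product N (C \<otimes> R) N equals (S C S - \<rho>^2 R C R) \<otimes>
  R - \<rho> (S C R + R C S) \<otimes> I. For symmetric C with tr(C S) = 0 the last bracket vanishes
  and S C S = det S R C R, which leaves (det S - \<rho>^2) R C R \<otimes> R. The trace condition
  does not see a scaling of S, so proportional \<open>\<sigma>1\<close> and \<open>\<sigma>2\<close>
  share one C. The scalar factor must be shared too: det S1 - (r1 + A)^2 = det S2 - (r2 + A)^2 is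
  linear in A, and for distinct r1, r2 its solution is the stated A. For S \<otimes> M + t T the
  same expansion meets M R M = det M R, whence the quadratic relation.
  \<open>effective_tensor\<close> is a definite description, so well-posedness has to be proved
  before anything can be said about it. The rotation argument also has to produce a periodic
  potential from coefficients parallel to their frequencies; this is where completeness of the basis
  is indispensable.\<close>

lemma lmeasurable_period_cell: "period_cell \<in> lmeasurable"
  by (simp add: period_cell_def)

lemma measure_lebesgue_period_cell: "measure lebesgue period_cell = 1"
  by (simp add: period_cell_def content_cbox_if_cart interval_ne_empty_cart)

interpretation cell: finite_measure cell_measure
  by (rule finite_measure_lebesgue_on[OF lmeasurable_period_cell])

lemma measure_cell_space [simp]: "measure cell_measure period_cell = 1"
  using lmeasurable_period_cell
  by (simp add: measure_restrict_space measure_lebesgue_period_cell fmeasurableD)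

lemma integral_cell_const [simp]: "(LINT x|cell_measure. (c::'a::euclidean_space)) = c"
  by simp

lemma continuous_measurable_cell:
  fixes f :: "real^2 \<Rightarrow> 'a::euclidean_space"
  assumes "continuous_on UNIV f"
  shows "f \<in> borel_measurable cell_measure"
  by (rule continuous_imp_measurable_on_sets_lebesgue)
    (use assms lmeasurable_period_cell in \<open>auto intro: continuous_on_subset simp: fmeasurableD\<close>)

lemma continuous_bounded_cell:
  fixes f :: "real^2 \<Rightarrow> 'a::euclidean_space"
  assumes "continuous_on UNIV f"
  shows "\<exists>C. \<forall>x\<in>period_cell. norm (f x) \<le> C"
proof -
  have "compact (f ` period_cell)"
    using assms by (intro compact_continuous_image)
      (auto simp: period_cell_def intro: continuous_on_subset)
  then show ?thesis
    by (meson bounded_iff compact_imp_bounded imageI)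
qed

lemma L2_cell_bounded:
  fixes f :: "real^2 \<Rightarrow> 'a::euclidean_space"
  assumes [measurable]: "f \<in> borel_measurable cell_measure"
    and "\<And>x. x \<in> period_cell \<Longrightarrow> norm (f x) \<le> C"
  shows "L2_cell f"
  unfolding L2_cell_def
proof
  show "integrable cell_measure (\<lambda>x. (norm (f x))\<^sup>2)"
    by (rule cell.integrable_const_bound[where B="C\<^sup>2"])
      (auto intro!: AE_I2 power_mono assms(2))
qed (rule assms)

lemma L2_cell_continuous:
  fixes f :: "real^2 \<Rightarrow> 'a::euclidean_space"
  assumes "continuous_on UNIV f"
  shows "L2_cell f"
  using continuous_bounded_cell[OF assms] L2_cell_bounded[OF continuous_measurable_cell[OF assms]]
  by blast

lemma L2_cell_const [simp]: "L2_cell (\<lambda>x. c)"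
  by (intro L2_cell_continuous continuous_intros)

lemma L2_cell_measurable: "L2_cell f \<Longrightarrow> f \<in> borel_measurable cell_measure"
  by (simp add: L2_cell_def)

lemma L2_cell_dominated:
  fixes f :: "real^2 \<Rightarrow> 'a::euclidean_space" and g :: "real^2 \<Rightarrow> 'b::euclidean_space"
  assumes "L2_cell g" and [measurable]: "f \<in> borel_measurable cell_measure"
    and "\<And>x. x \<in> period_cell \<Longrightarrow> norm (f x) \<le> C * norm (g x)"
  shows "L2_cell f"
  unfolding L2_cell_def
proof
  have "integrable cell_measure (\<lambda>x. C\<^sup>2 * (norm (g x))\<^sup>2)"
    using assms(1) by (simp add: L2_cell_def)
  then show "integrable cell_measure (\<lambda>x. (norm (f x))\<^sup>2)"
    by (rule Bochner_Integration.integrable_bound)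
      (use assms(3) in \<open>auto intro!: AE_I2 simp flip: power_mult_distrib intro: power_mono\<close>)
qed (rule assms)

lemma L2_cell_inner:
  fixes f g :: "real^2 \<Rightarrow> 'a::euclidean_space"
  assumes "L2_cell f" "L2_cell g"
  shows "integrable cell_measure (\<lambda>x. f x \<bullet> g x)"
proof -
  have [measurable]: "f \<in> borel_measurable cell_measure" "g \<in> borel_measurable cell_measure"
    using assms by (auto simp: L2_cell_def)
  have "integrable cell_measure (\<lambda>x. (norm (f x))\<^sup>2 + (norm (g x))\<^sup>2)"
    using assms by (simp add: L2_cell_def)
  then show ?thesis
  proof (rule Bochner_Integration.integrable_bound)
    have "\<bar>f x \<bullet> g x\<bar> \<le> (norm (f x))\<^sup>2 + (norm (g x))\<^sup>2" for x
    proof -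
      have "\<bar>f x \<bullet> g x\<bar> \<le> norm (f x) * norm (g x)"
        by (rule Cauchy_Schwarz_ineq2)
      also have "\<dots> \<le> (norm (f x))\<^sup>2 + (norm (g x))\<^sup>2"
        using sum_squares_bound[of "norm (f x)" "norm (g x)"]
          mult_nonneg_nonneg[OF norm_ge_zero[of "f x"] norm_ge_zero[of "g x"]] by linarith
      finally show ?thesis .
    qed
    then show "AE x in cell_measure. norm (f x \<bullet> g x) \<le> norm ((norm (f x))\<^sup>2 + (norm (g x))\<^sup>2)"
      by auto
  qed measurable
qed

lemma L2_cell_integrable:
  fixes f :: "real^2 \<Rightarrow> 'a::euclidean_space"
  assumes "L2_cell f"
  shows "integrable cell_measure f"
proof -
  have [measurable]: "f \<in> borel_measurable cell_measure"
    using assms by (auto simp: L2_cell_def)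
  have "integrable cell_measure (\<lambda>x. (norm (f x))\<^sup>2 + 1)"
    using assms by (simp add: L2_cell_def)
  then show ?thesis
  proof (rule Bochner_Integration.integrable_bound)
    have "norm (f x) \<le> (norm (f x))\<^sup>2 + 1" for x
      using sum_squares_bound[of "norm (f x)" 1] norm_ge_zero[of "f x"] unfolding power_one by linarith
    then show "AE x in cell_measure. norm (f x) \<le> norm ((norm (f x))\<^sup>2 + 1)"
      by auto
  qed measurable
qed

lemma L2_cell_add:
  fixes f g :: "real^2 \<Rightarrow> 'a::euclidean_space"
  assumes "L2_cell f" "L2_cell g"
  shows "L2_cell (\<lambda>x. f x + g x)"
  unfolding L2_cell_def
proof
  show [measurable]: "(\<lambda>x. f x + g x) \<in> borel_measurable cell_measure"
    using assms by (auto simp: L2_cell_def)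
  have "integrable cell_measure (\<lambda>x. (norm (f x))\<^sup>2 + 2 * (f x \<bullet> g x) + (norm (g x))\<^sup>2)"
    using assms L2_cell_inner[OF assms] by (simp add: L2_cell_def)
  then show "integrable cell_measure (\<lambda>x. (norm (f x + g x))\<^sup>2)"
    by (simp add: dot_norm field_simps)
qed

lemma L2_cell_linear:
  fixes f :: "real^2 \<Rightarrow> 'a::euclidean_space" and T :: "'a \<Rightarrow> 'b::euclidean_space"
  assumes "L2_cell f" "linear T"
  shows "L2_cell (\<lambda>x. T (f x))"
proof -
  obtain B where B: "\<And>x. norm (T x) \<le> B * norm x"
    using linear_bounded[OF assms(2)] by blast
  have "T \<in> borel_measurable borel"
    using assms(2) by (intro borel_measurable_continuous_onI linear_continuous_on
        linear_conv_bounded_linear[THEN iffD1])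
  then have "(\<lambda>x. T (f x)) \<in> borel_measurable cell_measure"
    using L2_cell_measurable[OF assms(1)] by (rule measurable_compose[rotated])
  then show ?thesis
    by (rule L2_cell_dominated[OF assms(1)]) (use B in blast)
qed

lemma L2_cell_scaleR: "L2_cell f \<Longrightarrow> L2_cell (\<lambda>x. c *\<^sub>R f x)"
  by (erule L2_cell_linear) (rule linear_scaleR)

lemma L2_cell_cmult: "L2_cell f \<Longrightarrow> L2_cell (\<lambda>x. c * f x :: real)"
  using L2_cell_scaleR[of f c] by simp

lemma L2_cell_diff:
  assumes "L2_cell f" "L2_cell g" shows "L2_cell (\<lambda>x. f x - g x)"
  using L2_cell_add[OF assms(1) L2_cell_scaleR[OF assms(2), of "-1"]] by simp

lemma L2_cell_sum:
  assumes "\<And>i. i \<in> I \<Longrightarrow> L2_cell (f i)"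
  shows "L2_cell (\<lambda>x. \<Sum>i\<in>I. f i x)"
  using assms
  by (induction I rule: infinite_finite_induct) (auto intro: L2_cell_add)

lemma L2_cell_nth: "L2_cell f \<Longrightarrow> L2_cell (\<lambda>x. f x $ i)"
  by (erule L2_cell_linear) (rule bounded_linear.linear[OF bounded_linear_vec_nth])

lemma L2_cell_nthI:
  fixes f :: "real^2 \<Rightarrow> 'a::euclidean_space^'n::finite"
  assumes "\<And>i. L2_cell (\<lambda>x. f x $ i)"
  shows "L2_cell f"
proof -
  have "f = (\<lambda>x. \<Sum>i\<in>UNIV. axis i (f x $ i))"
    by (simp add: fun_eq_iff vec_eq_iff axis_def if_distrib cong: if_cong)
  moreover have "L2_cell (\<lambda>x. \<Sum>i\<in>UNIV. axis i (f x $ i))"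
    by (intro L2_cell_sum L2_cell_linear[OF assms] linearI)
      (auto simp: vec_eq_iff axis_def)
  ultimately show ?thesis by simp
qed

section \<open>Inner product, Cauchy-Schwarz inequality and completeness of
  \<open>L2_cell\<close>\<close>

abbreviation cell_inner :: "(real^2 \<Rightarrow> 'a::euclidean_space) \<Rightarrow> (real^2 \<Rightarrow> 'a) \<Rightarrow> real" where
  "cell_inner f g \<equiv> (LINT x|cell_measure. f x \<bullet> g x)"

abbreviation cell_sq :: "(real^2 \<Rightarrow> 'a::euclidean_space) \<Rightarrow> real" where
  "cell_sq f \<equiv> (LINT x|cell_measure. (norm (f x))\<^sup>2)"

lemma cell_inner_Cauchy_Schwarz:
  fixes f g :: "real^2 \<Rightarrow> 'a::euclidean_space"
  assumes "L2_cell f" "L2_cell g"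
  shows "(cell_inner f g)\<^sup>2 \<le> cell_sq f * cell_sq g"
proof -
  let ?a = "cell_sq f" and ?b = "cell_inner f g" and ?c = "cell_sq g"
  have *: "0 \<le> ?a - 2 * t * ?b + t\<^sup>2 * ?c" for t
  proof -
    have "0 \<le> (LINT x|cell_measure. (norm (f x - t *\<^sub>R g x))\<^sup>2)"
      by simp
    also have "\<dots> = (LINT x|cell_measure. (norm (f x))\<^sup>2 - 2 * t * (f x \<bullet> g x) + t\<^sup>2 * (norm (g x))\<^sup>2)"
    proof (intro Bochner_Integration.integral_cong refl)
      fix x
      show "(norm (f x - t *\<^sub>R g x))\<^sup>2 = (norm (f x))\<^sup>2 - 2 * t * (f x \<bullet> g x) + t\<^sup>2 * (norm (g x))\<^sup>2"
        using dot_norm_neg[of "f x" "t *\<^sub>R g x"] by (simp add: power_mult_distrib)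
    qed
    also have "\<dots> = ?a - 2 * t * ?b + t\<^sup>2 * ?c"
      using assms L2_cell_inner[OF assms] by (simp add: L2_cell_def)
    finally show ?thesis .
  qed
  have c0: "0 \<le> ?c" by simp
  show ?thesis
  proof (cases "?c = 0")
    case True
    have "?b = 0"
    proof (rule ccontr)
      assume "?b \<noteq> 0"
      \<comment> \<open>With \<open>?c = 0\<close> the quadratic is affine in t, and this t gives it
        the value -1.\<close>
      with *[of "(?a + 1) / (2 * ?b)"] True show False
        by (simp add: field_simps)
    qed
    then show ?thesis using True by simp
  next
    case False
    then have "0 < ?c" using c0 by linarith
    moreover have "?a - 2 * (?b / ?c) * ?b + (?b / ?c)\<^sup>2 * ?c = ?a - ?b\<^sup>2 / ?c"
      using False by (simp add: power2_eq_square field_simps)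
    ultimately have "?b\<^sup>2 / ?c \<le> ?a"
      using *[of "?b / ?c"] by linarith
    then show ?thesis
      using \<open>0 < ?c\<close> by (simp add: field_simps)
  qed
qed

lemma cell_inner_tendsto:
  fixes u :: "nat \<Rightarrow> real^2 \<Rightarrow> 'a::euclidean_space"
  assumes "\<And>n. L2_cell (u n)" "L2_cell v" "L2_cell h"
    and "(\<lambda>n. cell_sq (\<lambda>x. u n x - v x)) \<longlonglongrightarrow> 0"
  shows "(\<lambda>n. cell_inner (u n) h) \<longlonglongrightarrow> cell_inner v h"
proof -
  have L: "L2_cell (\<lambda>x. u n x - v x)" for n
    by (intro L2_cell_diff assms)
  have eq: "cell_inner (u n) h - cell_inner v h = cell_inner (\<lambda>x. u n x - v x) h" for n
    by (simp add: inner_diff_left L2_cell_inner assms)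
  have "(\<lambda>n. (cell_inner (u n) h - cell_inner v h)\<^sup>2) \<longlonglongrightarrow> 0"
  proof (rule tendsto_sandwich[of "\<lambda>_. 0"])
    show "(\<lambda>n. cell_sq (\<lambda>x. u n x - v x) * cell_sq h) \<longlonglongrightarrow> 0"
      using tendsto_mult_right[OF assms(4), of "cell_sq h"] by simp
    show "\<forall>\<^sub>F n in sequentially. (cell_inner (u n) h - cell_inner v h)\<^sup>2 \<le> cell_sq (\<lambda>x. u n x - v x) * cell_sq h"
      unfolding eq by (intro always_eventually allI cell_inner_Cauchy_Schwarz L assms)
  qed (auto intro: always_eventually)
  then have "(\<lambda>n. cell_inner (u n) h - cell_inner v h) \<longlonglongrightarrow> 0"
    by simp
  then show ?thesis by (simp add: LIM_zero_iff)
qed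

lemma cell_sq_eq_0_AE:
  assumes "L2_cell f" "cell_sq f = 0"
  shows "AE x in cell_measure. f x = 0"
  using integral_nonneg_eq_0_iff_AE[of cell_measure "\<lambda>x. (norm (f x))\<^sup>2"] assms
  by (simp add: L2_cell_def)

text \<open>Turns bounds on norms along an a.e. convergent subsequence into integrability of the
  limit and the same bound for it. The bound C is automatically nonnegative, which is what allows
  the passage from \<open>ennreal\<close> back to the reals.\<close>

lemma Fatou_bound:
  fixes w :: "nat \<Rightarrow> 'b \<Rightarrow> real"
  assumes [measurable]: "\<And>k. integrable M (w k)" "v \<in> borel_measurable M"
    and nonneg: "\<And>k x. 0 \<le> w k x"
    and lim: "AE x in M. (\<lambda>k. w k x) \<longlonglongrightarrow> v x"
    and bound: "\<forall>\<^sub>F k in sequentially. integral\<^sup>L M (w k) \<le> C"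
  shows "integrable M v" "integral\<^sup>L M v \<le> C"
proof -
  have [measurable]: "\<And>k. w k \<in> borel_measurable M"
    using assms(1) by blast
  have v0: "AE x in M. 0 \<le> v x"
    using lim by eventually_elim (rule LIMSEQ_le_const, use nonneg in auto)
  have "C \<ge> 0"
  proof -
    obtain k where "integral\<^sup>L M (w k) \<le> C"
      using eventually_happens[OF bound] by auto
    moreover have "0 \<le> integral\<^sup>L M (w k)"
      by (intro Bochner_Integration.integral_nonneg nonneg)
    ultimately show ?thesis by linarith
  qed
  have "(\<integral>\<^sup>+ x. ennreal (v x) \<partial>M) = (\<integral>\<^sup>+ x. liminf (\<lambda>k. ennreal (w k x)) \<partial>M)"
    using lim by (intro nn_integral_cong_AE, eventually_elim)
      (auto intro!: lim_imp_Liminf[symmetric] tendsto_ennrealI)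
  also have "\<dots> \<le> liminf (\<lambda>k. \<integral>\<^sup>+ x. ennreal (w k x) \<partial>M)"
    by (rule nn_integral_liminf) measurable
  also have "\<dots> = liminf (\<lambda>k. ennreal (integral\<^sup>L M (w k)))"
    by (simp add: nn_integral_eq_integral assms(1) nonneg)
  also have "\<dots> \<le> liminf (\<lambda>k. ennreal C)"
    by (rule Liminf_mono) (use bound in \<open>eventually_elim, auto intro: ennreal_leI\<close>)
  also have "\<dots> = ennreal C"
    by (simp add: Liminf_const)
  finally have le: "(\<integral>\<^sup>+ x. ennreal (v x) \<partial>M) \<le> ennreal C" .
  show int: "integrable M v"
    using le v0 by (intro integrableI_nonneg) (auto simp: le_less_trans)
  show "integral\<^sup>L M v \<le> C"
    using le nn_integral_eq_integral[OF int v0] \<open>C \<ge> 0\<close> by simp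
qed

text \<open>A rapidly Cauchy subsequence has increments that are summable a.e., which gives a
  pointwise limit; Fatou's lemma in the second index then yields convergence in mean square of the
  whole sequence.\<close>

lemma L2_cell_complete:
  fixes u :: "nat \<Rightarrow> real^2 \<Rightarrow> 'a::euclidean_space"
  assumes L2: "\<And>n. L2_cell (u n)"
    and Cauchy: "\<And>e. e > 0 \<Longrightarrow> \<exists>N. \<forall>m\<ge>N. \<forall>n\<ge>N. cell_sq (\<lambda>x. u m x - u n x) < e"
  obtains v where "L2_cell v" "(\<lambda>n. cell_sq (\<lambda>x. u n x - v x)) \<longlonglongrightarrow> 0"
proof -
  have um [measurable]: "\<And>n. u n \<in> borel_measurable cell_measure"
    using L2 by (simp add: L2_cell_def)
  have "\<forall>k::nat. \<exists>N. \<forall>m\<ge>N. \<forall>n\<ge>N. cell_sq (\<lambda>x. u m x - u n x) < (1/4)^k"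
    by (intro allI Cauchy) simp
  from choice[OF this]
  obtain N where "\<forall>k. \<forall>m\<ge>N k. \<forall>n\<ge>N k. cell_sq (\<lambda>x. u m x - u n x) < (1/4)^k" ..
  then have N: "cell_sq (\<lambda>x. u m x - u n x) < (1/4)^k" if "m \<ge> N k" "n \<ge> N k" for k m n
    using that by blast
  \<comment> \<open>The partial sums give a monotone index above every \<open>N k\<close>; the
    summand k makes it unbounded.\<close>
  define r where "r k = (\<Sum>j\<le>k. N j) + k" for k
  have rN: "N k \<le> r k" for k
    unfolding r_def by (simp add: member_le_sum trans_le_add1)
  have rk: "k \<le> r k" for k by (simp add: r_def)
  have rS: "r k \<le> r (Suc k)" for k by (simp add: r_def)
  define d where "d k x = norm (u (r (Suc k)) x - u (r k) x)" for k x
  have d0: "0 \<le> d k x" for k x by (simp add: d_def)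
  have L2d: "L2_cell (\<lambda>x. u (r (Suc k)) x - u (r k) x)" for k
    by (intro L2_cell_diff L2)
  have dint: "integrable cell_measure (d k)" "integrable cell_measure (\<lambda>x. (d k x)\<^sup>2)" for k
    using L2_cell_integrable[OF L2d] L2d unfolding d_def L2_cell_def by (auto intro: integrable_norm)
  have [measurable]: "d k \<in> borel_measurable cell_measure" for k
    using dint by blast
  have d_le: "integral\<^sup>L cell_measure (d k) \<le> (1/2)^k" for k
  proof -
    have "integral\<^sup>L cell_measure (d k) \<le> (LINT x|cell_measure. (2^k * (d k x)\<^sup>2 + (1/2)^k) / 2)"
    proof (rule integral_mono)
      fix x
      \<comment> \<open>The square controls d by its square with weight 2^k. Since d^2 integrates to
        less than (1/4)^k and the cell has measure 1, both terms then contribute (1/2)^k.\<close>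
      have "0 \<le> (2^k * d k x - 1)\<^sup>2" by simp
      then have "2 * 2^k * d k x \<le> 2^k * (2^k * (d k x)\<^sup>2) + 1"
        by (simp add: power2_eq_square algebra_simps)
      then show "d k x \<le> (2^k * (d k x)\<^sup>2 + (1/2)^k) / 2"
        by (simp add: field_simps)
    qed (use dint in auto)
    also have "\<dots> = (2^k * cell_sq (\<lambda>x. u (r (Suc k)) x - u (r k) x) + (1/2)^k) / 2"
      using dint(2)[of k] by (simp add: d_def)
    also have "\<dots> \<le> (2^k * (1/4)^k + (1/2)^k) / 2"
      using N[of k "r (Suc k)" "r k"] rN[of k] rS[of k] by (simp add: less_imp_le)
    also have "\<dots> = (1/2)^k"
    proof -
      have "(2::real)^k * (1/4)^k = (2 * (1/4))^k"
        by (rule power_mult_distrib[symmetric])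
      then show ?thesis by simp
    qed
    finally show ?thesis .
  qed
  have "AE x in cell_measure. summable (\<lambda>k. d k x)"
  proof -
    have "(\<integral>\<^sup>+ x. (\<Sum>k. ennreal (d k x)) \<partial>cell_measure) = (\<Sum>k. \<integral>\<^sup>+ x. ennreal (d k x) \<partial>cell_measure)"
      by (rule nn_integral_suminf) measurable
    also have "\<dots> = (\<Sum>k. ennreal (integral\<^sup>L cell_measure (d k)))"
      using d0 dint(1) by (simp add: nn_integral_eq_integral)
    also have "\<dots> \<le> (\<Sum>k. ennreal ((1/2)^k))"
      by (intro suminf_le ennreal_leI d_le) auto
    also have "\<dots> < \<infinity>"
      by (subst suminf_ennreal2) (auto simp: summable_geometric)
    finally have "(\<integral>\<^sup>+ x. (\<Sum>k. ennreal (d k x)) \<partial>cell_measure) \<noteq> \<infinity>" by simp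
    then have "AE x in cell_measure. (\<Sum>k. ennreal (d k x)) \<noteq> \<infinity>"
      by (rule nn_integral_PInf_AE[rotated]) measurable
    then show ?thesis
      by eventually_elim (rule summable_suminf_not_top, auto simp: d_def)
  qed
  then have conv: "AE x in cell_measure. convergent (\<lambda>k. u (r k) x)"
  proof eventually_elim
    case (elim x)
    then have "summable (\<lambda>k. u (r (Suc k)) x - u (r k) x)"
      unfolding d_def by (rule summable_norm_cancel)
    then have "convergent (\<lambda>n. \<Sum>k<n. u (r (Suc k)) x - u (r k) x)"
      by (simp add: summable_iff_convergent)
    then have "convergent (\<lambda>n. u (r n) x - u (r 0) x)"
      using sum_lessThan_telescope[of "\<lambda>k. u (r k) x"] by simp
    then have "convergent (\<lambda>n. (u (r n) x - u (r 0) x) + u (r 0) x)"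
      by (intro convergent_add convergent_const)
    then show ?case by simp
  qed
  define v where "v x = lim (\<lambda>k. u (r k) x)" for x
  have vm [measurable]: "v \<in> borel_measurable cell_measure"
    unfolding v_def by measurable
  have lim: "AE x in cell_measure. (\<lambda>k. u (r k) x) \<longlonglongrightarrow> v x"
    using conv by eventually_elim (simp add: v_def convergent_LIMSEQ_iff)
  have bound: "integrable cell_measure (\<lambda>x. (norm (u n x - v x))\<^sup>2) \<and> cell_sq (\<lambda>x. u n x - v x) \<le> e"
    if e: "\<And>m. m \<ge> K \<Longrightarrow> cell_sq (\<lambda>x. u n x - u m x) \<le> e" for n K e
  proof -
    have 1: "integrable cell_measure (\<lambda>x. (norm (u n x - u (r k) x))\<^sup>2)" for k
      using L2_cell_diff[OF L2 L2] by (simp add: L2_cell_def)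
    have 2: "AE x in cell_measure. (\<lambda>k. (norm (u n x - u (r k) x))\<^sup>2) \<longlonglongrightarrow> (norm (u n x - v x))\<^sup>2"
      using lim by eventually_elim (intro tendsto_intros)
    have 3: "\<forall>\<^sub>F k in sequentially. cell_sq (\<lambda>x. u n x - u (r k) x) \<le> e"
      using e rk unfolding eventually_sequentially by (meson order_trans)
    show ?thesis
      using Fatou_bound[OF 1 _ _ 2 3] by simp
  qed
  have L2v: "L2_cell v"
  proof -
    obtain K where "\<And>m. m \<ge> K \<Longrightarrow> cell_sq (\<lambda>x. u K x - u m x) < 1"
      using Cauchy[of 1] by force
    then have "integrable cell_measure (\<lambda>x. (norm (u K x - v x))\<^sup>2)"
      using bound[of K K 1] by (simp add: less_imp_le)
    then have "L2_cell (\<lambda>x. u K x - v x)"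
      by (simp add: L2_cell_def)
    from L2_cell_diff[OF L2[of K] this] show ?thesis by simp
  qed
  moreover have "(\<lambda>n. cell_sq (\<lambda>x. u n x - v x)) \<longlonglongrightarrow> 0"
  proof (rule LIMSEQ_I)
    fix e :: real assume "e > 0"
    then obtain K where K: "\<And>m n. m \<ge> K \<Longrightarrow> n \<ge> K \<Longrightarrow> cell_sq (\<lambda>x. u m x - u n x) < e/2"
      using Cauchy[of "e/2"] by force
    have "cell_sq (\<lambda>x. u n x - v x) \<le> e/2" if "n \<ge> K" for n
      using bound[of K n "e/2"] K[OF that] by (simp add: less_imp_le)
    then show "\<exists>N. \<forall>n\<ge>N. norm (cell_sq (\<lambda>x. u n x - v x) - 0) < e"
      using \<open>e > 0\<close> by (intro exI[of _ K]) force
  qed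
  ultimately show thesis by (rule that)
qed


text \<open>The form is only semidefinite, since functions are not identified when they agree a.e.
  Completeness is therefore assumed for H in the seminorm, and no uniqueness of the projection is
  claimed.\<close>

lemma orthogonal_projection_exists:
  fixes a :: "('x \<Rightarrow> 'b::real_vector) \<Rightarrow> ('x \<Rightarrow> 'b) \<Rightarrow> real"
  assumes V: "\<And>u v c. u \<in> V \<Longrightarrow> v \<in> V \<Longrightarrow> (\<lambda>x. u x + c *\<^sub>R v x) \<in> V"
    and H: "\<And>u v c. u \<in> H \<Longrightarrow> v \<in> H \<Longrightarrow> (\<lambda>x. u x + c *\<^sub>R v x) \<in> H"
    and zero: "(\<lambda>x. 0) \<in> H" and "H \<subseteq> V"
    and lin: "\<And>u v w c. u \<in> V \<Longrightarrow> v \<in> V \<Longrightarrow> w \<in> V \<Longrightarrow> a (\<lambda>x. u x + c *\<^sub>R v x) w = a u w + c * a v w"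
    and sym: "\<And>u v. u \<in> V \<Longrightarrow> v \<in> V \<Longrightarrow> a u v = a v u"
    and pos: "\<And>u. u \<in> V \<Longrightarrow> 0 \<le> a u u"
    and complete: "\<And>s. (\<And>n. s n \<in> H) \<Longrightarrow>
          (\<And>e. e > 0 \<Longrightarrow> \<exists>N. \<forall>m\<ge>N. \<forall>n\<ge>N. a (\<lambda>x. s m x - s n x) (\<lambda>x. s m x - s n x) < e) \<Longrightarrow>
          \<exists>h\<in>H. (\<lambda>n. a (\<lambda>x. s n x - h x) (\<lambda>x. s n x - h x)) \<longlonglongrightarrow> 0"
    and f: "f \<in> V"
  obtains p where "p \<in> H" "\<forall>h\<in>H. a (\<lambda>x. f x - p x) h = 0"
proof -
  define Q where "Q u = a u u" for u
  have diffV: "(\<lambda>x. u x - v x) \<in> V" if "u \<in> V" "v \<in> V" for u v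
    using V[OF that, of "-1"] by simp
  have HV: "h \<in> V" if "h \<in> H" for h using that \<open>H \<subseteq> V\<close> by blast
  have Qadd: "Q (\<lambda>x. u x + c *\<^sub>R v x) = Q u + 2 * c * a u v + c\<^sup>2 * Q v" if "u \<in> V" "v \<in> V" for u v c
  proof -
    have w: "(\<lambda>x. u x + c *\<^sub>R v x) \<in> V" by (intro V that)
    have "Q (\<lambda>x. u x + c *\<^sub>R v x) = a u (\<lambda>x. u x + c *\<^sub>R v x) + c * a v (\<lambda>x. u x + c *\<^sub>R v x)"
      unfolding Q_def by (intro lin that w)
    also have "\<dots> = a (\<lambda>x. u x + c *\<^sub>R v x) u + c * a (\<lambda>x. u x + c *\<^sub>R v x) v"
      using sym[OF w] that by simp
    also have "\<dots> = Q u + 2 * c * a u v + c\<^sup>2 * Q v"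
      using that sym[of v u] by (simp add: lin Q_def power2_eq_square algebra_simps)
    finally show ?thesis .
  qed
  have Qdiff: "Q (\<lambda>x. u x - v x) = Q u - 2 * a u v + Q v" if "u \<in> V" "v \<in> V" for u v
    using Qadd[OF that, of "-1"] by simp
  have Qpos: "0 \<le> Q u" if "u \<in> V" for u using pos[OF that] by (simp add: Q_def)
  have complete_square: "x + 2 * (- b / q) * b + (- b / q)\<^sup>2 * q = x - b\<^sup>2 / q" if "0 < q" for x b q :: real
    using that by (simp add: field_simps power2_eq_square)
  \<comment> \<open>Cauchy-Schwarz with \<open>Q v + 1\<close> in place of \<open>Q v\<close>:
    weaker, but it avoids a case distinction on \<open>Q v = 0\<close> and suffices for
    limits.\<close>
  have CS: "(a u v)\<^sup>2 \<le> Q u * (Q v + 1)" if "u \<in> V" "v \<in> V" for u v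
  proof -
    let ?q = "Q v + 1" and ?b = "a u v"
    have q: "0 < ?q" using Qpos[OF that(2)] by simp
    have "0 \<le> Q u + 2 * (- ?b / ?q) * ?b + (- ?b / ?q)\<^sup>2 * Q v"
      using Qpos[OF V[OF that, of "- ?b / ?q"]] Qadd[OF that, of "- ?b / ?q"] by simp
    also have "\<dots> \<le> Q u + 2 * (- ?b / ?q) * ?b + (- ?b / ?q)\<^sup>2 * ?q"
      by (intro add_left_mono mult_left_mono) auto
    also have "\<dots> = Q u - ?b\<^sup>2 / ?q"
      by (rule complete_square[OF q])
    finally show ?thesis using q by (simp add: field_simps)
  qed
  define D where "D = (INF h\<in>H. Q (\<lambda>x. f x - h x))"
  have bdd: "bdd_below ((\<lambda>h. Q (\<lambda>x. f x - h x)) ` H)"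
    by (rule bdd_belowI[of _ 0]) (use Qpos[OF diffV[OF f HV]] in blast)
  have D_le: "D \<le> Q (\<lambda>x. f x - h x)" if "h \<in> H" for h
    unfolding D_def by (rule cINF_lower[OF bdd that])
  have "\<exists>h\<in>H. Q (\<lambda>x. f x - h x) < D + 1 / (real n + 1)" for n
  proof (rule ccontr)
    assume "\<not> ?thesis"
    then have "D + 1 / (real n + 1) \<le> D"
      unfolding D_def by (intro cINF_greatest) (use zero in \<open>auto simp: not_less\<close>)
    then show False by (simp add: field_simps)
  qed
  then have "\<forall>n. \<exists>h. h \<in> H \<and> Q (\<lambda>x. f x - h x) < D + 1 / (real n + 1)" by blast
  from choice[OF this] obtain s where
    s: "\<And>n. s n \<in> H" "\<And>n. Q (\<lambda>x. f x - s n x) < D + 1 / (real n + 1)" by blast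
  have par: "Q (\<lambda>x. s m x - s n x) \<le> 2 / (real m + 1) + 2 / (real n + 1)" for m n
  proof -
    define U W where "U = (\<lambda>x. f x - s m x)" and "W = (\<lambda>x. f x - s n x)"
    have UW: "U \<in> V" "W \<in> V" unfolding U_def W_def by (intro diffV f HV s)+
    \<comment> \<open>The midpoint of two near-minimisers lies in H, so its distance is at least D;
      the parallelogram law then makes the minimising sequence Cauchy.\<close>
    define mid where "mid = (\<lambda>x. 0 + (1/2) *\<^sub>R (s m x + 1 *\<^sub>R s n x))"
    have mid: "mid \<in> H" unfolding mid_def by (intro H zero s)
    define v where "v = (\<lambda>x. f x - mid x)"
    have v: "v \<in> V" unfolding v_def by (intro diffV f HV mid)
    have e: "(\<lambda>x. U x + 1 *\<^sub>R W x) = (\<lambda>x. v x + 1 *\<^sub>R v x)"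
    proof
      fix x
      have "(1/2) *\<^sub>R (s m x + s n x) + (1/2) *\<^sub>R (s m x + s n x) = s m x + s n x"
        by (simp flip: scaleR_add_left)
      then show "U x + 1 *\<^sub>R W x = v x + 1 *\<^sub>R v x"
        unfolding U_def W_def v_def mid_def by (simp add: algebra_simps)
    qed
    have "Q (\<lambda>x. s m x - s n x) = Q (\<lambda>x. W x - U x)"
      by (simp add: U_def W_def)
    also have "\<dots> = 2 * Q U + 2 * Q W - 4 * Q v"
      using Qadd[OF UW, of 1] Qadd[OF v v, of 1] Qdiff[OF UW(2,1)] sym[OF UW] e
      by (simp add: Q_def)
    also have "\<dots> \<le> 2 / (real m + 1) + 2 / (real n + 1)"
      using s(2)[of m] s(2)[of n] D_le[OF mid] by (simp add: U_def W_def v_def)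
    finally show ?thesis .
  qed
  have "\<exists>h\<in>H. (\<lambda>n. a (\<lambda>x. s n x - h x) (\<lambda>x. s n x - h x)) \<longlonglongrightarrow> 0"
  proof (rule complete)
    fix e :: real assume "e > 0"
    obtain N :: nat where N: "4 / e < real N"
      using reals_Archimedean2 by blast
    have "Q (\<lambda>x. s m x - s n x) < e" if "m \<ge> N" "n \<ge> N" for m n
    proof -
      have "0 < real N" using N \<open>e > 0\<close> by (smt (z3) divide_pos_pos)
      have "2 / (real m + 1) \<le> 2 / real N" "2 / (real n + 1) \<le> 2 / real N"
        using that \<open>0 < real N\<close> by (auto intro!: divide_left_mono)
      then have "Q (\<lambda>x. s m x - s n x) \<le> 4 / real N"
        using par[of m n] by simp
      also have "\<dots> < e"
        using N \<open>e > 0\<close> \<open>0 < real N\<close> by (simp add: field_simps)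
      finally show ?thesis .
    qed
    then show "\<exists>N. \<forall>m\<ge>N. \<forall>n\<ge>N. a (\<lambda>x. s m x - s n x) (\<lambda>x. s m x - s n x) < e"
      unfolding Q_def by blast
  qed (rule s)
  then obtain p where p: "p \<in> H" "(\<lambda>n. Q (\<lambda>x. s n x - p x)) \<longlonglongrightarrow> 0"
    unfolding Q_def by blast
  have "a (\<lambda>x. f x - p x) h = 0" if h: "h \<in> H" for h
  proof -
    define b where "b = a (\<lambda>x. f x - p x) h"
    have lim: "(\<lambda>n. a (\<lambda>x. s n x - p x) h) \<longlonglongrightarrow> 0"
    proof -
      have "(\<lambda>n. (a (\<lambda>x. s n x - p x) h)\<^sup>2) \<longlonglongrightarrow> 0"
      proof (rule tendsto_sandwich[of "\<lambda>_. 0"])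
        show "(\<lambda>n. Q (\<lambda>x. s n x - p x) * (Q h + 1)) \<longlonglongrightarrow> 0"
          using tendsto_mult_right[OF p(2), of "Q h + 1"] by simp
        show "\<forall>\<^sub>F n in sequentially. (a (\<lambda>x. s n x - p x) h)\<^sup>2 \<le> Q (\<lambda>x. s n x - p x) * (Q h + 1)"
          by (intro always_eventually allI CS diffV HV s p h)
      qed (auto intro: always_eventually)
      then show ?thesis by simp
    qed
    \<comment> \<open>First variation at the minimiser. The minimality of D is tested along
      \<open>s n\<close>, which is optimal up to 1/(n+1), and the inequality is passed to the
      limit.\<close>
    have key: "0 \<le> 2 * t * b + t\<^sup>2 * Q h" for t
    proof (rule LIMSEQ_le_const)
      show "(\<lambda>n. 1 / (real n + 1) + 2 * t * (b - a (\<lambda>x. s n x - p x) h) + t\<^sup>2 * Q h)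
              \<longlonglongrightarrow> 2 * t * b + t\<^sup>2 * Q h"
      proof -
        have "(\<lambda>n. 1 / (real n + 1)) \<longlonglongrightarrow> 0"
          using LIMSEQ_inverse_real_of_nat by (simp add: inverse_eq_divide add.commute)
        from tendsto_add[OF tendsto_add[OF this tendsto_mult_left[OF tendsto_diff[OF tendsto_const[of b] lim], of "2*t"]]
            tendsto_const[of "t\<^sup>2 * Q h"]]
        show ?thesis by simp
      qed
      have "0 \<le> 1 / (real n + 1) + 2 * t * (b - a (\<lambda>x. s n x - p x) h) + t\<^sup>2 * Q h" for n
      proof -
        have fs: "(\<lambda>x. f x - s n x) \<in> V" "(\<lambda>x. s n x - p x) \<in> V" "h \<in> V"
          by (intro diffV f HV s h p)+
        have "b = a (\<lambda>x. (f x - s n x) + 1 *\<^sub>R (s n x - p x)) h"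
          by (simp add: b_def)
        also have "\<dots> = a (\<lambda>x. f x - s n x) h + 1 * a (\<lambda>x. s n x - p x) h"
          by (rule lin[OF fs])
        finally have b: "a (\<lambda>x. f x - s n x) h = b - a (\<lambda>x. s n x - p x) h" by simp
        have "D \<le> Q (\<lambda>x. f x - (s n x + (- t) *\<^sub>R h x))"
          by (intro D_le H s h)
        also have "\<dots> = Q (\<lambda>x. (f x - s n x) + t *\<^sub>R h x)"
          by (simp add: algebra_simps)
        also have "\<dots> = Q (\<lambda>x. f x - s n x) + 2 * t * a (\<lambda>x. f x - s n x) h + t\<^sup>2 * Q h"
          by (rule Qadd[OF fs(1,3)])
        finally show ?thesis using s(2)[of n] b by simp
      qed
      then show "\<exists>N. \<forall>n\<ge>N. 0 \<le> 1 / (real n + 1) + 2 * t * (b - a (\<lambda>x. s n x - p x) h) + t\<^sup>2 * Q h"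
        by blast
    qed
    let ?q = "Q h + 1"
    have q: "0 < ?q" using Qpos[OF HV[OF h]] by simp
    \<comment> \<open>t = -b/(Q h + 1) would minimise the quadratic with Q h + 1 for Q h, and the
      value is then -b^2/(Q h + 1). It is defined even when h is a null vector.\<close>
    have "0 \<le> 2 * (- b / ?q) * b + (- b / ?q)\<^sup>2 * Q h" by (rule key)
    also have "\<dots> \<le> 2 * (- b / ?q) * b + (- b / ?q)\<^sup>2 * ?q"
      by (intro add_left_mono mult_left_mono) auto
    also have "\<dots> = - (b\<^sup>2 / ?q)"
      using complete_square[OF q, of 0 b] by simp
    finally have "b\<^sup>2 \<le> 0" using q by (simp add: field_simps)
    then show ?thesis by (simp add: b_def)
  qed
  then have "\<forall>h\<in>H. a (\<lambda>x. f x - p x) h = 0" by blast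
  with p(1) show thesis by (rule that)
qed

section \<open>Integration by parts for periodic functions\<close>

text \<open>The shifted cell is cut at the face where the i-th coordinate is 1, and periodicity
  moves the overhang back to the other end.\<close>

lemma integral_cell_shift:
  fixes u :: "real^2 \<Rightarrow> real"
  assumes cont: "continuous_on UNIV u" and "periodic u" and h: "0 \<le> h" "h \<le> 1"
  shows "integral period_cell (\<lambda>x. u (x + h *\<^sub>R axis i 1)) = integral period_cell u"
proof -
  let ?v = "axis i 1 :: real^2"
  \<comment> \<open>The unit cell with its i-th side replaced by the interval from s to t.\<close>
  define slab where "slab s t = cbox (s *\<^sub>R ?v) (1 + (t - 1) *\<^sub>R ?v)" for s t :: real
  have "(s *\<^sub>R ?v) $ j = (if j = i then s else 0)" "(1 + (t - 1) *\<^sub>R ?v) $ j = (if j = i then t else 1)" for s t j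
    by (auto simp: axis_def)
  then have mem_slab: "x \<in> slab s t \<longleftrightarrow> s \<le> x $ i \<and> x $ i \<le> t \<and> (\<forall>j. j \<noteq> i \<longrightarrow> 0 \<le> x $ j \<and> x $ j \<le> 1)" for x s t
    unfolding slab_def mem_box_cart by (auto split: if_splits)
  have per: "u (x + ?v) = u x" for x
    using \<open>periodic u\<close> by (simp add: periodic_def)
  have shift: "integral (slab s t) (\<lambda>x. u (x + c *\<^sub>R ?v)) = integral (slab (s + c) (t + c)) u" for s t c
  proof -
    have "(u has_integral integral (slab (s + c) (t + c)) u) (slab (s + c) (t + c))"
      unfolding slab_def
      by (intro integrable_integral integrable_continuous continuous_on_subset[OF cont]) simp
    then have "((\<lambda>x. u (1 *\<^sub>R x + c *\<^sub>R ?v)) has_integral (integral (slab (s + c) (t + c)) u /\<^sub>R 1 ^ DIM(real^2)))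
         (cbox (((s + c) *\<^sub>R ?v - c *\<^sub>R ?v) /\<^sub>R 1) (((1 + (t + c - 1) *\<^sub>R ?v) - c *\<^sub>R ?v) /\<^sub>R 1))"
      unfolding slab_def by (subst has_integral_affinity_iff) auto
    moreover have "1 + (t + c - 1) *\<^sub>R ?v - c *\<^sub>R ?v = 1 + (t - 1) *\<^sub>R ?v"
      by (simp add: algebra_simps)
    ultimately show ?thesis
      by (simp add: integral_unique slab_def algebra_simps)
  qed
  have split: "integral (slab s t) u = integral (slab s c) u + integral (slab c t) u"
    if "s \<le> c" "c \<le> t" for s c t
  proof -
    have "?v \<in> Basis" by (simp add: axis_in_Basis_iff)
    then have "integral (slab s t) u = integral (slab s t \<inter> {x. x \<bullet> ?v \<le> c}) u + integral (slab s t \<inter> {x. x \<bullet> ?v \<ge> c}) u"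
      unfolding slab_def
      by (intro integral_split integrable_continuous continuous_on_subset[OF cont]) auto
    moreover have "slab s t \<inter> {x. x \<bullet> ?v \<le> c} = slab s c" "slab s t \<inter> {x. x \<bullet> ?v \<ge> c} = slab c t"
      using that
      by (auto simp: mem_slab inner_axis)
    ultimately show ?thesis by simp
  qed
  have cell: "period_cell = slab 0 1" by (simp add: slab_def period_cell_def)
  have "integral period_cell (\<lambda>x. u (x + h *\<^sub>R ?v)) = integral (slab h (1 + h)) u"
    using shift[of 0 1 h] by (simp add: cell add.commute)
  also have "\<dots> = integral (slab h 1) u + integral (slab 1 (1 + h)) u"
    using h by (intro split) auto
  also have "integral (slab 1 (1 + h)) u = integral (slab 0 h) u"
    using shift[of 0 h 1] per by (simp add: add.commute)
  also have "integral (slab h 1) u + integral (slab 0 h) u = integral period_cell u"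
    using split[of 0 h 1] h by (simp add: cell)
  finally show ?thesis .
qed

lemma lebesgue_integral_cell_eq:
  fixes f :: "real^2 \<Rightarrow> real"
  assumes "continuous_on UNIV f"
  shows "(LINT x|cell_measure. f x) = integral period_cell f"
  by (intro lebesgue_integral_eq_integral L2_cell_integrable L2_cell_continuous assms)
    (simp add: fmeasurableD lmeasurable_period_cell)

lemma partial_deriv_line:
  assumes "\<And>x. f differentiable (at x)"
  shows "((\<lambda>t. f (x + t *\<^sub>R axis i 1)) has_real_derivative partial_deriv i f (x + t *\<^sub>R axis i 1)) (at t)"
proof -
  have "(f has_derivative frechet_derivative f (at (x + t *\<^sub>R axis i 1))) (at (x + t *\<^sub>R axis i 1))"
    using assms frechet_derivative_works by blast
  moreover have "((\<lambda>t. x + t *\<^sub>R axis i 1) has_derivative (\<lambda>s. s *\<^sub>R axis i 1)) (at t)"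
    by (auto intro!: derivative_eq_intros)
  ultimately have "((\<lambda>t. f (x + t *\<^sub>R axis i 1)) has_derivative
      (\<lambda>s. frechet_derivative f (at (x + t *\<^sub>R axis i 1)) (s *\<^sub>R axis i 1))) (at t)"
    by (rule has_derivative_compose[rotated])
  moreover have "linear (frechet_derivative f (at (x + t *\<^sub>R axis i 1)))"
    using assms linear_frechet_derivative by blast
  then have "(\<lambda>s. frechet_derivative f (at (x + t *\<^sub>R axis i 1)) (s *\<^sub>R axis i 1))
      = (*) (partial_deriv i f (x + t *\<^sub>R axis i 1))"
    by (simp add: fun_eq_iff partial_deriv_def linear_scale)
  ultimately show ?thesis
    by (simp add: has_field_derivative_def)
qed

lemma partial_deriv_eqI:
  "(f has_derivative f') (at x) \<Longrightarrow> partial_deriv i f x = f' (axis i 1)"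
  unfolding partial_deriv_def using frechet_derivative_at by metis

lemma partial_deriv_mult:
  assumes "f differentiable (at x)" "g differentiable (at x)"
  shows "partial_deriv i (\<lambda>x. f x * g x) x = f x * partial_deriv i g x + partial_deriv i f x * g x"
  using has_derivative_mult[OF assms[unfolded frechet_derivative_works]]
  unfolding partial_deriv_def[of i f] partial_deriv_def[of i g] by (rule partial_deriv_eqI)

text \<open>Difference quotients integrate to zero by shift invariance, and dominated convergence
  carries this to the derivative. No iterated integrals are involved.\<close>

lemma integral_partial_deriv_periodic:
  assumes diff: "\<And>x. u differentiable (at x)" and cont: "continuous_on UNIV (partial_deriv i u)"
    and "periodic u"
  shows "(LINT x|cell_measure. partial_deriv i u x) = 0"
proof -
  let ?v = "axis i 1 :: real^2"
  define h where "h n = 1 / (real n + 1)" for n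
  have h: "0 < h n" "h n \<le> 1" for n by (auto simp: h_def)
  have h0: "h \<longlonglongrightarrow> 0"
    unfolding h_def using LIMSEQ_inverse_real_of_nat by (simp add: inverse_eq_divide add.commute)
  have ucont: "continuous_on UNIV u"
    using diff by (simp add: continuous_on_eq_continuous_at differentiable_imp_continuous_within)
  define q where "q n x = (u (x + h n *\<^sub>R ?v) - u x) / h n" for n x
  have qcont: "continuous_on UNIV (q n)" for n
    unfolding q_def using h(1)[of n]
    by (intro continuous_intros continuous_on_compose2[OF ucont]) auto
  have shcont: "continuous_on UNIV (\<lambda>x. u (x + h n *\<^sub>R ?v))" for n
    by (intro continuous_intros continuous_on_compose2[OF ucont]) auto
  have q0: "(LINT x|cell_measure. q n x) = 0" for n
  proof -
    have "(LINT x|cell_measure. q n x)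
        = ((LINT x|cell_measure. u (x + h n *\<^sub>R ?v)) - (LINT x|cell_measure. u x)) / h n"
      unfolding q_def
      by (simp add: L2_cell_integrable[OF L2_cell_continuous] ucont shcont)
    also have "\<dots> = 0"
      using integral_cell_shift[OF ucont \<open>periodic u\<close>, of "h n" i] h[of n]
      by (simp add: lebesgue_integral_cell_eq ucont shcont)
    finally show ?thesis .
  qed
  \<comment> \<open>The mean value theorem evaluates the derivative up to distance 1 outside the
    cell, so the bound is taken on a box of side 2.\<close>
  obtain C where C: "\<And>x. x \<in> cbox 0 2 \<Longrightarrow> \<bar>partial_deriv i u x\<bar> \<le> C"
  proof -
    have "compact (partial_deriv i u ` cbox 0 2)"
      by (intro compact_continuous_image continuous_on_subset[OF cont]) auto
    then show thesis
      using that by (metis bounded_iff compact_imp_bounded imageI real_norm_def)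
  qed
  have qC: "\<bar>q n x\<bar> \<le> C" if "x \<in> period_cell" for n x
  proof -
    obtain z where z: "0 < z" "z < h n"
      "u (x + h n *\<^sub>R ?v) - u (x + 0 *\<^sub>R ?v) = (h n - 0) * partial_deriv i u (x + z *\<^sub>R ?v)"
      using MVT2[of 0 "h n" "\<lambda>t. u (x + t *\<^sub>R ?v)" "\<lambda>t. partial_deriv i u (x + t *\<^sub>R ?v)"]
        partial_deriv_line[OF diff] h[of n] by blast
    have "x + z *\<^sub>R ?v \<in> cbox 0 2"
      using that z h(2)[of n]
      by (auto simp: period_cell_def mem_box_cart axis_def intro: order_trans[OF _ one_le_numeral]) (smt (z3))+
    then show ?thesis
      using C z h(1)[of n] by (simp add: q_def)
  qed
  have qlim: "(\<lambda>n. q n x) \<longlonglongrightarrow> partial_deriv i u x" for x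
  proof -
    have "((\<lambda>s. (u (x + s *\<^sub>R ?v) - u x) / s) \<longlongrightarrow> partial_deriv i u x) (at 0)"
      using partial_deriv_line[OF diff, of x i 0] by (simp add: DERIV_def)
    moreover have "filterlim h (at 0) sequentially"
      using h0 by (simp add: filterlim_at h_def)
    ultimately show ?thesis
      unfolding q_def by (rule filterlim_compose)
  qed
  have "(\<lambda>n. LINT x|cell_measure. q n x) \<longlonglongrightarrow> (LINT x|cell_measure. partial_deriv i u x)"
  proof (rule integral_dominated_convergence[where w="\<lambda>_. C"])
    show "AE x in cell_measure. norm (q n x) \<le> C" for n
      using qC by (auto intro!: AE_I2)
  qed (use qlim in \<open>auto intro!: continuous_measurable_cell qcont cont\<close>)
  then show ?thesis
    by (simp add: q0 LIMSEQ_const_iff)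
qed

lemma smooth_differentiable: "smooth f \<Longrightarrow> f differentiable (at x)"
  unfolding smooth_def by (auto dest: spec[of _ "[]"])

lemma smooth_partial_deriv:
  assumes "smooth f" shows "smooth (partial_deriv i f)"
  unfolding smooth_def
proof (intro allI)
  fix ks x
  have "fold partial_deriv (i # ks) f differentiable (at x)"
    using assms unfolding smooth_def by blast
  then show "fold partial_deriv ks (partial_deriv i f) differentiable (at x)"
    by simp
qed

lemma smooth_continuous: "smooth f \<Longrightarrow> continuous_on UNIV f"
  using smooth_differentiable
  by (simp add: continuous_on_eq_continuous_at differentiable_imp_continuous_within)

section \<open>The Hartley basis\<close>

definition phase :: "int^2 \<Rightarrow> real^2 \<Rightarrow> real" where
  "phase k x = 2 * pi * (\<Sum>i\<in>UNIV. of_int (k $ i) * x $ i)"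

text \<open>
  The functions \<open>cos + sin\<close> form a real orthonormal basis of \<open>L\<^sup>2\<close> that is stable, up to scalars and
  \<open>k \<mapsto> -k\<close>, under partial derivatives and under products; this avoids complex coefficients.
\<close>

definition hartley :: "int^2 \<Rightarrow> real^2 \<Rightarrow> real" where
  "hartley k x = cos (phase k x) + sin (phase k x)"

definition hcoef :: "(real^2 \<Rightarrow> real) \<Rightarrow> int^2 \<Rightarrow> real" where
  "hcoef f k = (LINT x|cell_measure. f x * hartley k x)"

lemma phase_minus [simp]: "phase (- k) x = - phase k x"
  by (simp add: phase_def sum_negf)

lemma phase_add: "phase (k + l) x = phase k x + phase l x"
  by (simp add: phase_def algebra_simps sum.distrib)

lemma phase_add_right: "phase k (x + y) = phase k x + phase k y"
  by (simp add: phase_def algebra_simps sum.distrib)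

lemma phase_0 [simp]: "phase 0 x = 0"
  by (simp add: phase_def)

lemma hartley_0 [simp]: "hartley 0 x = 1"
  by (simp add: hartley_def)

lemma phase_has_derivative: "(phase k has_derivative phase k) (at x)"
  unfolding phase_def[abs_def]
  by (auto intro!: derivative_eq_intros bounded_linear_imp_has_derivative[OF bounded_linear_vec_nth])

lemma phase_axis [simp]: "phase k (axis i 1) = 2 * pi * of_int (k $ i)"
  by (simp add: phase_def axis_def if_distrib cong: if_cong)

text \<open>The derivative of cos s + sin s is cos s - sin s, the Hartley function of the opposite
  frequency. Every \<open>- k\<close> in the later coefficient identities originates here.\<close>

lemma hartley_has_derivative:
  "(hartley k has_derivative (\<lambda>v. phase k v * hartley (- k) x)) (at x)"
  unfolding hartley_def[abs_def]
  by (auto intro!: derivative_eq_intros phase_has_derivative simp: hartley_def algebra_simps)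

lemma partial_deriv_hartley:
  "partial_deriv i (\<lambda>x. c * hartley k x) = (\<lambda>x. (c * (2 * pi * of_int (k $ i))) * hartley (- k) x)"
proof
  fix x
  have "((\<lambda>x. c * hartley k x) has_derivative (\<lambda>v. c * (phase k v * hartley (- k) x))) (at x)"
    by (auto intro!: derivative_eq_intros hartley_has_derivative)
  from partial_deriv_eqI[OF this]
  show "partial_deriv i (\<lambda>x. c * hartley k x) x = (c * (2 * pi * of_int (k $ i))) * hartley (- k) x"
    by simp
qed

lemma smooth_hartley: "smooth (hartley k)"
proof -
  have "\<exists>c' k'. fold partial_deriv ks (\<lambda>x. c * hartley k x) = (\<lambda>x. c' * hartley k' x)" for ks c k
  proof (induction ks arbitrary: c k)
    case (Cons i ks)
    then show ?case by (simp add: partial_deriv_hartley)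
  qed auto
  from this[of _ 1 k] have fold: "\<exists>c' k'. fold partial_deriv ks (hartley k) = (\<lambda>x. c' * hartley k' x)" for ks
    by simp
  have "(\<lambda>x. c * hartley l x) differentiable (at x)" for c l x
    by (intro differentiable_mult differentiable_const)
      (use hartley_has_derivative differentiable_def in blast)
  then show ?thesis
    unfolding smooth_def using fold by (intro allI) metis
qed

lemma periodic_hartley: "periodic (hartley k)"
proof -
  have "phase k (x + axis i 1) = phase k x + 2 * pi * of_int (k $ i)" for x i
    by (simp add: phase_add_right)
  then have "sin (phase k (x + axis i 1)) = sin (phase k x) \<and> cos (phase k (x + axis i 1)) = cos (phase k x)" for x i
    using sin_cos_eq_iff by blast
  then show ?thesis by (simp add: periodic_def hartley_def)
qed

lemma continuous_hartley: "continuous_on UNIV (hartley k)"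
  by (rule smooth_continuous[OF smooth_hartley])

lemma hartley_measurable [measurable]: "hartley k \<in> borel_measurable cell_measure"
  by (rule continuous_measurable_cell[OF continuous_hartley])

lemma L2_hartley: "L2_cell (hartley k)"
  by (rule L2_cell_continuous[OF continuous_hartley])

text \<open>Integration by parts: the derivative of the periodic product f times
  \<open>hartley k\<close> has integral zero.\<close>

lemma hcoef_partial_deriv:
  assumes "smooth f" "periodic f"
  shows "hcoef (partial_deriv i f) k = - (2 * pi * of_int (k $ i)) * hcoef f (- k)"
proof -
  let ?d = "\<lambda>x. f x * ((2 * pi * of_int (k $ i)) * hartley (- k) x) + partial_deriv i f x * hartley k x"
  have d: "partial_deriv i (\<lambda>x. f x * hartley k x) = ?d"
    using partial_deriv_mult[OF smooth_differentiable[OF assms(1)] smooth_differentiable[OF smooth_hartley], of i]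
      partial_deriv_hartley[of i 1 k] by (auto simp: fun_eq_iff)
  have c: "continuous_on UNIV f" "continuous_on UNIV (partial_deriv i f)"
    by (auto intro: smooth_continuous smooth_partial_deriv assms)
  have "(LINT x|cell_measure. ?d x) = 0"
    unfolding d[symmetric]
  proof (rule integral_partial_deriv_periodic)
    show "(\<lambda>x. f x * hartley k x) differentiable (at x)" for x
      by (intro differentiable_mult smooth_differentiable assms smooth_hartley)
    show "continuous_on UNIV (partial_deriv i (\<lambda>x. f x * hartley k x))"
      unfolding d by (intro continuous_intros c continuous_hartley)
    show "periodic (\<lambda>x. f x * hartley k x)"
      using assms(2) periodic_hartley by (simp add: periodic_def)
  qed
  moreover have "(LINT x|cell_measure. ?d x)
    = (LINT x|cell_measure. (2 * pi * of_int (k $ i)) * (f x * hartley (- k) x))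
      + (LINT x|cell_measure. partial_deriv i f x * hartley k x)"
    by (subst Bochner_Integration.integral_add[symmetric])
      (auto intro!: L2_cell_integrable L2_cell_continuous continuous_intros c continuous_hartley simp: algebra_simps)
  ultimately show ?thesis by (simp add: hcoef_def)
qed

lemma integral_hartley: "(LINT x|cell_measure. hartley k x) = (if k = 0 then 1 else 0)"
proof (cases "k = 0")
  case False
  then obtain i where i: "k $ i \<noteq> 0" by (auto simp: vec_eq_iff)
  have "smooth (\<lambda>_. 1)" "periodic (\<lambda>_. 1 :: real)"
    using smooth_hartley[of 0] by (simp_all add: periodic_def hartley_0[abs_def])
  \<comment> \<open>Applied to the constant 1 at frequency -k, the rule reads 0 = 2 pi k_i times the
    integral of \<open>hartley k\<close>.\<close>
  from hcoef_partial_deriv[OF this, of i "- k"] i show ?thesis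
    using False by (simp add: hcoef_def partial_deriv_def)
qed simp

text \<open>The product is cos(a - b) + sin(a + b) for the two phases a and b. The even part of a
  Hartley function gives the cosine, the odd part the sine.\<close>

lemma hartley_mult:
  "hartley k x * hartley l x
    = (hartley (k - l) x + hartley (l - k) x + hartley (k + l) x - hartley (- k - l) x) / 2"
proof -
  have *: "phase (k - l) x = phase k x - phase l x" "phase (l - k) x = phase l x - phase k x"
    "phase (- k - l) x = - phase k x - phase l x"
    using phase_add[of k "- l" x] phase_add[of l "- k" x] phase_add[of "- k" "- l" x] by simp_all
  show ?thesis
    unfolding hartley_def * phase_add
    by (simp add: cos_add sin_add cos_diff sin_diff algebra_simps)
qed

lemma hartley_orthonormal:
  "(LINT x|cell_measure. hartley k x * hartley l x) = (if k = l then 1 else 0)"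
proof -
  have "(LINT x|cell_measure. hartley k x * hartley l x)
     = ((if k = l then 1 else 0) + (if l = k then 1 else 0) + (if k + l = 0 then 1 else 0)
        - (if - k - l = 0 then 1 else 0)) / 2"
    unfolding hartley_mult by (simp add: integral_hartley L2_cell_integrable[OF L2_hartley])
  moreover have "- k - l = 0 \<longleftrightarrow> k + l = 0"
    by (simp add: neg_eq_iff_add_eq_0)
  ultimately show ?thesis by (simp add: eq_commute[of l k])
qed

section \<open>Completeness of the Hartley basis\<close>

inductive trig :: "(real^2 \<Rightarrow> real) \<Rightarrow> bool" where
  trig_hartley: "trig (hartley k)"
| trig_lincomb: "trig p \<Longrightarrow> trig q \<Longrightarrow> trig (\<lambda>x. p x + c * q x)"

lemma trig_continuous: "trig p \<Longrightarrow> continuous_on UNIV p"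
  by (induction rule: trig.induct) (auto intro!: continuous_intros continuous_hartley)

lemma trig_const: "trig (\<lambda>x. c)"
  using trig_lincomb[OF trig_hartley[of 0] trig_hartley[of 0], of "c - 1"] by simp

lemma trig_add: "trig p \<Longrightarrow> trig q \<Longrightarrow> trig (\<lambda>x. p x + q x)"
  using trig_lincomb[of p q 1] by simp

lemma trig_cmult: "trig p \<Longrightarrow> trig (\<lambda>x. c * p x)"
  using trig_lincomb[OF trig_const[of 0], of p c] by simp

lemma trig_diff: "trig p \<Longrightarrow> trig q \<Longrightarrow> trig (\<lambda>x. p x - q x)"
  using trig_lincomb[of p q "-1"] by simp

text \<open>Makes \<open>trig\<close> an algebra, so that polynomials in a trigonometric function
  stay trigonometric; this is what the one-variable Weierstrass theorem is applied to.\<close>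

lemma trig_mult:
  assumes "trig p" "trig q" shows "trig (\<lambda>x. p x * q x)"
  using assms(1)
proof induction
  case (trig_hartley k)
  show ?case using assms(2)
  proof induction
    case (trig_hartley l)
    have "trig (\<lambda>x. (1/2) * (hartley (k - l) x + hartley (l - k) x + hartley (k + l) x - hartley (- k - l) x))"
      by (intro trig_cmult trig_add trig_diff trig.trig_hartley)
    then show ?case by (simp add: hartley_mult)
  next
    case (trig_lincomb p q c)
    have "trig (\<lambda>x. hartley k x * p x + c * (hartley k x * q x))"
      by (intro trig.trig_lincomb trig_lincomb.IH)
    then show ?case by (simp add: algebra_simps)
  qed
next
  case (trig_lincomb p r c)
  have "trig (\<lambda>x. p x * q x + c * (r x * q x))"
    by (intro trig.trig_lincomb trig_lincomb.IH)
  then show ?case by (simp add: algebra_simps)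
qed

lemma trig_polynomial:
  assumes "real_polynomial_function (q :: real \<Rightarrow> real)" "trig p"
  shows "trig (\<lambda>x. q (p x))"
  using assms(1)
proof induction
  case (linear f)
  then obtain c where "f = (\<lambda>x. x * c)" by (auto simp: real_bounded_linear)
  then show ?case using trig_cmult[OF assms(2), of c] by (simp add: mult.commute)
qed (auto intro: trig_const trig_add trig_mult)

text \<open>A shifted cosine bump in one coordinate; its superlevel sets in the cell are the slabs
  from which half-spaces are obtained.\<close>

lemma trig_shifted_cos: "trig (\<lambda>x. cos (2 * pi * (x $ i - c)))"
proof -
  let ?k = "axis i 1 :: int^2"
  have ph: "phase ?k x = 2 * pi * x $ i" for x
    by (simp add: phase_def axis_def if_distrib if_distribR cong: if_cong)
  have "trig (\<lambda>x. ((cos (2 * pi * c)) / 2) * (hartley ?k x + hartley (- ?k) x)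
                + (sin (2 * pi * c) / 2) * (hartley ?k x - hartley (- ?k) x))"
    by (intro trig_add trig_cmult trig_diff trig_hartley)
  also have "(\<lambda>x. ((cos (2 * pi * c)) / 2) * (hartley ?k x + hartley (- ?k) x)
                + (sin (2 * pi * c) / 2) * (hartley ?k x - hartley (- ?k) x))
      = (\<lambda>x. cos (2 * pi * (x $ i - c)))"
    by (simp add: fun_eq_iff hartley_def ph right_diff_distrib cos_diff)
  finally show ?thesis .
qed

section \<open>Functions orthogonal to all trigonometric polynomials\<close>

definition trig_orth :: "(real^2 \<Rightarrow> real) \<Rightarrow> bool" where
  "trig_orth f \<longleftrightarrow> integrable cell_measure f \<and> (\<forall>p. trig p \<longrightarrow> (LINT x|cell_measure. f x * p x) = 0)"

lemma integrable_times_trig: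
  assumes "integrable cell_measure f" "trig p"
  shows "integrable cell_measure (\<lambda>x. f x * p x)"
proof -
  obtain C where C: "\<And>x. x \<in> period_cell \<Longrightarrow> \<bar>p x\<bar> \<le> C"
    using continuous_bounded_cell[OF trig_continuous[OF assms(2)]] by auto
  have [measurable]: "p \<in> borel_measurable cell_measure"
    by (intro continuous_measurable_cell trig_continuous assms)
  have [measurable]: "f \<in> borel_measurable cell_measure"
    using assms(1) by blast
  show ?thesis
  proof (rule Bochner_Integration.integrable_bound)
    show "integrable cell_measure (\<lambda>x. C * f x)"
      using assms(1) by simp
    show "AE x in cell_measure. norm (f x * p x) \<le> norm (C * f x)"
    proof (rule AE_I2)
      fix x assume "x \<in> space cell_measure"
      then have "\<bar>p x\<bar> \<le> \<bar>C\<bar>" using C[of x] by simp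
      then have "\<bar>p x\<bar> * \<bar>f x\<bar> \<le> \<bar>C\<bar> * \<bar>f x\<bar>"
        by (rule mult_right_mono) simp
      then show "norm (f x * p x) \<le> norm (C * f x)"
        by (simp only: real_norm_def abs_mult mult.commute)
    qed
  qed measurable
qed

lemma trig_orthI:
  assumes f: "integrable cell_measure f" and 0: "\<And>k. hcoef f k = 0"
  shows "trig_orth f"
  unfolding trig_orth_def
proof (intro conjI allI impI f)
  fix p assume "trig p"
  then show "(LINT x|cell_measure. f x * p x) = 0"
  proof induction
    case (trig_hartley k)
    then show ?case using 0[of k] by (simp add: hcoef_def)
  next
    case (trig_lincomb p q c)
    have "(LINT x|cell_measure. f x * (p x + c * q x))
        = (LINT x|cell_measure. f x * p x + c * (f x * q x))"
      by (simp add: algebra_simps)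
    also have "\<dots> = (LINT x|cell_measure. f x * p x) + c * (LINT x|cell_measure. f x * q x)"
      by (simp add: integrable_times_trig[OF f] trig_lincomb.hyps)
    finally show ?case using trig_lincomb.IH by simp
  qed
qed

text \<open>
  The preserving sets form a \<open>\<sigma>\<close>-algebra that contains the positivity sets of trigonometric
  polynomials, hence half-spaces, hence all measurable sets; this gives completeness of the basis
  with only the Weierstrass theorem in one variable.
\<close>

definition preserving :: "(real^2) set \<Rightarrow> bool" where
  "preserving A \<longleftrightarrow> A \<in> sets cell_measure \<and> (\<forall>f. trig_orth f \<longrightarrow> trig_orth (\<lambda>x. indicator A x * f x))"

lemma trig_orth_cong_AE:
  assumes "trig_orth f" "g \<in> borel_measurable cell_measure" "AE x in cell_measure. f x = g x"
  shows "trig_orth g"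
proof -
  have f: "f \<in> borel_measurable cell_measure" using assms(1) by (auto simp: trig_orth_def)
  show ?thesis
    unfolding trig_orth_def
  proof (intro conjI allI impI)
    show "integrable cell_measure g"
      using assms integrable_cong_AE[OF f assms(2,3)] by (simp add: trig_orth_def)
    fix p assume p: "trig p"
    have "p \<in> borel_measurable cell_measure"
      by (intro continuous_measurable_cell trig_continuous p)
    then have "(LINT x|cell_measure. g x * p x) = (LINT x|cell_measure. f x * p x)"
      using assms f by (intro integral_cong_AE) auto
    then show "(LINT x|cell_measure. g x * p x) = 0"
      using assms(1) p by (simp add: trig_orth_def)
  qed
qed

lemma preserving_AE:
  assumes "preserving A" "B \<in> sets cell_measure" "AE x in cell_measure. x \<in> A \<longleftrightarrow> x \<in> B"
  shows "preserving B"
  unfolding preserving_def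
proof (intro conjI allI impI assms)
  fix f assume f: "trig_orth f"
  then have [measurable]: "f \<in> borel_measurable cell_measure" by (auto simp: trig_orth_def)
  note assms(2) [measurable]
  have "AE x in cell_measure. indicator A x * f x = indicator B x * f x"
    using assms(3) by eventually_elim (auto simp: indicator_def)
  moreover have "trig_orth (\<lambda>x. indicator A x * f x)"
    using assms(1) f by (simp add: preserving_def)
  ultimately show "trig_orth (\<lambda>x. indicator B x * f x)"
    by (elim trig_orth_cong_AE[rotated 2]) measurable
qed

lemma preserving_Int:
  assumes "preserving A" "preserving B" shows "preserving (A \<inter> B)"
  unfolding preserving_def
proof (intro conjI allI impI)
  show "A \<inter> B \<in> sets cell_measure"
    using assms unfolding preserving_def by (intro sets.Int) auto
  fix f assume "trig_orth f"
  then have "trig_orth (\<lambda>x. indicator B x * f x)"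
    using assms(2) by (simp add: preserving_def)
  then have "trig_orth (\<lambda>x. indicator A x * (indicator B x * f x))"
    using assms(1) by (simp add: preserving_def)
  then show "trig_orth (\<lambda>x. indicator (A \<inter> B) x * f x)"
    by (simp add: indicator_inter_arith mult.assoc)
qed

lemma preserving_compl:
  assumes "preserving A" shows "preserving (period_cell - A)"
  unfolding preserving_def
proof (intro conjI allI impI)
  have A [measurable]: "A \<in> sets cell_measure" using assms by (simp add: preserving_def)
  then show m: "period_cell - A \<in> sets cell_measure"
    using sets.compl_sets by force
  fix f assume f: "trig_orth f"
  have Af: "trig_orth (\<lambda>x. indicator A x * f x)"
    using assms f by (simp add: preserving_def)
  have fm: "f \<in> borel_measurable cell_measure" using f by (auto simp: trig_orth_def)
  have "trig_orth (\<lambda>x. f x - indicator A x * f x)"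
    unfolding trig_orth_def
  proof (intro conjI allI impI)
    show "integrable cell_measure (\<lambda>x. f x - indicator A x * f x)"
      using f Af by (simp add: trig_orth_def)
    fix p assume "trig p"
    then show "(LINT x|cell_measure. (f x - indicator A x * f x) * p x) = 0"
      using f Af by (simp add: left_diff_distrib trig_orth_def integrable_times_trig)
  qed
  then show "trig_orth (\<lambda>x. indicator (period_cell - A) x * f x)"
  proof (rule trig_orth_cong_AE)
    show "(\<lambda>x. indicator (period_cell - A) x * f x) \<in> borel_measurable cell_measure"
      using m fm by measurable
    show "AE x in cell_measure. f x - indicator A x * f x = indicator (period_cell - A) x * f x"
      by (rule AE_I2) (simp add: indicator_def)
  qed
qed

text \<open>The family is replaced by its decreasing finite intersections, and the orthogonality
  relations pass to the limit under the majorant |f p|.\<close>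

lemma preserving_INT:
  fixes A :: "nat \<Rightarrow> (real^2) set"
  assumes "\<And>n. preserving (A n)" shows "preserving (\<Inter>n. A n)"
proof -
  define B where "B n = (\<Inter>j\<le>n. A j)" for n
  have B: "preserving (B n)" for n
  proof (induction n)
    case 0 then show ?case using assms by (simp add: B_def)
  next
    case (Suc n)
    have "B (Suc n) = A (Suc n) \<inter> B n" by (auto simp: B_def atMost_Suc)
    then show ?case using assms Suc preserving_Int by simp
  qed
  have Bm [measurable]: "B n \<in> sets cell_measure" for n using B by (simp add: preserving_def)
  have Am: "(\<Inter>n. A n) \<in> sets cell_measure"
    using assms unfolding preserving_def by (intro sets.countable_INT) auto
  show ?thesis
    unfolding preserving_def
  proof (intro conjI allI impI Am)
    fix f assume f: "trig_orth f"
    then have [measurable]: "f \<in> borel_measurable cell_measure" by (auto simp: trig_orth_def)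
    have fi: "integrable cell_measure f" using f by (simp add: trig_orth_def)
    note Am [measurable]
    have int: "integrable cell_measure (\<lambda>x. indicator (\<Inter>n. A n) x * f x)"
      using integrable_mult_indicator[OF Am fi] by simp
    show "trig_orth (\<lambda>x. indicator (\<Inter>n. A n) x * f x)"
      unfolding trig_orth_def
    proof (intro conjI allI impI int)
      fix p assume p: "trig p"
      have [measurable]: "p \<in> borel_measurable cell_measure"
        by (intro continuous_measurable_cell trig_continuous p)
      have "(\<lambda>n. LINT x|cell_measure. indicator (B n) x * f x * p x)
          \<longlonglongrightarrow> (LINT x|cell_measure. indicator (\<Inter>n. A n) x * f x * p x)"
      proof (rule integral_dominated_convergence[where w="\<lambda>x. \<bar>f x * p x\<bar>"])
        show "integrable cell_measure (\<lambda>x. \<bar>f x * p x\<bar>)"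
          using integrable_times_trig[OF fi p] by simp
        have "(\<lambda>n. indicator (B n) x :: real) \<longlonglongrightarrow> indicator (\<Inter>n. A n) x" for x
        proof -
          have "decseq B" by (auto simp: B_def decseq_def)
          moreover have "(\<Inter>n. B n) = (\<Inter>n. A n)" by (auto simp: B_def)
          ultimately show ?thesis using LIMSEQ_indicator_decseq[of B x] by simp
        qed
        then show "AE x in cell_measure. (\<lambda>n. indicator (B n) x * f x * p x) \<longlonglongrightarrow> indicator (\<Inter>n. A n) x * f x * p x"
          by (intro AE_I2 tendsto_intros)
        show "AE x in cell_measure. norm (indicator (B n) x * f x * p x) \<le> \<bar>f x * p x\<bar>" for n
          by (auto simp: indicator_def)
      qed measurable
      moreover have "(LINT x|cell_measure. indicator (B n) x * f x * p x) = 0" for n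
        using B[of n] f p by (simp add: preserving_def trig_orth_def)
      ultimately show "(LINT x|cell_measure. indicator (\<Inter>n. A n) x * f x * p x) = 0"
        by (simp add: LIMSEQ_const_iff)
    qed
  qed
qed

lemma preserving_period_cell: "preserving period_cell"
  unfolding preserving_def
proof (intro conjI allI impI)
  fix f assume f: "trig_orth f"
  have [measurable]: "f \<in> borel_measurable cell_measure" using f by (auto simp: trig_orth_def)
  show "trig_orth (\<lambda>x. indicator period_cell x * f x)"
  proof (rule trig_orth_cong_AE[OF f])
    have [measurable]: "period_cell \<in> sets cell_measure" by simp
    show "(\<lambda>x. indicator period_cell x * f x) \<in> borel_measurable cell_measure" by measurable
    show "AE x in cell_measure. f x = indicator period_cell x * f x" by (rule AE_I2) simp
  qed
qed simp

text \<open>The indicator of the positivity set is a bounded pointwise limit of polynomials in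
  \<open>p0\<close>. Multiplying f by such a polynomial keeps orthogonality, because the factor can
  be moved to the test polynomial.\<close>

lemma preserving_trig_pos:
  assumes p0: "trig p0"
  shows "preserving {x \<in> period_cell. 0 < p0 x}"
  unfolding preserving_def
proof (intro conjI allI impI)
  let ?A = "{x \<in> period_cell. 0 < p0 x}"
  have p0m [measurable]: "p0 \<in> borel_measurable cell_measure"
    by (intro continuous_measurable_cell trig_continuous p0)
  have "{x \<in> space cell_measure. 0 < p0 x} \<in> sets cell_measure" by measurable
  then show A [measurable]: "?A \<in> sets cell_measure" by simp
  fix f assume f: "trig_orth f"
  then have [measurable]: "f \<in> borel_measurable cell_measure" by (auto simp: trig_orth_def)
  have fi: "integrable cell_measure f" using f by (simp add: trig_orth_def)
  have int: "integrable cell_measure (\<lambda>x. indicator ?A x * f x)"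
    using integrable_mult_indicator[OF A fi] by simp
  obtain C where C: "\<And>x. x \<in> period_cell \<Longrightarrow> \<bar>p0 x\<bar> \<le> C"
    using continuous_bounded_cell[OF trig_continuous[OF p0]] by auto
  \<comment> \<open>Continuous ramps that increase to the indicator of s > 0. They vanish at s = 0,
    matching the strict inequality in \<open>?A\<close>.\<close>
  define g where "g n s = min 1 (max 0 (real n * s))" for n and s :: real
  have "\<exists>q. real_polynomial_function q \<and> (\<forall>s\<in>{-C..C}. \<bar>g n s - q s\<bar> < 1 / (real n + 1))" for n
  proof -
    have "continuous_on {-C..C} (g n)"
      unfolding g_def by (intro continuous_intros)
    from Stone_Weierstrass_real_polynomial_function[OF compact_Icc this, of "1 / (real n + 1)"]
    show ?thesis by (metis divide_pos_pos of_nat_0_le_iff zero_less_one add_nonneg_pos)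
  qed
  then have "\<forall>n. \<exists>q. real_polynomial_function q \<and> (\<forall>s\<in>{-C..C}. \<bar>g n s - q s\<bar> < 1 / (real n + 1))"
    by blast
  from choice[OF this] obtain q where
    q: "\<And>n. real_polynomial_function (q n)" "\<And>n s. s \<in> {-C..C} \<Longrightarrow> \<bar>g n s - q n s\<bar> < 1 / (real n + 1)"
    by blast
  have g01: "0 \<le> g n s" "g n s \<le> 1" for n s by (auto simp: g_def)
  have q2: "\<bar>q n (p0 x)\<bar> \<le> 2" if "x \<in> period_cell" for n x
  proof -
    have "\<bar>g n (p0 x) - q n (p0 x)\<bar> < 1 / (real n + 1)"
      using C[OF that] by (intro q(2)) auto
    also have "\<dots> \<le> 1" by simp
    finally show ?thesis using g01[of n "p0 x"] by linarith
  qed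
  have qlim: "(\<lambda>n. q n (p0 x)) \<longlonglongrightarrow> indicator ?A x" if x: "x \<in> period_cell" for x
  proof -
    have "(\<lambda>n. g n (p0 x)) \<longlonglongrightarrow> indicator ?A x"
    proof (cases "0 < p0 x")
      case True
      obtain N :: nat where N: "1 / p0 x < real N" using reals_Archimedean2 by blast
      have "g n (p0 x) = 1" if "n \<ge> N" for n
      proof -
        have "1 / p0 x \<le> real n" using N that by linarith
        then have "1 \<le> real n * p0 x" using True by (simp add: field_simps)
        then show ?thesis by (simp add: g_def)
      qed
      then have "\<forall>\<^sub>F n in sequentially. g n (p0 x) = indicator ?A x"
        using True x unfolding eventually_sequentially by (intro exI[of _ N]) simp
      then show ?thesis by (rule tendsto_eventually)
    next
      case False
      then have "real n * p0 x \<le> 0" for n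
        by (simp add: mult_nonneg_nonpos)
      then have "g n (p0 x) = 0" for n
        by (simp add: g_def)
      then show ?thesis using False by simp
    qed
    moreover have "(\<lambda>n. g n (p0 x) - q n (p0 x)) \<longlonglongrightarrow> 0"
    proof (rule Lim_null_comparison)
      show "\<forall>\<^sub>F n in sequentially. norm (g n (p0 x) - q n (p0 x)) \<le> 1 / (real n + 1)"
      proof (intro always_eventually allI)
        fix n
        have "\<bar>g n (p0 x) - q n (p0 x)\<bar> < 1 / (real n + 1)"
          using C[OF x] by (intro q(2)) auto
        then show "norm (g n (p0 x) - q n (p0 x)) \<le> 1 / (real n + 1)" by simp
      qed
      show "(\<lambda>n. 1 / (real n + 1)) \<longlonglongrightarrow> 0"
        using LIMSEQ_inverse_real_of_nat by (simp add: inverse_eq_divide add.commute)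
    qed
    ultimately have "(\<lambda>n. g n (p0 x) - (g n (p0 x) - q n (p0 x))) \<longlonglongrightarrow> indicator ?A x - 0"
      by (rule tendsto_diff)
    then show ?thesis by simp
  qed
  have qtrig: "trig (\<lambda>x. q n (p0 x))" for n
    by (rule trig_polynomial[OF q(1) p0])
  show "trig_orth (\<lambda>x. indicator ?A x * f x)"
    unfolding trig_orth_def
  proof (intro conjI allI impI int)
    fix p assume p: "trig p"
    have [measurable]: "p \<in> borel_measurable cell_measure" "\<And>n. (\<lambda>x. q n (p0 x)) \<in> borel_measurable cell_measure"
      by (intro continuous_measurable_cell trig_continuous p qtrig)+
    have "(\<lambda>n. LINT x|cell_measure. f x * (q n (p0 x) * p x))
        \<longlonglongrightarrow> (LINT x|cell_measure. indicator ?A x * f x * p x)"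
    proof (rule integral_dominated_convergence[where w="\<lambda>x. 2 * \<bar>f x * p x\<bar>"])
      show "integrable cell_measure (\<lambda>x. 2 * \<bar>f x * p x\<bar>)"
        using integrable_times_trig[OF fi p] by simp
      show "AE x in cell_measure. (\<lambda>n. f x * (q n (p0 x) * p x)) \<longlonglongrightarrow> indicator ?A x * f x * p x"
      proof (rule AE_I2)
        fix x assume "x \<in> space cell_measure"
        then have "(\<lambda>n. q n (p0 x) * (f x * p x)) \<longlonglongrightarrow> indicator ?A x * (f x * p x)"
          by (intro tendsto_intros qlim) simp
        then show "(\<lambda>n. f x * (q n (p0 x) * p x)) \<longlonglongrightarrow> indicator ?A x * f x * p x"
          by (simp add: mult.left_commute mult.assoc)
      qed
      show "AE x in cell_measure. norm (f x * (q n (p0 x) * p x)) \<le> 2 * \<bar>f x * p x\<bar>" for n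
      proof (rule AE_I2)
        fix x assume "x \<in> space cell_measure"
        then have "\<bar>q n (p0 x)\<bar> * \<bar>f x * p x\<bar> \<le> 2 * \<bar>f x * p x\<bar>"
          by (intro mult_right_mono q2) auto
        then show "norm (f x * (q n (p0 x) * p x)) \<le> 2 * \<bar>f x * p x\<bar>"
          by (simp add: abs_mult mult.left_commute)
      qed
    qed measurable
    moreover have "(LINT x|cell_measure. f x * (q n (p0 x) * p x)) = 0" for n
      using f trig_mult[OF qtrig p] unfolding trig_orth_def by blast
    ultimately show "(LINT x|cell_measure. indicator ?A x * f x * p x) = 0"
      by (simp add: LIMSEQ_const_iff)
  qed
qed

lemma AE_cell_coordinate_neq: "AE x in cell_measure. x $ i \<noteq> c"
proof -
  have "negligible {x :: real^2. x \<bullet> axis i 1 = c}"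
    by (rule negligible_standard_hyperplane) (simp add: axis_in_Basis_iff)
  then have "AE x in lebesgue. x \<notin> {x :: real^2. x \<bullet> axis i 1 = c}"
    by (intro AE_not_in) (simp add: negligible_iff_null_sets)
  then have "AE x in lebesgue. (x :: real^2) \<in> period_cell \<longrightarrow> x $ i \<noteq> c"
    by eventually_elim (simp add: inner_axis)
  then show ?thesis
    using lmeasurable_period_cell by (subst AE_restrict_space_iff) (auto simp: fmeasurableD)
qed

text \<open>For 0 < c \<le> 1 the bump centred at c/2 exceeds cos(pi c) in the cell exactly where 0
  < x_i < c. The face x_i = 0, which the bump misses, is null.\<close>

lemma preserving_halfspace: "preserving {x \<in> period_cell. x $ i < c}"
proof -
  have m: "{x \<in> period_cell. x $ i < c} \<in> sets cell_measure"
  proof -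
    have [measurable]: "(\<lambda>x :: real^2. x $ i) \<in> borel_measurable cell_measure"
      by (intro continuous_measurable_cell continuous_intros)
    have "{x \<in> space cell_measure. x $ i < c} \<in> sets cell_measure" by measurable
    then show ?thesis by simp
  qed
  have x01: "0 \<le> x $ i" "x $ i \<le> 1" if "x \<in> period_cell" for x
    using that by (auto simp: period_cell_def mem_box_cart)
  consider "c \<le> 0" | "1 < c" | "0 < c" "c \<le> 1" by linarith
  then show ?thesis
  proof cases
    case 1
    then have "{x \<in> period_cell. x $ i < c} = period_cell - period_cell"
      using x01 by fastforce
    then show ?thesis using preserving_compl[OF preserving_period_cell] by metis
  next
    case 2
    then have "{x \<in> period_cell. x $ i < c} = period_cell"
      using x01 by fastforce
    then show ?thesis using preserving_period_cell by metis
  next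
    case 3
    let ?p = "\<lambda>x :: real^2. cos (2 * pi * (x $ i - c / 2)) - cos (pi * c)"
    have p: "preserving {x \<in> period_cell. 0 < ?p x}"
      by (intro preserving_trig_pos trig_diff trig_shifted_cos trig_const)
    have iff: "0 < ?p x \<longleftrightarrow> 0 < x $ i \<and> x $ i < c" if "x \<in> period_cell" for x
    proof -
      define s where "s = x $ i"
      have s: "0 \<le> s" "s \<le> 1" using x01[OF that] by (auto simp: s_def)
      have pc: "0 < pi * c" "pi * c \<le> pi" using 3 by auto
      consider "s = 0" | "0 < s" "s < c" | "c \<le> s" using s by linarith
      then have "cos (pi * c) < cos (2 * pi * (s - c / 2)) \<longleftrightarrow> 0 < s \<and> s < c"
      proof cases
        case 1
        then show ?thesis by simp
      next
        case 2
        have "0 < pi * s" "pi * s < pi * c" using 2 by auto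
        then have "\<bar>2 * pi * (s - c / 2)\<bar> < pi * c"
          unfolding abs_less_iff by (simp add: algebra_simps)
        then have "cos (pi * c) < cos \<bar>2 * pi * (s - c / 2)\<bar>"
          using pc by (intro cos_monotone_0_pi) auto
        then show ?thesis using 2 by simp
      next
        case 3
        let ?t = "2 * pi * (s - c / 2)"
        have t1: "pi * c \<le> ?t" using 3 by simp
        have t2: "?t \<le> 2 * pi - pi * c" using s by (simp add: algebra_simps)
        \<comment> \<open>Here t lies between pi c and 2 pi - pi c. Cosine decreases up to pi;
          beyond pi the point is reflected to 2 pi - t.\<close>
        have "cos ?t \<le> cos (pi * c)"
        proof (cases "?t \<le> pi")
          case True
          then show ?thesis using t1 pc by (intro cos_monotone_0_pi_le) auto
        next
          case False
          have "cos (2 * pi - ?t) \<le> cos (pi * c)"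
            using t2 pc False by (intro cos_monotone_0_pi_le) auto
          then show ?thesis by (simp add: cos_diff)
        qed
        then show ?thesis using 3 by linarith
      qed
      then show ?thesis by (simp add: s_def)
    qed
    have "AE x in cell_measure. x \<in> {x \<in> period_cell. 0 < ?p x} \<longleftrightarrow> x \<in> {x \<in> period_cell. x $ i < c}"
      using AE_cell_coordinate_neq[of i 0] AE_space
    proof eventually_elim
      case (elim x)
      then have x: "x \<in> period_cell" by simp
      from elim(1) x01(1)[OF x] have "0 < x $ i" by (simp add: less_le)
      then show ?case by (simp only: mem_Collect_eq iff[OF x] x simp_thms)
    qed
    then show ?thesis by (rule preserving_AE[OF p m])
  qed
qed

lemma preserving_borel:
  assumes "B \<in> sets borel" shows "preserving (B \<inter> period_cell)"
proof -
  have "B \<in> sigma_sets UNIV ((\<lambda>(a, i). {x::real^2. x \<bullet> i < a}) ` (UNIV \<times> Basis))"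
    using assms unfolding borel_eq_halfspace_less by simp
  then show ?thesis
  proof induction
    case (Basic a)
    then obtain c and i :: "real^2" where ai: "i \<in> Basis" "a = {x. x \<bullet> i < c}" by auto
    then obtain j where "i = axis j 1" by (auto simp: Basis_vec_def)
    with ai have "a \<inter> period_cell = {x \<in> period_cell. x $ j < c}"
      by (auto simp: inner_axis)
    then show ?case using preserving_halfspace by metis
  next
    case Empty
    then show ?case using preserving_compl[OF preserving_period_cell] by simp
  next
    case (Compl a)
    have "(UNIV - a) \<inter> period_cell = period_cell - (a \<inter> period_cell)" by auto
    then show ?case using preserving_compl[OF Compl.IH] by simp
  next
    case (Union a)
    have eq: "(\<Union>n. a n) \<inter> period_cell = period_cell - (\<Inter>n. period_cell - (a n \<inter> period_cell))" by auto
    show ?case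
      unfolding eq by (intro preserving_compl preserving_INT Union.IH)
  qed
qed

text \<open>A Lebesgue set differs from a Borel set by a null set, which \<open>preserving\<close>
  does not detect.\<close>

lemma preserving_measurable:
  assumes A: "A \<in> sets cell_measure" shows "preserving A"
proof -
  have cell: "period_cell \<in> sets lebesgue"
    using lmeasurable_period_cell by (simp add: fmeasurableD)
  then have "A \<in> sets lebesgue"
    using A by (auto simp: sets_restrict_space_iff)
  then obtain S N N' where SN: "A = S \<union> N" "N \<subseteq> N'" "N' \<in> null_sets lborel" "S \<in> sets lborel"
    by (rule sets_completionE)
  have "AE x in lebesgue. x \<notin> N'"
    using SN(3) by (intro AE_not_in null_sets_completionI)
  then have "AE x in lebesgue. x \<in> period_cell \<longrightarrow> (x \<in> S \<inter> period_cell \<longleftrightarrow> x \<in> A)"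
    by eventually_elim (use SN in auto)
  then have ae: "AE x in cell_measure. x \<in> S \<inter> period_cell \<longleftrightarrow> x \<in> A"
    using cell by (subst AE_restrict_space_iff) auto
  have "preserving (S \<inter> period_cell)"
    using SN by (intro preserving_borel) auto
  then show ?thesis by (rule preserving_AE[OF _ A ae])
qed

text \<open>Restricting f to the set where it is positive or negative keeps it orthogonal to the
  constant 1, so its positive and negative parts both have integral zero.\<close>

lemma trig_orth_AE_zero:
  assumes "trig_orth f" shows "AE x in cell_measure. f x = 0"
proof -
  have [measurable]: "f \<in> borel_measurable cell_measure" using assms by (auto simp: trig_orth_def)
  have *: "AE x in cell_measure. indicator A x * f x = 0"
    if A: "A \<in> sets cell_measure" and s: "s \<noteq> 0" and pos: "\<And>x. x \<in> A \<Longrightarrow> 0 \<le> s * f x" for A and s :: real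
  proof -
    have o: "trig_orth (\<lambda>x. indicator A x * f x)"
      using preserving_measurable[OF A] assms by (simp add: preserving_def)
    then have "(LINT x|cell_measure. indicator A x * f x * 1) = 0"
      using trig_const unfolding trig_orth_def by blast
    then have 0: "(LINT x|cell_measure. s * (indicator A x * f x)) = 0" by simp
    have int: "integrable cell_measure (\<lambda>x. s * (indicator A x * f x))"
      using o by (simp add: trig_orth_def)
    have nonneg: "AE x in cell_measure. 0 \<le> s * (indicator A x * f x)"
      using pos by (auto simp: indicator_def)
    have "AE x in cell_measure. s * (indicator A x * f x) = 0"
      using integral_nonneg_eq_0_iff_AE[OF int nonneg] 0 by simp
    then show ?thesis using s by simp
  qed
  have sets: "{x \<in> space cell_measure. 0 < f x} \<in> sets cell_measure"
    "{x \<in> space cell_measure. f x < 0} \<in> sets cell_measure"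
    by measurable
  have "AE x in cell_measure. indicator {x \<in> space cell_measure. 0 < f x} x * f x = 0"
    by (rule *[OF sets(1), of 1]) auto
  moreover have "AE x in cell_measure. indicator {x \<in> space cell_measure. f x < 0} x * f x = 0"
    by (rule *[OF sets(2), of "-1"]) auto
  ultimately show ?thesis
    using AE_space by eventually_elim (auto simp: indicator_def split: if_splits)
qed

lemma hcoef_zero_AE:
  assumes "integrable cell_measure f" "\<And>k. hcoef f k = 0"
  shows "AE x in cell_measure. f x = 0"
  by (intro trig_orth_AE_zero trig_orthI assms)

section \<open>Riesz--Fischer and Parseval\<close>

lemma hcoef_eq_cell_inner: "hcoef f k = cell_inner f (hartley k)"
  by (simp add: hcoef_def)

lemma hcoef_lincomb:
  assumes "L2_cell f" "L2_cell g"
  shows "hcoef (\<lambda>x. f x + c * g x) k = hcoef f k + c * hcoef g k"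
proof -
  have "hcoef (\<lambda>x. f x + c * g x) k = (LINT x|cell_measure. f x \<bullet> hartley k x + c * (g x \<bullet> hartley k x))"
    by (simp add: hcoef_def algebra_simps)
  also have "\<dots> = (LINT x|cell_measure. f x \<bullet> hartley k x) + c * (LINT x|cell_measure. g x \<bullet> hartley k x)"
    using L2_cell_inner[OF assms(1) L2_hartley[of k]] L2_cell_inner[OF assms(2) L2_hartley[of k]] by simp
  finally show ?thesis by (simp add: hcoef_def)
qed

lemma hcoef_const: "hcoef (\<lambda>x. c) k = (if k = 0 then c else 0)"
  by (simp add: hcoef_def integral_hartley)

lemma hcoef_minus: "hcoef (\<lambda>x. - f x) k = - hcoef f k"
  by (simp add: hcoef_def)

lemma hcoef_diff_const:
  assumes "L2_cell f"
  shows "hcoef (\<lambda>x. f x - c) k = hcoef f k - (if k = 0 then c else 0)"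
  using hcoef_lincomb[OF assms L2_cell_const[of "c"], of "-1" k] by (simp add: hcoef_const)

lemma L2_hpoly: "L2_cell (\<lambda>x. \<Sum>k\<in>A. c k * hartley k x)"
  by (intro L2_cell_sum L2_cell_cmult L2_hartley)

lemma hpoly_inner:
  assumes "L2_cell f"
  shows "(LINT x|cell_measure. (\<Sum>k\<in>A. c k * hartley k x) * f x) = (\<Sum>k\<in>A. c k * hcoef f k)"
proof -
  have "(LINT x|cell_measure. (\<Sum>k\<in>A. c k * hartley k x) * f x)
      = (LINT x|cell_measure. (\<Sum>k\<in>A. c k * (f x \<bullet> hartley k x)))"
    unfolding sum_distrib_right by (intro Bochner_Integration.integral_cong sum.cong refl) simp
  also have "\<dots> = (\<Sum>k\<in>A. LINT x|cell_measure. c k * (f x \<bullet> hartley k x))"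
    by (rule Bochner_Integration.integral_sum)
      (intro integrable_mult_right L2_cell_inner assms L2_hartley)
  finally show ?thesis by (simp add: hcoef_def)
qed

lemma hcoef_hpoly:
  assumes "finite A"
  shows "hcoef (\<lambda>x. \<Sum>k\<in>A. c k * hartley k x) l = (if l \<in> A then c l else 0)"
proof -
  have h: "hcoef (hartley l) k = (if k = l then 1 else 0)" for k
    using hartley_orthonormal[of l k] by (auto simp: hcoef_def)
  have "hcoef (\<lambda>x. \<Sum>k\<in>A. c k * hartley k x) l = (\<Sum>k\<in>A. c k * hcoef (hartley l) k)"
    unfolding hcoef_def[of "\<lambda>x. \<Sum>k\<in>A. c k * hartley k x"] by (rule hpoly_inner[OF L2_hartley])
  also have "\<dots> = (\<Sum>k\<in>A. if k = l then c k else 0)"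
    by (intro sum.cong refl) (simp add: h)
  finally show ?thesis using assms by simp
qed

lemma cell_sq_hpoly:
  assumes "finite A"
  shows "cell_sq (\<lambda>x. \<Sum>k\<in>A. c k * hartley k x) = (\<Sum>k\<in>A. (c k)\<^sup>2)"
proof -
  let ?p = "\<lambda>x. \<Sum>k\<in>A. c k * hartley k x"
  have sq: "(norm r)\<^sup>2 = r * r" for r :: real by (simp add: power2_eq_square)
  have "cell_sq ?p = (LINT x|cell_measure. ?p x * ?p x)"
    unfolding sq ..
  also have "\<dots> = (\<Sum>k\<in>A. c k * hcoef ?p k)"
    by (rule hpoly_inner[OF L2_hpoly])
  also have "\<dots> = (\<Sum>k\<in>A. (c k)\<^sup>2)"
    by (intro sum.cong refl) (simp add: hcoef_hpoly[OF assms] power2_eq_square)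
  finally show ?thesis .
qed

lemma Bessel:
  assumes f: "L2_cell f" and "finite A"
  shows "(\<Sum>k\<in>A. (hcoef f k)\<^sup>2) \<le> cell_sq f"
proof -
  define p where "p = (\<lambda>x. \<Sum>k\<in>A. hcoef f k * hartley k x)"
  have p: "L2_cell p" unfolding p_def by (rule L2_hpoly)
  have pf: "(LINT x|cell_measure. p x * f x) = (\<Sum>k\<in>A. (hcoef f k)\<^sup>2)"
    unfolding p_def hpoly_inner[OF f] by (simp add: power2_eq_square)
  have pp: "cell_sq p = (\<Sum>k\<in>A. (hcoef f k)\<^sup>2)"
    unfolding p_def by (rule cell_sq_hpoly[OF \<open>finite A\<close>])
  have "0 \<le> (LINT x|cell_measure. (f x - p x)\<^sup>2)" by simp
  also have "\<dots> = (LINT x|cell_measure. (norm (f x))\<^sup>2 - 2 * (p x \<bullet> f x) + (norm (p x))\<^sup>2)"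
    by (intro Bochner_Integration.integral_cong refl) (simp add: power2_eq_square algebra_simps)
  also have "\<dots> = cell_sq f - 2 * (LINT x|cell_measure. p x \<bullet> f x) + cell_sq p"
    using L2_cell_inner[OF p f] f p by (simp add: L2_cell_def)
  finally show ?thesis using pf pp by simp
qed

text \<open>Square partial sums. The boxes are invariant under k \<mapsto> -k, which is needed to
  reindex sums after each derivative flips the frequency.\<close>

definition freq_box :: "nat \<Rightarrow> (int^2) set" where
  "freq_box N = {k. \<forall>i. \<bar>k $ i\<bar> \<le> int N}"

lemma finite_freq_box: "finite (freq_box N)"
proof -
  have "freq_box N \<subseteq> (\<lambda>(a, b). vector [a, b]) ` ({-int N..int N} \<times> {-int N..int N})"
  proof
    fix k assume "k \<in> freq_box N"
    then have "\<bar>k $ 1\<bar> \<le> int N" "\<bar>k $ 2\<bar> \<le> int N" by (auto simp: freq_box_def)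
    moreover have "k = vector [k $ 1, k $ 2]" by (simp add: vec_eq_iff forall_2)
    ultimately show "k \<in> (\<lambda>(a, b). vector [a, b]) ` ({-int N..int N} \<times> {-int N..int N})"
      by (intro image_eqI[of _ _ "(k $ 1, k $ 2)"]) (auto simp: abs_le_iff)
  qed
  then show ?thesis by (rule finite_subset) simp
qed

lemma freq_box_mono: "m \<le> n \<Longrightarrow> freq_box m \<subseteq> freq_box n"
  unfolding freq_box_def by (auto intro: order_trans)

lemma eventually_freq_box: "\<forall>\<^sub>F N in sequentially. k \<in> freq_box N"
proof -
  have "k \<in> freq_box N" if "nat \<bar>k $ 1\<bar> + nat \<bar>k $ 2\<bar> \<le> N" for N
    using that by (auto simp: freq_box_def forall_2)
  then show ?thesis unfolding eventually_sequentially by blast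
qed

lemma sum_freq_box_uminus: "(\<Sum>k\<in>freq_box N. f (- k)) = (\<Sum>k\<in>freq_box N. f k)"
  by (rule sum.reindex_bij_witness[of _ uminus uminus]) (auto simp: freq_box_def)

text \<open>Bounded sums of squares make the square partial sums Cauchy. The convergence in mean
  square is exported along with f, because \<open>Parseval\<close> needs it.\<close>

lemma Riesz_Fischer:
  assumes bound: "\<And>A. finite A \<Longrightarrow> (\<Sum>k\<in>A. (c k)\<^sup>2) \<le> C"
  obtains f where "L2_cell f" "hcoef f = c"
    "(\<lambda>N. cell_sq (\<lambda>x. (\<Sum>k\<in>freq_box N. c k * hartley k x) - f x)) \<longlonglongrightarrow> 0"
proof -
  define S where "S N x = (\<Sum>k\<in>freq_box N. c k * hartley k x)" for N x
  have SL2: "L2_cell (S N)" for N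
    unfolding S_def by (rule L2_hpoly)
  define s where "s N = (\<Sum>k\<in>freq_box N. (c k)\<^sup>2)" for N
  have inc: "incseq s"
    unfolding s_def by (intro incseq_SucI sum_mono2 finite_freq_box freq_box_mono) auto
  moreover have "\<forall>N. s N \<le> C"
    unfolding s_def by (intro allI bound finite_freq_box)
  ultimately obtain L where "s \<longlonglongrightarrow> L"
    by (rule incseq_convergent)
  then have "Cauchy s" by (rule LIMSEQ_imp_Cauchy)
  have diff: "cell_sq (\<lambda>x. S n x - S m x) = s n - s m" if "m \<le> n" for m n
  proof -
    have "S n x - S m x = (\<Sum>k\<in>freq_box n - freq_box m. c k * hartley k x)" for x
      unfolding S_def by (rule sum_diff[OF finite_freq_box freq_box_mono[OF that], symmetric])
    then have "cell_sq (\<lambda>x. S n x - S m x) = (\<Sum>k\<in>freq_box n - freq_box m. (c k)\<^sup>2)"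
      by (simp only: cell_sq_hpoly[OF finite_Diff[OF finite_freq_box]])
    also have "\<dots> = s n - s m"
      unfolding s_def by (rule sum_diff[OF finite_freq_box freq_box_mono[OF that]])
    finally show ?thesis .
  qed
  have absdiff: "cell_sq (\<lambda>x. S m x - S n x) = \<bar>s m - s n\<bar>" for m n
  proof (cases "m \<le> n")
    case True
    have "cell_sq (\<lambda>x. S m x - S n x) = cell_sq (\<lambda>x. S n x - S m x)"
      by (simp only: norm_minus_commute)
    then show ?thesis using diff[OF True] incseqD[OF inc True] by linarith
  next
    case False
    then have "n \<le> m" by simp
    then show ?thesis using diff[of n m] incseqD[OF inc, of n m] by linarith
  qed
  obtain f where f: "L2_cell f" "(\<lambda>N. cell_sq (\<lambda>x. S N x - f x)) \<longlonglongrightarrow> 0"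
  proof (rule L2_cell_complete[of S])
    show "L2_cell (S n)" for n by (rule SL2)
    show "\<exists>N. \<forall>m\<ge>N. \<forall>n\<ge>N. cell_sq (\<lambda>x. S m x - S n x) < e" if "e > 0" for e
      using metric_CauchyD[OF \<open>Cauchy s\<close> that] by (simp only: absdiff dist_real_def)
  qed
  have "hcoef f k = c k" for k
  proof -
    have "(\<lambda>N. cell_inner (S N) (hartley k)) \<longlonglongrightarrow> cell_inner f (hartley k)"
      by (rule cell_inner_tendsto[OF SL2 f(1) L2_hartley f(2)])
    then have "(\<lambda>N. hcoef (S N) k) \<longlonglongrightarrow> hcoef f k"
      by (simp only: hcoef_eq_cell_inner)
    moreover have "\<forall>\<^sub>F N in sequentially. hcoef (S N) k = c k"
      using eventually_freq_box[of k]
      by eventually_elim (simp add: hcoef_hpoly[OF finite_freq_box] S_def[abs_def])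
    then have "(\<lambda>N. hcoef (S N) k) \<longlonglongrightarrow> c k" by (rule tendsto_eventually)
    ultimately show ?thesis by (rule LIMSEQ_unique)
  qed
  then have "hcoef f = c" ..
  with f(1) show thesis
    using f(2) unfolding S_def by (rule that)
qed

text \<open>The series built from the coefficients of f converges to some g with the same
  coefficients; completeness identifies g with f a.e. Stating a limit of box sums avoids unordered
  summation over frequencies.\<close>

lemma Parseval:
  assumes f: "L2_cell f" and h: "L2_cell h"
  shows "(\<lambda>N. \<Sum>k\<in>freq_box N. hcoef f k * hcoef h k) \<longlonglongrightarrow> (LINT x|cell_measure. f x * h x)"
proof -
  obtain g where g: "L2_cell g" "hcoef g = hcoef f"
    "(\<lambda>N. cell_sq (\<lambda>x. (\<Sum>k\<in>freq_box N. hcoef f k * hartley k x) - g x)) \<longlonglongrightarrow> 0"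
  proof (rule Riesz_Fischer[of "hcoef f" "cell_sq f"])
    show "(\<Sum>k\<in>A. (hcoef f k)\<^sup>2) \<le> cell_sq f" if "finite A" for A
      by (rule Bessel[OF f that])
  qed
  have 0: "hcoef (\<lambda>x. f x - g x) k = 0" for k
    using hcoef_lincomb[OF f g(1), of "-1" k] g(2) by simp
  have ae: "AE x in cell_measure. f x - g x = 0"
    by (rule hcoef_zero_AE[OF L2_cell_integrable[OF L2_cell_diff[OF f g(1)]] 0])
  have "(LINT x|cell_measure. f x * h x) = (LINT x|cell_measure. g x * h x)"
  proof (rule integral_cong_AE)
    show "AE x in cell_measure. f x * h x = g x * h x" using ae by eventually_elim simp
  qed (intro borel_measurable_times L2_cell_measurable f g h)+
  moreover have "(\<lambda>N. LINT x|cell_measure. (\<Sum>k\<in>freq_box N. hcoef f k * hartley k x) * h x)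
      \<longlonglongrightarrow> (LINT x|cell_measure. g x * h x)"
    using cell_inner_tendsto[OF L2_hpoly g(1) h g(3)] by (simp only: inner_real_def)
  ultimately show ?thesis
    by (simp only: hpoly_inner[OF h])
qed

section \<open>Weak gradients and divergence-free fields in Fourier space\<close>

lemma sq_sum_le:
  fixes a b u v :: real
  shows "(a * u + b * v)\<^sup>2 \<le> (a\<^sup>2 + b\<^sup>2) * (u\<^sup>2 + v\<^sup>2)"
  using zero_le_power2[of "a * v - b * u"] by (simp add: power2_eq_square algebra_simps)

lemma H1_per_grad_imp_hcoef:
  assumes "H1_per_grad \<phi> g"
  shows "hcoef (\<lambda>x. g x $ i) k = - (2 * pi * of_int (k $ i)) * hcoef \<phi> (- k)"
proof -
  have "(LINT x|cell_measure. \<phi> x * partial_deriv i (hartley k) x) = - (LINT x|cell_measure. g x $ i * hartley k x)"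
    using assms smooth_hartley periodic_hartley unfolding H1_per_grad_def by blast
  moreover have "(\<lambda>x. \<phi> x * partial_deriv i (hartley k) x) = (\<lambda>x. (2 * pi * of_int (k $ i)) * (\<phi> x * hartley (- k) x))"
    using partial_deriv_hartley[of i 1 k] by (simp add: fun_eq_iff algebra_simps)
  ultimately show ?thesis by (simp add: hcoef_def)
qed

text \<open>A function obtained from Fourier coefficients is controlled only on the cell, whereas a
  potential in \<open>H1_per_grad\<close> must be periodic at every point.\<close>

lemma periodic_extension:
  fixes f :: "real^2 \<Rightarrow> real"
  assumes "L2_cell f"
  obtains h where "periodic h" "L2_cell h" "AE x in cell_measure. h x = f x"
proof -
  \<comment> \<open>The value 0 at points with an integer coordinate makes h on the closed cell
    equal to f times the indicator of the open cell, so measurability is inherited and opposite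
    faces agree.\<close>
  define h where "h x = (if \<exists>i. frac (x $ i) = 0 then 0 else f (\<chi> i. frac (x $ i)))" for x :: "real^2"
  have "frac ((x + axis i 1) $ j) = frac (x $ j)" for x :: "real^2" and i j
    by (simp add: axis_def frac_1_eq)
  then have per: "periodic h" by (simp add: periodic_def h_def)
  define U where "U = {x :: real^2. \<forall>i. 0 < x $ i \<and> x $ i < 1}"
  have "open U"
    unfolding U_def forall_2 by (intro open_Collect_conj open_Collect_less continuous_intros)
  then have U: "U \<inter> period_cell \<in> sets cell_measure"
    by (auto simp: sets_restrict_space)
  have hU: "h x = indicator (U \<inter> period_cell) x * f x" if x: "x \<in> period_cell" for x
  proof (cases "x \<in> U")
    case True
    then have fr: "frac (x $ i) = x $ i" "x $ i \<noteq> 0" for i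
      by (auto simp: U_def frac_eq less_imp_le dest: spec[of _ i])
    then show ?thesis using True x by (simp add: h_def)
  next
    case False
    then obtain i where i: "\<not> (0 < x $ i \<and> x $ i < 1)" by (auto simp: U_def)
    have "0 \<le> x $ i" "x $ i \<le> 1" using x by (auto simp: period_cell_def mem_box_cart)
    then have "x $ i = 0 \<or> x $ i = 1" using i by linarith
    then have "frac (x $ i) = 0" by auto
    then show ?thesis using False by (auto simp: h_def)
  qed
  have m: "(\<lambda>x. indicator (U \<inter> period_cell) x * f x) \<in> borel_measurable cell_measure"
    using U L2_cell_measurable[OF assms] by measurable
  have hm: "h \<in> borel_measurable cell_measure"
    by (subst measurable_cong[OF hU]) (auto intro: m)
  have "L2_cell h"
    by (rule L2_cell_dominated[OF assms hm, of 1]) (auto simp: hU indicator_def)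
  moreover have "AE x in cell_measure. h x = f x"
    using AE_cell_coordinate_neq[of 1 0] AE_cell_coordinate_neq[of 1 1]
      AE_cell_coordinate_neq[of 2 0] AE_cell_coordinate_neq[of 2 1] AE_space
  proof eventually_elim
    case (elim x)
    then have "x \<in> period_cell" by simp
    moreover have "x \<in> U"
      using \<open>x \<in> period_cell\<close> elim by (auto simp: U_def period_cell_def mem_box_cart forall_2 less_le)
    ultimately show ?case by (simp add: hU)
  qed
  ultimately show thesis using per that by blast
qed

text \<open>Eliminates the potential in favour of linear conditions on coefficients: zero mean, and
  at each frequency a coefficient vector parallel to k, the weak form of curl-freeness. Closure,
  limits and rotations become checks at single frequencies.\<close>

lemma H1_per_grad_exists_iff:
  "(\<exists>\<phi>. H1_per_grad \<phi> g) \<longleftrightarrow> L2_cell g \<and> (\<forall>i. hcoef (\<lambda>x. g x $ i) 0 = 0) \<and>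
     (\<forall>k. of_int (k $ 1) * hcoef (\<lambda>x. g x $ 2) k = of_int (k $ 2) * hcoef (\<lambda>x. g x $ 1) k)"
  (is "?l \<longleftrightarrow> ?r")
proof
  assume ?l
  then obtain \<phi> where "H1_per_grad \<phi> g" ..
  then show ?r
    by (auto simp: H1_per_grad_imp_hcoef) (simp add: H1_per_grad_def)
next
  assume r: ?r
  define G where "G i k = hcoef (\<lambda>x. g x $ i) k" for i k
  have Lg: "L2_cell (\<lambda>x. g x $ i)" for i using r by (intro L2_cell_nth) blast
  \<comment> \<open>Solves G i (-k) = 2 pi k_i c(k) after taking the inner product with k. At k = 0
    the division by zero returns 0, which selects the potential of mean zero.\<close>
  define c where "c k = (of_int (k $ 1) * G 1 (- k) + of_int (k $ 2) * G 2 (- k)) / (2 * pi * ((of_int (k $ 1))\<^sup>2 + (of_int (k $ 2))\<^sup>2))" for k :: "int^2"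
  have c_bound: "(c k)\<^sup>2 \<le> (G 1 (- k))\<^sup>2 + (G 2 (- k))\<^sup>2" for k
  proof (cases "k = 0")
    case False
    let ?n = "(of_int (k $ 1))\<^sup>2 + (of_int (k $ 2))\<^sup>2 :: real"
    \<comment> \<open>A nonzero integer frequency has length at least 1, so dividing by it does not
      spoil square-summability.\<close>
    have "1 \<le> (k $ 1)\<^sup>2 + (k $ 2)\<^sup>2"
    proof -
      have "k $ 1 \<noteq> 0 \<or> k $ 2 \<noteq> 0" using False by (auto simp: vec_eq_iff forall_2)
      then have "0 < (k $ 1)\<^sup>2 + (k $ 2)\<^sup>2" by (simp add: sum_power2_gt_zero_iff)
      then show ?thesis by linarith
    qed
    then have n: "1 \<le> ?n"
      by (metis of_int_1_le_iff of_int_add of_int_power)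
    have "1 \<le> 2 * pi" using pi_gt3 by linarith
    then have p: "1 \<le> (2 * pi)\<^sup>2" by (rule one_le_power)
    have "(c k)\<^sup>2 \<le> ?n * ((G 1 (- k))\<^sup>2 + (G 2 (- k))\<^sup>2) / ((2 * pi)\<^sup>2 * ?n\<^sup>2)"
      unfolding c_def power_divide power_mult_distrib[of "2 * pi"] by (intro divide_right_mono sq_sum_le) simp
    also have "\<dots> = ((G 1 (- k))\<^sup>2 + (G 2 (- k))\<^sup>2) / ((2 * pi)\<^sup>2 * ?n)"
      using n by (simp add: power2_eq_square)
    also have "\<dots> \<le> ((G 1 (- k))\<^sup>2 + (G 2 (- k))\<^sup>2) / 1"
    proof (rule divide_left_mono)
      show "1 \<le> (2 * pi)\<^sup>2 * ?n" using mult_mono[OF p n] by simp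
    qed (use n p in auto)
    finally show ?thesis by simp
  qed (simp add: c_def)
  have c_grad: "G i (- k) = 2 * pi * of_int (k $ i) * c k" for i k
  proof (cases "k = 0")
    case True
    then show ?thesis using r by (simp add: G_def)
  next
    case False
    let ?n = "(of_int (k $ 1))\<^sup>2 + (of_int (k $ 2))\<^sup>2 :: real"
    have "k $ 1 \<noteq> 0 \<or> k $ 2 \<noteq> 0" using False by (auto simp: vec_eq_iff forall_2)
    then have n: "?n \<noteq> 0" by (simp add: sum_power2_eq_zero_iff)
    have e: "of_int (k $ 1) * G 2 (- k) = of_int (k $ 2) * G 1 (- k)"
      using r unfolding G_def by (auto dest!: spec[of _ "- k"])
    let ?num = "of_int (k $ 1) * G 1 (- k) + of_int (k $ 2) * G 2 (- k)"
    have "G i (- k) * ?n = of_int (k $ i) * ?num"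
      using exhaust_2[of i] e by (auto simp: power2_eq_square algebra_simps)
    then have "G i (- k) = of_int (k $ i) * ?num / ?n"
      by (rule nonzero_eq_divide_eq[OF n, THEN iffD2])
    then show ?thesis by (simp add: c_def)
  qed
  have "\<exists>C. \<forall>A. finite A \<longrightarrow> (\<Sum>k\<in>A. (c k)\<^sup>2) \<le> C"
  proof (intro exI allI impI)
    fix A :: "(int^2) set" assume A: "finite A"
    have "(\<Sum>k\<in>A. (c k)\<^sup>2) \<le> (\<Sum>k\<in>A. (G 1 (- k))\<^sup>2 + (G 2 (- k))\<^sup>2)"
      by (rule sum_mono) (rule c_bound)
    also have "\<dots> = (\<Sum>k\<in>uminus ` A. (G 1 k)\<^sup>2) + (\<Sum>k\<in>uminus ` A. (G 2 k)\<^sup>2)"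
      by (simp add: sum.reindex sum.distrib)
    also have "\<dots> \<le> cell_sq (\<lambda>x. g x $ 1) + cell_sq (\<lambda>x. g x $ 2)"
      unfolding G_def using A by (intro add_mono Bessel Lg) auto
    finally show "(\<Sum>k\<in>A. (c k)\<^sup>2) \<le> cell_sq (\<lambda>x. g x $ 1) + cell_sq (\<lambda>x. g x $ 2)" .
  qed
  then obtain C where "\<And>A. finite A \<Longrightarrow> (\<Sum>k\<in>A. (c k)\<^sup>2) \<le> C" by blast
  then obtain f where f: "L2_cell f" "hcoef f = c"
    by (rule Riesz_Fischer)
  obtain \<phi> where \<phi>: "periodic \<phi>" "L2_cell \<phi>" "AE x in cell_measure. \<phi> x = f x"
    using periodic_extension[OF f(1)] by blast
  have \<phi>c: "hcoef \<phi> k = c k" for k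
  proof -
    have "hcoef \<phi> k = hcoef f k"
      unfolding hcoef_def using \<phi>(3) L2_cell_measurable[OF \<phi>(2)] L2_cell_measurable[OF f(1)]
      by (intro integral_cong_AE) auto
    then show ?thesis by (simp add: f)
  qed
  have "(LINT x|cell_measure. \<phi> x * partial_deriv i \<psi> x) = - (LINT x|cell_measure. g x $ i * \<psi> x)"
    if \<psi>: "smooth \<psi>" "periodic \<psi>" for \<psi> i
  proof (rule LIMSEQ_unique)
    have L: "L2_cell \<psi>" "L2_cell (partial_deriv i \<psi>)"
      by (auto intro!: L2_cell_continuous smooth_continuous smooth_partial_deriv \<psi>)
    show "(\<lambda>N. \<Sum>k\<in>freq_box N. hcoef \<phi> k * hcoef (partial_deriv i \<psi>) k) \<longlonglongrightarrow> (LINT x|cell_measure. \<phi> x * partial_deriv i \<psi> x)"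
      by (rule Parseval[OF \<phi>(2) L(2)])
    \<comment> \<open>On the coefficient side integration by parts is a termwise identity after k
      \<mapsto> -k; taking limits gives it for every smooth periodic test function.\<close>
    have "(\<Sum>k\<in>freq_box N. hcoef \<phi> k * hcoef (partial_deriv i \<psi>) k)
        = - (\<Sum>k\<in>freq_box N. hcoef (\<lambda>x. g x $ i) k * hcoef \<psi> k)" for N
    proof -
      have "(\<Sum>k\<in>freq_box N. hcoef (\<lambda>x. g x $ i) k * hcoef \<psi> k)
          = (\<Sum>k\<in>freq_box N. G i (- k) * hcoef \<psi> (- k))"
        by (simp add: G_def sum_freq_box_uminus[of "\<lambda>k. hcoef (\<lambda>x. g x $ i) k * hcoef \<psi> k"])
      also have "\<dots> = - (\<Sum>k\<in>freq_box N. hcoef \<phi> k * hcoef (partial_deriv i \<psi>) k)"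
        by (simp add: c_grad \<phi>c hcoef_partial_deriv[OF \<psi>] sum_negf[symmetric] algebra_simps)
      finally show ?thesis by simp
    qed
    then show "(\<lambda>N. \<Sum>k\<in>freq_box N. hcoef \<phi> k * hcoef (partial_deriv i \<psi>) k) \<longlonglongrightarrow> - (LINT x|cell_measure. g x $ i * \<psi> x)"
      using tendsto_minus[OF Parseval[OF Lg[of i] L(1)]] by simp
  qed
  then show ?l
    unfolding H1_per_grad_def using \<phi> r by blast
qed

lemma cell_inner_components:
  fixes J G :: "real^2 \<Rightarrow> real^2"
  assumes "L2_cell J" "L2_cell G"
  shows "cell_inner J G = (\<Sum>i\<in>UNIV. LINT x|cell_measure. J x $ i * G x $ i)"
  using L2_cell_inner[OF L2_cell_nth[OF assms(1)] L2_cell_nth[OF assms(2)]]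
  by (simp add: inner_vec_def)

lemma Parseval_vec:
  fixes J G :: "real^2 \<Rightarrow> real^2"
  assumes "L2_cell J" "L2_cell G"
  shows "(\<lambda>N. \<Sum>k\<in>freq_box N. \<Sum>i\<in>UNIV. hcoef (\<lambda>x. J x $ i) k * hcoef (\<lambda>x. G x $ i) k) \<longlonglongrightarrow> cell_inner J G"
  unfolding cell_inner_components[OF assms] sum.swap[of _ UNIV]
  by (intro tendsto_sum Parseval L2_cell_nth assms)

lemma cell_inner_eq_0I:
  fixes J G :: "real^2 \<Rightarrow> real^2"
  assumes "L2_cell J" "L2_cell G"
    and "\<And>k. (\<Sum>i\<in>UNIV. hcoef (\<lambda>x. J x $ i) k * hcoef (\<lambda>x. G x $ i) k) = 0"
  shows "cell_inner J G = 0"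
  using Parseval_vec[OF assms(1,2)] by (simp add: assms(3) LIMSEQ_const_iff)

lemma grad_smooth_L2: "smooth \<psi> \<Longrightarrow> L2_cell (grad \<psi>)"
  unfolding grad_def[abs_def]
  by (rule L2_cell_nthI) (simp add: L2_cell_continuous smooth_continuous smooth_partial_deriv)

lemma div_free_iff:
  "div_free J \<longleftrightarrow> L2_cell J \<and> (\<forall>k. of_int (k $ 1) * hcoef (\<lambda>x. J x $ 1) k + of_int (k $ 2) * hcoef (\<lambda>x. J x $ 2) k = 0)"
  (is "?l \<longleftrightarrow> ?r")
proof
  assume l: ?l
  then have J: "L2_cell J" by (simp add: div_free_def)
  have "of_int (k $ 1) * hcoef (\<lambda>x. J x $ 1) k + of_int (k $ 2) * hcoef (\<lambda>x. J x $ 2) k = 0" for k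
  proof -
    \<comment> \<open>Testing with the opposite frequency produces exactly the coefficients at k,
      because differentiation flips the sign back.\<close>
    have g: "grad (hartley (- k)) x $ i = - (2 * pi * of_int (k $ i)) * hartley k x" for x i
      using partial_deriv_hartley[of i 1 "- k"] by (simp add: grad_def)
    have "0 = cell_inner J (grad (hartley (- k)))"
      using l smooth_hartley[of "- k"] periodic_hartley[of "- k"] by (simp add: div_free_def)
    also have "\<dots> = (\<Sum>i\<in>UNIV. LINT x|cell_measure. - (2 * pi * of_int (k $ i)) * (J x $ i * hartley k x))"
      unfolding cell_inner_components[OF J grad_smooth_L2[OF smooth_hartley]] g
      by (simp add: algebra_simps)
    also have "\<dots> = (\<Sum>i\<in>UNIV. - (2 * pi * of_int (k $ i)) * hcoef (\<lambda>x. J x $ i) k)"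
      unfolding hcoef_def by (simp only: Bochner_Integration.integral_mult_right_zero)
    also have "\<dots> = - (2 * pi) * (of_int (k $ 1) * hcoef (\<lambda>x. J x $ 1) k + of_int (k $ 2) * hcoef (\<lambda>x. J x $ 2) k)"
      by (simp add: sum_2 algebra_simps)
    finally show ?thesis by simp
  qed
  then show ?r using J by blast
next
  assume r: ?r
  have "cell_inner J (grad \<psi>) = 0" if \<psi>: "smooth \<psi>" "periodic \<psi>" for \<psi>
  proof (rule cell_inner_eq_0I)
    show "L2_cell J" using r by blast
    show "L2_cell (grad \<psi>)" by (rule grad_smooth_L2[OF \<psi>(1)])
    fix k
    have "(\<Sum>i\<in>UNIV. hcoef (\<lambda>x. J x $ i) k * hcoef (\<lambda>x. grad \<psi> x $ i) k)
       = - (2 * pi * hcoef \<psi> (- k)) * (of_int (k $ 1) * hcoef (\<lambda>x. J x $ 1) k + of_int (k $ 2) * hcoef (\<lambda>x. J x $ 2) k)"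
      by (simp add: grad_def sum_2 hcoef_partial_deriv[OF \<psi>] algebra_simps)
    then show "(\<Sum>i\<in>UNIV. hcoef (\<lambda>x. J x $ i) k * hcoef (\<lambda>x. grad \<psi> x $ i) k) = 0"
      using r by simp
  qed
  then show ?l using r by (simp add: div_free_def)
qed

text \<open>Extends the orthogonality in \<open>div_free\<close> from smooth test functions to weak
  gradients: at each frequency one coefficient vector is orthogonal to k and the other parallel to
  k.\<close>

lemma div_free_grad_orth:
  assumes "div_free J" "H1_per_grad \<phi> g"
  shows "cell_inner J g = 0"
proof (rule cell_inner_eq_0I)
  have g: "L2_cell g" "\<And>i. hcoef (\<lambda>x. g x $ i) 0 = 0"
     "\<And>k. of_int (k $ 1) * hcoef (\<lambda>x. g x $ 2) k = of_int (k $ 2) * hcoef (\<lambda>x. g x $ 1) k"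
    using assms(2) H1_per_grad_exists_iff[of g] by blast+
  show "L2_cell g" by (rule g)
  show "L2_cell J" using assms(1) by (simp add: div_free_def)
  fix k :: "int^2"
  let ?a = "of_int (k $ 1) :: real" and ?b = "of_int (k $ 2) :: real"
    and ?J = "\<lambda>i. hcoef (\<lambda>x. J x $ i) k" and ?g = "\<lambda>i. hcoef (\<lambda>x. g x $ i) k"
  have J: "?a * ?J 1 + ?b * ?J 2 = 0"
    using assms(1) by (simp add: div_free_iff)
  show "(\<Sum>i\<in>UNIV. ?J i * ?g i) = 0"
  proof (cases "k = 0")
    case True then show ?thesis using g(2) by simp
  next
    case False
    then have "?a \<noteq> 0 \<or> ?b \<noteq> 0" by (auto simp: vec_eq_iff forall_2)
    moreover have "?a * (?J 1 * ?g 1 + ?J 2 * ?g 2) = 0"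
      using J g(3)[of k] by algebra
    moreover have "?b * (?J 1 * ?g 1 + ?J 2 * ?g 2) = 0"
      using J g(3)[of k] by algebra
    ultimately show ?thesis by (auto simp: sum_2)
  qed
qed

section \<open>Rotation by a right angle, and linear operations on gradients and divergence-free
  fields\<close>

lemma R_perp_mult: "R_perp *v v = vector [- (v $ 2), v $ 1]"
  by (simp add: R_perp_def vec_eq_iff forall_2 matrix_vector_mult_def sum_2)

lemma div_free_rotated_grad:
  assumes "H1_per_grad \<phi> g"
  shows "div_free (\<lambda>x. R_perp *v g x)"
proof -
  have "L2_cell g" using assms by (simp add: H1_per_grad_def)
  then have "L2_cell (\<lambda>x. R_perp *v g x)"
    by (rule L2_cell_linear) simp
  then show ?thesis
    using H1_per_grad_exists_iff[of g] assms
    by (auto simp: div_free_iff R_perp_mult hcoef_minus)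
qed

text \<open>Zero divergence says nothing about frequency 0, while a gradient has mean zero; hence
  the rotated mean is subtracted.\<close>

lemma grad_rotated_div_free:
  assumes "div_free J"
  shows "\<exists>\<phi>. H1_per_grad \<phi> (\<lambda>x. R_perp *v J x - R_perp *v (LINT x|cell_measure. J x))"
proof -
  have J: "L2_cell J" using assms by (simp add: div_free_def)
  have mean: "(LINT x|cell_measure. J x) $ i = hcoef (\<lambda>x. J x $ i) 0" for i
    using integral_bounded_linear[OF bounded_linear_vec_nth[of i] L2_cell_integrable[OF J]]
    by (simp add: hcoef_def)
  define G where "G x = R_perp *v J x - R_perp *v (LINT x|cell_measure. J x)" for x
  have "L2_cell (\<lambda>x. R_perp *v J x)"
    by (rule L2_cell_linear[OF J]) simp
  then have "L2_cell G"
    unfolding G_def by (intro L2_cell_diff L2_cell_const)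
  moreover have "hcoef (\<lambda>x. G x $ 2) k = hcoef (\<lambda>x. J x $ 1) k - (if k = 0 then hcoef (\<lambda>x. J x $ 1) 0 else 0)" for k
    using hcoef_diff_const[OF L2_cell_nth[OF J, of 1], of "hcoef (\<lambda>x. J x $ 1) 0" k]
    by (simp add: G_def R_perp_mult mean)
  moreover have "hcoef (\<lambda>x. G x $ 1) k = - (hcoef (\<lambda>x. J x $ 2) k - (if k = 0 then hcoef (\<lambda>x. J x $ 2) 0 else 0))" for k
    unfolding hcoef_diff_const[OF L2_cell_nth[OF J, of 2], of "hcoef (\<lambda>x. J x $ 2) 0" k, symmetric]
      hcoef_minus[symmetric]
    by (simp add: G_def R_perp_mult mean)
  moreover have "of_int (k $ 1) * hcoef (\<lambda>x. J x $ 1) k + of_int (k $ 2) * hcoef (\<lambda>x. J x $ 2) k = 0" for k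
    using assms by (simp add: div_free_iff)
  ultimately have "\<exists>\<phi>. H1_per_grad \<phi> G"
    unfolding H1_per_grad_exists_iff by (simp add: forall_2 eq_neg_iff_add_eq_0)
  then show ?thesis unfolding G_def .
qed

lemma div_free_const: "div_free (\<lambda>x. c)"
  by (auto simp: div_free_iff hcoef_const)

lemma div_free_lincomb:
  assumes "div_free J" "div_free K" shows "div_free (\<lambda>x. J x + c *\<^sub>R K x)"
proof -
  have L: "L2_cell J" "L2_cell K" using assms by (auto simp: div_free_def)
  have "hcoef (\<lambda>x. (J x + c *\<^sub>R K x) $ i) k = hcoef (\<lambda>x. J x $ i) k + c * hcoef (\<lambda>x. K x $ i) k" for i k
    using hcoef_lincomb[OF L2_cell_nth[OF L(1), of i] L2_cell_nth[OF L(2), of i], where c=c and k=k] by simp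
  moreover have "L2_cell (\<lambda>x. J x + c *\<^sub>R K x)"
    by (intro L2_cell_add L2_cell_scaleR L)
  moreover have "a * (u + c * u') + b * (v + c * v') = (a * u + b * v) + c * (a * u' + b * v')" for a b u u' v v' :: real
    by (simp add: algebra_simps)
  ultimately show ?thesis using assms by (simp add: div_free_iff)
qed

lemma grad_lincomb:
  assumes "H1_per_grad \<phi> g" "H1_per_grad \<phi>' h"
  shows "\<exists>\<psi>. H1_per_grad \<psi> (\<lambda>x. g x + c *\<^sub>R h x)"
proof -
  have g: "L2_cell g" "\<And>i. hcoef (\<lambda>x. g x $ i) 0 = 0"
     "\<And>k. of_int (k $ 1) * hcoef (\<lambda>x. g x $ 2) k = of_int (k $ 2) * hcoef (\<lambda>x. g x $ 1) k"
    using assms(1) H1_per_grad_exists_iff[of g] by blast+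
  have h: "L2_cell h" "\<And>i. hcoef (\<lambda>x. h x $ i) 0 = 0"
     "\<And>k. of_int (k $ 1) * hcoef (\<lambda>x. h x $ 2) k = of_int (k $ 2) * hcoef (\<lambda>x. h x $ 1) k"
    using assms(2) H1_per_grad_exists_iff[of h] by blast+
  have c: "hcoef (\<lambda>x. (g x + c *\<^sub>R h x) $ i) k = hcoef (\<lambda>x. g x $ i) k + c * hcoef (\<lambda>x. h x $ i) k" for i k
    using hcoef_lincomb[OF L2_cell_nth[OF g(1), of i] L2_cell_nth[OF h(1), of i], where c=c and k=k] by simp
  have "L2_cell (\<lambda>x. g x + c *\<^sub>R h x)"
    by (intro L2_cell_add L2_cell_scaleR g h)
  then show ?thesis
    unfolding H1_per_grad_exists_iff c using g(2,3) h(2,3) by (simp add: distrib_left mult.left_commute)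
qed

text \<open>Makes smooth gradients admissible in the projection problem, so that energy
  orthogonality yields the weak divergence condition.\<close>

lemma H1_per_grad_smooth:
  assumes "smooth f" "periodic f" shows "\<exists>\<phi>. H1_per_grad \<phi> (grad f)"
  unfolding H1_per_grad_exists_iff
  using grad_smooth_L2[OF assms(1)] hcoef_partial_deriv[OF assms] by (simp add: grad_def)

section \<open>The cell problem\<close>

lemma op_apply_nth: "op_apply M E $ i = M $ i $ 1 *v E $ 1 + M $ i $ 2 *v E $ 2"
  by (simp add: op_apply_def sum_2)

lemma op_apply_lincomb: "op_apply M (E + c *\<^sub>R F) = op_apply M E + c *\<^sub>R op_apply M F"
  by (simp add: vec_eq_iff[of "op_apply M (E + c *\<^sub>R F)"] op_apply_nth matrix_vector_right_distrib
      matrix_vector_mult_scaleR scaleR_add_right)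

lemma linear_op_apply: "linear (op_apply M)"
proof (rule linearI)
  show "op_apply M (E + F) = op_apply M E + op_apply M F" for E F
    using op_apply_lincomb[of M E 1 F] by simp
  have "op_apply M 0 = 0"
    by (simp add: vec_eq_iff[of "op_apply M 0"] op_apply_nth)
  then show "op_apply M (c *\<^sub>R E) = c *\<^sub>R op_apply M E" for c E
    using op_apply_lincomb[of M 0 c E] by simp
qed

lemma linear_op_apply_obtain:
  assumes "linear \<Phi>" obtains M where "op_apply M = \<Phi>"
proof
  define M :: T_op where "M = (\<chi> i j. \<chi> p q. \<Phi> (axis j (axis q 1)) $ i $ p)"
  show "op_apply M = \<Phi>"
  proof
    fix E :: T_space
    have E: "E = (\<Sum>j\<in>UNIV. \<Sum>q\<in>UNIV. (E $ j $ q) *\<^sub>R axis j (axis q 1))"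
      by (simp add: vec_eq_iff forall_2 sum_2 axis_def)
    have "\<Phi> E = (\<Sum>j\<in>UNIV. \<Sum>q\<in>UNIV. (E $ j $ q) *\<^sub>R \<Phi> (axis j (axis q 1)))"
      by (subst E) (simp only: linear_sum[OF assms] linear_scale[OF assms])
    then show "op_apply M E = \<Phi> E"
      by (simp add: vec_eq_iff op_apply_def M_def matrix_vector_mult_def sum_2 mult.commute)
  qed
qed

lemma op_apply_eqD:
  assumes "\<And>E. op_apply M E = op_apply N E" shows "M = N"
proof -
  have "M $ i $ j *v v = N $ i $ j *v v" for i j v
  proof -
    have "op_apply K (axis j v) $ i = K $ i $ j *v v" for K
      using exhaust_2[of j] by (auto simp: op_apply_nth axis_def)
    then show ?thesis using assms by metis
  qed
  then have "M $ i $ j = N $ i $ j" for i j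
    by (simp add: matrix_eq)
  then show ?thesis by (simp add: vec_eq_iff)
qed

lemma cell_solution_iff:
  "cell_solution L E0 E \<longleftrightarrow> (\<forall>i. \<exists>\<phi>. H1_per_grad \<phi> (\<lambda>x. E x $ i - E0 $ i))
     \<and> (\<forall>i. div_free (\<lambda>x. op_apply (L x) (E x) $ i))"
proof -
  have "(\<exists>\<phi>1 \<phi>2 g1 g2. H1_per_grad \<phi>1 g1 \<and> H1_per_grad \<phi>2 g2 \<and> (\<forall>x. E x = E0 + vector [g1 x, g2 x]))
     \<longleftrightarrow> (\<forall>i. \<exists>\<phi>. H1_per_grad \<phi> (\<lambda>x. E x $ i - E0 $ i))"
    (is "?l = ?r")
  proof
    assume ?l
    then obtain \<phi>1 \<phi>2 g1 g2 where g: "H1_per_grad \<phi>1 g1" "H1_per_grad \<phi>2 g2"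
      and E: "\<And>x. E x = E0 + vector [g1 x, g2 x]" by blast
    have "(\<lambda>x. E x $ 1 - E0 $ 1) = g1" "(\<lambda>x. E x $ 2 - E0 $ 2) = g2"
      by (simp_all add: E)
    then show ?r using g by (auto simp: forall_2)
  next
    assume ?r
    then obtain \<phi>1 \<phi>2 where "H1_per_grad \<phi>1 (\<lambda>x. E x $ 1 - E0 $ 1)" "H1_per_grad \<phi>2 (\<lambda>x. E x $ 2 - E0 $ 2)"
      by (auto simp: forall_2)
    moreover have "E x = E0 + vector [E x $ 1 - E0 $ 1, E x $ 2 - E0 $ 2]" for x
      by (simp add: vec_eq_iff[of "E x"] forall_2)
    ultimately show ?l by blast
  qed
  then show ?thesis by (simp add: cell_solution_def)
qed

text \<open>Each coefficient is a continuous functional in mean square and being a gradient is a set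
  of linear equations between coefficients, so gradients form a closed subspace.\<close>

lemma grad_limit:
  fixes u :: "nat \<Rightarrow> real^2 \<Rightarrow> T_space"
  assumes u: "\<And>n. L2_cell (u n)" "\<And>n i. \<exists>\<phi>. H1_per_grad \<phi> (\<lambda>x. u n x $ i)" and v: "L2_cell v"
    and lim: "(\<lambda>n. cell_sq (\<lambda>x. u n x - v x)) \<longlonglongrightarrow> 0"
  shows "\<exists>\<phi>. H1_per_grad \<phi> (\<lambda>x. v x $ i)"
proof -
  have c: "(\<lambda>n. hcoef (\<lambda>x. u n x $ i $ j) k) \<longlonglongrightarrow> hcoef (\<lambda>x. v x $ i $ j) k" for j k
  proof -
    have eq: "hcoef (\<lambda>x. w x $ i $ j) k = cell_inner w (\<lambda>x. axis i (axis j (hartley k x)))" for w :: "real^2 \<Rightarrow> T_space"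
      by (simp add: hcoef_def inner_axis)
    have "L2_cell (\<lambda>x. axis i (axis j (hartley k x)) :: T_space)"
      by (rule L2_cell_linear[OF L2_hartley], rule linearI) (auto simp: vec_eq_iff axis_def)
    then show ?thesis
      unfolding eq by (rule cell_inner_tendsto[OF u(1) v _ lim])
  qed
  have g: "hcoef (\<lambda>x. u n x $ i $ j) 0 = 0"
     "of_int (k $ 1) * hcoef (\<lambda>x. u n x $ i $ 2) k = of_int (k $ 2) * hcoef (\<lambda>x. u n x $ i $ 1) k" for n j k
    using u(2)[of n i] unfolding H1_per_grad_exists_iff by blast+
  have "hcoef (\<lambda>x. v x $ i $ j) 0 = 0" for j
    using c[of j 0] unfolding g by (simp add: LIMSEQ_const_iff)
  moreover have "of_int (k $ 1) * hcoef (\<lambda>x. v x $ i $ 2) k = of_int (k $ 2) * hcoef (\<lambda>x. v x $ i $ 1) k" for k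
  proof (rule LIMSEQ_unique)
    show "(\<lambda>n. of_int (k $ 1) * hcoef (\<lambda>x. u n x $ i $ 2) k) \<longlonglongrightarrow> of_int (k $ 1) * hcoef (\<lambda>x. v x $ i $ 2) k"
      by (intro tendsto_intros c)
    show "(\<lambda>n. of_int (k $ 1) * hcoef (\<lambda>x. u n x $ i $ 2) k) \<longlonglongrightarrow> of_int (k $ 2) * hcoef (\<lambda>x. v x $ i $ 1) k"
      unfolding g(2) by (intro tendsto_intros c)
  qed
  ultimately show ?thesis
    unfolding H1_per_grad_exists_iff using L2_cell_nth[OF v, of i] by blast
qed

lemma L2_cell_if:
  fixes f g :: "real^2 \<Rightarrow> 'a::euclidean_space"
  assumes "L2_cell f" "L2_cell g" and A: "A \<in> sets lebesgue"
  shows "L2_cell (\<lambda>x. if x \<in> A then f x else g x)"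
proof -
  have fm: "f \<in> borel_measurable cell_measure" "g \<in> borel_measurable cell_measure"
    using assms by (auto simp: L2_cell_def)
  have "A \<inter> period_cell \<in> sets cell_measure"
    using A by (auto simp: sets_restrict_space)
  then have m: "(\<lambda>x. if x \<in> A \<inter> period_cell then f x else g x) \<in> borel_measurable cell_measure"
    by (intro measurable_If_set fm) simp
  have m': "(\<lambda>x. if x \<in> A then f x else g x) \<in> borel_measurable cell_measure"
    by (rule measurable_cong[THEN iffD1, OF _ m]) simp
  have int: "integrable cell_measure (\<lambda>x. (norm (f x))\<^sup>2 + (norm (g x))\<^sup>2)"
    using assms by (simp add: L2_cell_def)
  have m2: "(\<lambda>x. (norm (if x \<in> A then f x else g x))\<^sup>2) \<in> borel_measurable cell_measure"
    using measurable_compose[OF m' borel_measurable_norm] by (rule borel_measurable_power)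
  have "integrable cell_measure (\<lambda>x. (norm (if x \<in> A then f x else g x))\<^sup>2)"
    by (rule Bochner_Integration.integrable_bound[OF int m2]) (auto intro!: AE_I2)
  then show ?thesis using m' by (simp add: L2_cell_def)
qed

section \<open>Well-posedness of the cell problem for symmetric coercive phases\<close>

locale two_phase_problem =
  fixes A1 :: "(real^2) set" and L1 L2 :: T_op and \<alpha> :: real
  assumes A1: "A1 \<in> sets lebesgue"
    and sym1: "\<And>E F. op_apply L1 E \<bullet> F = op_apply L1 F \<bullet> E"
    and sym2: "\<And>E F. op_apply L2 E \<bullet> F = op_apply L2 F \<bullet> E"
    and \<alpha>: "0 < \<alpha>"
    and coercive1: "\<And>E. \<alpha> * (norm E)\<^sup>2 \<le> op_apply L1 E \<bullet> E"
    and coercive2: "\<And>E. \<alpha> * (norm E)\<^sup>2 \<le> op_apply L2 E \<bullet> E"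
begin

abbreviation L :: "real^2 \<Rightarrow> T_op" where "L \<equiv> two_phase A1 L1 L2"

lemma flux_if: "op_apply (L x) E = (if x \<in> A1 then op_apply L1 E else op_apply L2 E)"
  by (simp add: two_phase_def)

lemma L_sym: "op_apply (L x) E \<bullet> F = op_apply (L x) F \<bullet> E"
  using sym1[of E F] sym2[of E F] by (simp add: flux_if)

lemma L_coercive: "\<alpha> * (norm E)\<^sup>2 \<le> op_apply (L x) E \<bullet> E"
  using coercive1 coercive2 by (simp add: flux_if)

lemma L_bounded: "\<exists>\<beta>. \<forall>x E. op_apply (L x) E \<bullet> E \<le> \<beta> * (norm E)\<^sup>2"
proof -
  obtain B1 where B1: "\<And>E. norm (op_apply L1 E) \<le> B1 * norm E"
    using linear_bounded[OF linear_op_apply] by blast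
  obtain B2 where B2: "\<And>E. norm (op_apply L2 E) \<le> B2 * norm E"
    using linear_bounded[OF linear_op_apply] by blast
  have "op_apply (L x) E \<bullet> E \<le> max B1 B2 * (norm E)\<^sup>2" for x E
  proof -
    have "norm (op_apply (L x) E) \<le> max B1 B2 * norm E"
      using B1[of E] B2[of E] mult_right_mono[OF max.cobounded1[of B1 B2] norm_ge_zero[of E]]
        mult_right_mono[OF max.cobounded2[of B2 B1] norm_ge_zero[of E]]
      by (auto simp: flux_if)
    then have "norm (op_apply (L x) E) * norm E \<le> max B1 B2 * norm E * norm E"
      by (rule mult_right_mono) simp
    then show ?thesis
      using norm_cauchy_schwarz[of "op_apply (L x) E" E] by (simp add: power2_eq_square mult.assoc)
  qed
  then show ?thesis by blast
qed

lemma L2_flux: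
  assumes "L2_cell E" shows "L2_cell (\<lambda>x. op_apply (L x) (E x))"
  unfolding flux_if by (intro L2_cell_if L2_cell_linear[OF assms] linear_op_apply A1)

abbreviation energy :: "(real^2 \<Rightarrow> T_space) \<Rightarrow> (real^2 \<Rightarrow> T_space) \<Rightarrow> real" where
  "energy u v \<equiv> cell_inner (\<lambda>x. op_apply (L x) (u x)) v"

lemma energy_coercive:
  assumes "L2_cell u" shows "\<alpha> * cell_sq u \<le> energy u u"
proof -
  have "(LINT x|cell_measure. \<alpha> * (norm (u x))\<^sup>2) \<le> energy u u"
    using assms by (intro integral_mono L_coercive L2_cell_inner L2_flux) (simp add: L2_cell_def)
  then show ?thesis by simp
qed

lemma energy_lincomb:
  assumes "L2_cell u" "L2_cell v" "L2_cell w"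
  shows "energy (\<lambda>x. u x + c *\<^sub>R v x) w = energy u w + c * energy v w"
  using L2_cell_inner[OF L2_flux[OF assms(1)] assms(3)] L2_cell_inner[OF L2_flux[OF assms(2)] assms(3)]
  by (simp add: op_apply_lincomb inner_add_left)

text \<open>The constant -E0 is projected onto the gradient fields in the energy product. Coercivity
  makes energy-Cauchy sequences Cauchy in mean square, and boundedness of the phases brings
  convergence back to the energy.\<close>

lemma cell_solution_exists: "\<exists>E. cell_solution L E0 E"
proof -
  define V :: "(real^2 \<Rightarrow> T_space) set" where "V = Collect L2_cell"
  define H where "H = {u \<in> V. \<forall>i. \<exists>\<phi>. H1_per_grad \<phi> (\<lambda>x. u x $ i)}"
  obtain p where p: "p \<in> H" "\<forall>h\<in>H. energy (\<lambda>x. - E0 - p x) h = 0"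
  proof (rule orthogonal_projection_exists[of V H energy "\<lambda>x. - E0"])
    show "(\<lambda>x. u x + c *\<^sub>R v x) \<in> V" if "u \<in> V" "v \<in> V" for u v c
      using that by (simp add: V_def L2_cell_add L2_cell_scaleR)
    show "(\<lambda>x. u x + c *\<^sub>R v x) \<in> H" if "u \<in> H" "v \<in> H" for u v c
    proof -
      have "\<exists>\<phi>. H1_per_grad \<phi> (\<lambda>x. u x $ i + c *\<^sub>R (v x $ i))" for i
        using that grad_lincomb by (force simp: H_def)
      then show ?thesis using that by (simp add: H_def V_def L2_cell_add L2_cell_scaleR)
    qed
    have "\<exists>\<phi>. H1_per_grad \<phi> (\<lambda>x. 0)"
      unfolding H1_per_grad_exists_iff by (simp add: hcoef_const)
    then show "(\<lambda>x. 0) \<in> H" by (simp add: H_def V_def)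
    show "H \<subseteq> V" by (auto simp: H_def)
    show "energy (\<lambda>x. u x + c *\<^sub>R v x) w = energy u w + c * energy v w"
      if "u \<in> V" "v \<in> V" "w \<in> V" for u v w c
      using that by (intro energy_lincomb) (auto simp: V_def)
    show "energy u v = energy v u" for u v
      by (simp only: L_sym)
    show "0 \<le> energy u u" if "u \<in> V" for u
    proof -
      have "0 \<le> \<alpha> * cell_sq u" using \<alpha> by simp
      then show ?thesis using energy_coercive[of u] that by (simp add: V_def)
    qed
    show "(\<lambda>x. - E0) \<in> V" by (simp add: V_def)
    fix s :: "nat \<Rightarrow> real^2 \<Rightarrow> T_space"
    assume sH: "\<And>n. s n \<in> H"
      and Cauchy: "\<And>e. e > 0 \<Longrightarrow> \<exists>N. \<forall>m\<ge>N. \<forall>n\<ge>N. energy (\<lambda>x. s m x - s n x) (\<lambda>x. s m x - s n x) < e"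
    have s: "L2_cell (s n)" "\<exists>\<phi>. H1_per_grad \<phi> (\<lambda>x. s n x $ i)" for n i
      using sH[of n] by (auto simp: H_def V_def)
    obtain v where v: "L2_cell v" "(\<lambda>n. cell_sq (\<lambda>x. s n x - v x)) \<longlonglongrightarrow> 0"
    proof (rule L2_cell_complete[of s])
      show "L2_cell (s n)" for n by (rule s)
      show "\<exists>N. \<forall>m\<ge>N. \<forall>n\<ge>N. cell_sq (\<lambda>x. s m x - s n x) < e" if "e > 0" for e
      proof -
        have "0 < \<alpha> * e" using \<alpha> that by simp
        from Cauchy[OF this] obtain N where
          N: "\<forall>m\<ge>N. \<forall>n\<ge>N. energy (\<lambda>x. s m x - s n x) (\<lambda>x. s m x - s n x) < \<alpha> * e" ..
        have "cell_sq (\<lambda>x. s m x - s n x) < e" if "m \<ge> N" "n \<ge> N" for m n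
        proof -
          have "\<alpha> * cell_sq (\<lambda>x. s m x - s n x) < \<alpha> * e"
            using energy_coercive[OF L2_cell_diff[OF s(1) s(1)], of m n] N[rule_format, OF that] by linarith
          then show ?thesis using \<alpha> by simp
        qed
        then show ?thesis by blast
      qed
    qed
    have "\<exists>\<phi>. H1_per_grad \<phi> (\<lambda>x. v x $ i)" for i
      by (rule grad_limit[OF s v])
    then have "v \<in> H" using v(1) by (simp add: H_def V_def)
    moreover have "(\<lambda>n. energy (\<lambda>x. s n x - v x) (\<lambda>x. s n x - v x)) \<longlonglongrightarrow> 0"
    proof -
      obtain \<beta> where \<beta>: "\<And>x E. op_apply (L x) E \<bullet> E \<le> \<beta> * (norm E)\<^sup>2"
        using L_bounded by blast
      have d: "L2_cell (\<lambda>x. s n x - v x)" for n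
        by (intro L2_cell_diff s v)
      have up: "energy (\<lambda>x. s n x - v x) (\<lambda>x. s n x - v x) \<le> \<beta> * cell_sq (\<lambda>x. s n x - v x)" for n
      proof -
        have "energy (\<lambda>x. s n x - v x) (\<lambda>x. s n x - v x) \<le> (LINT x|cell_measure. \<beta> * (norm (s n x - v x))\<^sup>2)"
          using d[of n] by (intro integral_mono \<beta> L2_cell_inner L2_flux d) (simp add: L2_cell_def)
        then show ?thesis by simp
      qed
      have low: "0 \<le> energy (\<lambda>x. s n x - v x) (\<lambda>x. s n x - v x)" for n
      proof -
        have "0 \<le> \<alpha> * cell_sq (\<lambda>x. s n x - v x)" using \<alpha> by simp
        then show ?thesis using energy_coercive[OF d, of n] by linarith
      qed
      show ?thesis
      proof (rule tendsto_sandwich[of "\<lambda>_. 0"])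
        show "(\<lambda>n. \<beta> * cell_sq (\<lambda>x. s n x - v x)) \<longlonglongrightarrow> 0"
          using tendsto_mult_left[OF v(2), of \<beta>] by simp
      qed (use up low in auto)
    qed
    ultimately show "\<exists>h\<in>H. (\<lambda>n. energy (\<lambda>x. s n x - h x) (\<lambda>x. s n x - h x)) \<longlonglongrightarrow> 0"
      by blast
  qed
  define E where "E x = E0 + p x" for x
  have pL2: "L2_cell p" using p(1) by (simp add: H_def V_def)
  have EL2: "L2_cell E" unfolding E_def by (intro L2_cell_add pL2) simp
  have orth: "energy E h = 0" if "h \<in> H" for h
  proof -
    \<comment> \<open>The residual of the projection is -E, so E itself is orthogonal to all
      gradient fields.\<close>
    have neg: "- E0 - p x = 0 + (-1) *\<^sub>R E x" for x by (simp add: E_def)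
    have "energy (\<lambda>x. 0 + (-1) *\<^sub>R E x) h = energy (\<lambda>x. 0) h + (-1) * energy E h"
      using that by (intro energy_lincomb EL2) (auto simp: H_def V_def)
    moreover have "energy (\<lambda>x. 0) h = 0"
      using linear_0[OF linear_op_apply] by simp
    ultimately show ?thesis using p(2) that unfolding neg by simp
  qed
  have "div_free (\<lambda>x. op_apply (L x) (E x) $ i)" for i
    unfolding div_free_def
  proof (intro conjI allI impI)
    show "L2_cell (\<lambda>x. op_apply (L x) (E x) $ i)"
      by (intro L2_cell_nth L2_flux EL2)
    fix \<psi> assume \<psi>: "smooth \<psi> \<and> periodic \<psi>"
    \<comment> \<open>A smooth gradient in slot i and zero in the other slot isolates the i-th
      component of the flux.\<close>
    have "(\<lambda>x. axis i (grad \<psi> x)) \<in> H"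
    proof -
      have "L2_cell (\<lambda>x. axis i (grad \<psi> x) :: T_space)"
        using \<psi> by (intro L2_cell_linear[OF grad_smooth_L2] linearI) (auto simp: vec_eq_iff axis_def)
      moreover have "\<exists>\<phi>. H1_per_grad \<phi> (\<lambda>x. axis i (grad \<psi> x) $ j)" for j
      proof (cases "j = i")
        case True then show ?thesis using H1_per_grad_smooth \<psi> by (simp add: axis_def)
      next
        case False
        then show ?thesis
          unfolding H1_per_grad_exists_iff by (simp add: axis_def hcoef_const)
      qed
      ultimately show ?thesis by (simp add: H_def V_def)
    qed
    from orth[OF this] show "cell_inner (\<lambda>x. op_apply (L x) (E x) $ i) (grad \<psi>) = 0"
      by (simp add: inner_axis)
  qed
  moreover have "\<exists>\<phi>. H1_per_grad \<phi> (\<lambda>x. E x $ i - E0 $ i)" for i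
    using p(1) by (simp add: E_def H_def)
  ultimately show ?thesis unfolding cell_solution_iff by blast
qed

lemma cell_solution_L2:
  assumes "cell_solution L E0 E" shows "L2_cell E"
proof (rule L2_cell_nthI)
  fix i
  have "L2_cell (\<lambda>x. E x $ i - E0 $ i)"
    using assms unfolding cell_solution_iff by (auto simp: H1_per_grad_def)
  from L2_cell_add[OF this L2_cell_const[of "E0 $ i"]] show "L2_cell (\<lambda>x. E x $ i)" by simp
qed

lemma cell_solution_flux_integrable:
  assumes "cell_solution L E0 E" shows "integrable cell_measure (\<lambda>x. op_apply (L x) (E x))"
  by (intro L2_cell_integrable L2_flux cell_solution_L2[OF assms])

text \<open>Hill's lemma: the flux is orthogonal to the fluctuation F - F0, so the energy depends
  only on averages. It yields both uniqueness of the flux average and symmetry of the effective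
  tensor.\<close>

lemma energy_average:
  assumes E: "cell_solution L E0 E" and F: "cell_solution L F0 F"
  shows "energy E F = (LINT x|cell_measure. op_apply (L x) (E x)) \<bullet> F0"
proof -
  let ?J = "\<lambda>x. op_apply (L x) (E x)"
  have J: "L2_cell ?J" by (intro L2_flux cell_solution_L2[OF E])
  have FL: "L2_cell F" by (rule cell_solution_L2[OF F])
  have 0: "cell_inner (\<lambda>x. ?J x $ i) (\<lambda>x. F x $ i - F0 $ i) = 0" for i
    using E F div_free_grad_orth unfolding cell_solution_iff by blast
  have int: "integrable cell_measure (\<lambda>x. ?J x $ i \<bullet> (F x $ i - F0 $ i))" for i
    by (intro L2_cell_inner L2_cell_nth J L2_cell_diff FL L2_cell_const)
  have "cell_inner ?J (\<lambda>x. F x - F0) = (LINT x|cell_measure. (\<Sum>i\<in>UNIV. ?J x $ i \<bullet> (F x $ i - F0 $ i)))"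
    by (simp add: inner_vec_def[of "op_apply _ _"])
  also have "\<dots> = (\<Sum>i\<in>UNIV. cell_inner (\<lambda>x. ?J x $ i) (\<lambda>x. F x $ i - F0 $ i))"
    by (rule Bochner_Integration.integral_sum) (rule int)
  finally have "cell_inner ?J (\<lambda>x. F x - F0) = 0" using 0 by simp
  moreover have "cell_inner ?J (\<lambda>x. F x - F0) = energy E F - cell_inner ?J (\<lambda>x. F0)"
    using L2_cell_inner[OF J FL] L2_cell_inner[OF J L2_cell_const[of F0]] by (simp add: inner_diff_right)
  moreover have "cell_inner ?J (\<lambda>x. F0) = (LINT x|cell_measure. ?J x) \<bullet> F0"
    using L2_cell_integrable[OF J] by simp
  ultimately show ?thesis by simp
qed

lemma cell_solution_lincomb:
  assumes E: "cell_solution L E0 E" and F: "cell_solution L F0 F"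
  shows "cell_solution L (E0 + c *\<^sub>R F0) (\<lambda>x. E x + c *\<^sub>R F x)"
  unfolding cell_solution_iff
proof (intro conjI allI)
  fix i
  obtain \<phi> \<phi>' where "H1_per_grad \<phi> (\<lambda>x. E x $ i - E0 $ i)" "H1_per_grad \<phi>' (\<lambda>x. F x $ i - F0 $ i)"
    using E F unfolding cell_solution_iff by blast
  from grad_lincomb[OF this, of c]
  show "\<exists>\<phi>. H1_per_grad \<phi> (\<lambda>x. (E x + c *\<^sub>R F x) $ i - (E0 + c *\<^sub>R F0) $ i)"
    by (simp add: algebra_simps)
  have "div_free (\<lambda>x. op_apply (L x) (E x) $ i + c *\<^sub>R op_apply (L x) (F x) $ i)"
    using E F unfolding cell_solution_iff by (intro div_free_lincomb) blast+
  then show "div_free (\<lambda>x. op_apply (L x) (E x + c *\<^sub>R F x) $ i)"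
    by (simp add: op_apply_lincomb)
qed

lemma flux_average_lincomb:
  assumes E: "cell_solution L E0 E" and F: "cell_solution L F0 F"
  shows "(LINT x|cell_measure. op_apply (L x) (E x + c *\<^sub>R F x))
     = (LINT x|cell_measure. op_apply (L x) (E x)) + c *\<^sub>R (LINT x|cell_measure. op_apply (L x) (F x))"
  using cell_solution_flux_integrable[OF E] cell_solution_flux_integrable[OF F]
  by (simp add: op_apply_lincomb)

text \<open>The difference of two solutions solves the problem with zero mean, hence has zero
  energy, hence vanishes a.e. by coercivity.\<close>

lemma flux_average_unique:
  assumes E: "cell_solution L E0 E" and F: "cell_solution L E0 F"
  shows "(LINT x|cell_measure. op_apply (L x) (E x)) = (LINT x|cell_measure. op_apply (L x) (F x))"
proof -
  let ?D = "\<lambda>x. E x + (-1) *\<^sub>R F x"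
  have "cell_solution L (E0 + (-1) *\<^sub>R E0) ?D"
    by (rule cell_solution_lincomb[OF E F])
  then have D: "cell_solution L 0 ?D" by simp
  have DL: "L2_cell ?D" by (rule cell_solution_L2[OF D])
  have "energy ?D ?D = 0"
    using energy_average[OF D D] by simp
  then have "\<alpha> * cell_sq ?D \<le> 0"
    using energy_coercive[OF DL] by simp
  then have "cell_sq ?D \<le> 0" using \<alpha> by (simp only: mult_le_0_iff) auto
  moreover have "0 \<le> cell_sq ?D" by simp
  ultimately have "cell_sq ?D = 0" by linarith
  then have "AE x in cell_measure. ?D x = 0"
    by (rule cell_sq_eq_0_AE[OF DL])
  then have ae: "AE x in cell_measure. op_apply (L x) (E x) = op_apply (L x) (F x)"
    by eventually_elim simp
  show ?thesis
    using cell_solution_flux_integrable[OF E] cell_solution_flux_integrable[OF F]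
    by (intro integral_cong_AE ae borel_measurable_integrable)
qed

text \<open>Justifies the definite description: the average flux is a linear function of E0
  independent of the chosen solution, and an operator is determined by its action on all E0.\<close>

lemma is_effective_tensor_effective_tensor: "is_effective_tensor L (effective_tensor L)"
proof -
  define S where "S E0 = (SOME E. cell_solution L E0 E)" for E0
  have S: "cell_solution L E0 (S E0)" for E0
    unfolding S_def using cell_solution_exists by (rule someI_ex)
  define \<Phi> where "\<Phi> E0 = (LINT x|cell_measure. op_apply (L x) (S E0 x))" for E0
  have \<Phi>: "\<Phi> E0 = (LINT x|cell_measure. op_apply (L x) (E x))" if "cell_solution L E0 E" for E0 E
    unfolding \<Phi>_def by (rule flux_average_unique[OF S that])
  have lin: "\<Phi> (E0 + c *\<^sub>R F0) = \<Phi> E0 + c *\<^sub>R \<Phi> F0" for E0 F0 c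
    using \<Phi>[OF cell_solution_lincomb[OF S S]] flux_average_lincomb[OF S S]
    by (simp add: \<Phi>_def)
  have "linear \<Phi>"
  proof (rule linearI)
    show "\<Phi> (E0 + F0) = \<Phi> E0 + \<Phi> F0" for E0 F0 using lin[of E0 1 F0] by simp
    have "\<Phi> 0 = 0" using lin[of 0 1 0] by simp
    then show "\<Phi> (c *\<^sub>R E0) = c *\<^sub>R \<Phi> E0" for c E0 using lin[of 0 c E0] by simp
  qed
  then obtain M where M: "op_apply M = \<Phi>"
    by (rule linear_op_apply_obtain)
  have "is_effective_tensor L M"
    unfolding is_effective_tensor_def using M \<Phi> cell_solution_exists by simp
  moreover have "N = M" if "is_effective_tensor L N" for N
  proof (rule op_apply_eqD)
    fix E0
    show "op_apply N E0 = op_apply M E0"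
      using that S[of E0] unfolding is_effective_tensor_def M \<Phi>_def by blast
  qed
  ultimately show ?thesis
    unfolding effective_tensor_def by (rule theI)
qed

lemma effective_tensor_eq:
  assumes "cell_solution L E0 E"
  shows "op_apply (effective_tensor L) E0 = (LINT x|cell_measure. op_apply (L x) (E x))"
  using is_effective_tensor_effective_tensor assms unfolding is_effective_tensor_def by blast

lemma effective_tensor_sym:
  "op_apply (effective_tensor L) E0 \<bullet> F0 = op_apply (effective_tensor L) F0 \<bullet> E0"
proof -
  obtain E F where E: "cell_solution L E0 E" and F: "cell_solution L F0 F"
    using cell_solution_exists by blast
  have "energy E F = energy F E" by (simp only: L_sym)
  then show ?thesis
    using energy_average[OF E F] energy_average[OF F E] effective_tensor_eq[OF E] effective_tensor_eq[OF F]
    by simp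
qed

end

section \<open>Exact relations for the effective tensor\<close>

lemma grad_lincomb2:
  assumes "\<exists>\<phi>. H1_per_grad \<phi> g" "\<exists>\<phi>. H1_per_grad \<phi> h"
  shows "\<exists>\<phi>. H1_per_grad \<phi> (\<lambda>x. a *\<^sub>R g x + b *\<^sub>R h x)"
proof -
  have "\<exists>\<phi>. H1_per_grad \<phi> (\<lambda>x. 0)"
    unfolding H1_per_grad_exists_iff by (simp add: hcoef_const)
  then obtain \<phi> where "H1_per_grad \<phi> (\<lambda>x. a *\<^sub>R g x)"
    using assms(1) grad_lincomb[of _ "\<lambda>x. 0" _ g a] by auto
  then show ?thesis using assms(2) grad_lincomb by blast
qed

lemma div_free_lincomb2:
  assumes "div_free J" "div_free K" shows "div_free (\<lambda>x. a *\<^sub>R J x + b *\<^sub>R K x)"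
  using div_free_lincomb[OF div_free_lincomb[OF div_free_const[of 0] assms(1), of a] assms(2), of b] by simp

lemma div_free_rotated:
  assumes "\<exists>\<phi>. H1_per_grad \<phi> (\<lambda>x. e x - e0)"
  shows "div_free (\<lambda>x. R_perp *v e x)"
proof -
  obtain \<phi> where "H1_per_grad \<phi> (\<lambda>x. e x - e0)" using assms ..
  from div_free_lincomb[OF div_free_const[of "R_perp *v e0"] div_free_rotated_grad[OF this], of 1]
  show ?thesis by (simp add: matrix_vector_mult_diff_distrib)
qed

lemma integral_grad:
  assumes "\<exists>\<phi>. H1_per_grad \<phi> (\<lambda>x. e x - e0)"
  shows "(LINT x|cell_measure. e x) = e0"
proof -
  have L: "L2_cell (\<lambda>x. e x - e0)" and 0: "hcoef (\<lambda>x. (e x - e0) $ i) 0 = 0" for i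
    using assms unfolding H1_per_grad_exists_iff by blast+
  have "(LINT x|cell_measure. e x - e0) $ i = 0" for i
    using integral_bounded_linear[OF bounded_linear_vec_nth[of i] L2_cell_integrable[OF L]] 0[of i]
    by (simp add: hcoef_def)
  then have z: "(LINT x|cell_measure. e x - e0) = 0" by (simp add: vec_eq_iff)
  have "(LINT x|cell_measure. (e x - e0) + e0) = (LINT x|cell_measure. e x - e0) + (LINT x|cell_measure. e0)"
    by (intro Bochner_Integration.integral_add L2_cell_integrable L L2_cell_const)
  then show ?thesis using z by simp
qed

lemma integral_op_apply:
  assumes "integrable cell_measure F"
  shows "(LINT x|cell_measure. op_apply M (F x)) = op_apply M (LINT x|cell_measure. F x)"
  using linear_op_apply assms by (intro integral_bounded_linear) (simp add: linear_conv_bounded_linear)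

lemma integral_T_space_nth:
  fixes F :: "real^2 \<Rightarrow> T_space"
  assumes "integrable cell_measure F"
  shows "(LINT x|cell_measure. F x) $ i = (LINT x|cell_measure. F x $ i)"
  using integral_bounded_linear[OF bounded_linear_vec_nth[of i] assms] by simp

lemma op_apply_tensor:
  "op_apply (A \<otimes>\<^sub>b B) E $ i = (A $ i $ 1) *\<^sub>R (B *v E $ 1) + (A $ i $ 2) *\<^sub>R (B *v E $ 2)"
  by (simp add: op_apply_nth tensor_def scaleR_matrix_vector_assoc)

lemma R_perp_nth [simp]:
  "R_perp $ 1 $ 1 = 0" "R_perp $ 1 $ 2 = -1" "R_perp $ 2 $ 1 = 1" "R_perp $ 2 $ 2 = 0"
  by (simp_all add: R_perp_def)

lemma op_apply_T_perp:
  "op_apply T_perp E $ 1 = - (R_perp *v E $ 2)" "op_apply T_perp E $ 2 = R_perp *v E $ 1"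
  by (simp_all add: T_perp_def op_apply_tensor)

lemma op_apply_add_op: "op_apply (M + N) E = op_apply M E + op_apply N E"
  by (simp add: vec_eq_iff[of "op_apply (M + N) E"] op_apply_nth matrix_vector_mult_add_rdistrib)

lemma op_apply_scaleR_op: "op_apply (c *\<^sub>R M) E = c *\<^sub>R op_apply M E"
  by (simp add: vec_eq_iff[of "op_apply (c *\<^sub>R M) E"] op_apply_nth
      scaleR_matrix_vector_assoc[symmetric] scaleR_add_right)

context two_phase_problem
begin

text \<open>Q \<otimes> I mixes the two rows with constant coefficients and therefore preserves
  gradients, as Q' \<otimes> I preserves divergence-free fluxes. Thus (Q \<otimes> I) E is a
  solution with mean (Q \<otimes> I) E0.\<close>

lemma effective_tensor_intertwining:
  assumes c1: "\<And>E. op_apply L1 (op_apply (Q \<otimes>\<^sub>b mat 1) E) = op_apply (Q' \<otimes>\<^sub>b mat 1) (op_apply L1 E)"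
    and c2: "\<And>E. op_apply L2 (op_apply (Q \<otimes>\<^sub>b mat 1) E) = op_apply (Q' \<otimes>\<^sub>b mat 1) (op_apply L2 E)"
  shows "op_apply (effective_tensor L) (op_apply (Q \<otimes>\<^sub>b mat 1) E0)
       = op_apply (Q' \<otimes>\<^sub>b mat 1) (op_apply (effective_tensor L) E0)"
proof -
  obtain E where E: "cell_solution L E0 E" using cell_solution_exists by blast
  have c: "op_apply (L x) (op_apply (Q \<otimes>\<^sub>b mat 1) F) = op_apply (Q' \<otimes>\<^sub>b mat 1) (op_apply (L x) F)" for x F
    using c1 c2 by (simp add: flux_if)
  have "cell_solution L (op_apply (Q \<otimes>\<^sub>b mat 1) E0) (\<lambda>x. op_apply (Q \<otimes>\<^sub>b mat 1) (E x))"
    unfolding cell_solution_iff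
  proof (intro conjI allI)
    fix i
    have "\<exists>\<phi>. H1_per_grad \<phi> (\<lambda>x. (Q $ i $ 1) *\<^sub>R (E x $ 1 - E0 $ 1) + (Q $ i $ 2) *\<^sub>R (E x $ 2 - E0 $ 2))"
      using E unfolding cell_solution_iff by (intro grad_lincomb2) blast+
    then show "\<exists>\<phi>. H1_per_grad \<phi> (\<lambda>x. op_apply (Q \<otimes>\<^sub>b mat 1) (E x) $ i - op_apply (Q \<otimes>\<^sub>b mat 1) E0 $ i)"
      by (simp add: op_apply_tensor algebra_simps)
    have "div_free (\<lambda>x. (Q' $ i $ 1) *\<^sub>R op_apply (L x) (E x) $ 1 + (Q' $ i $ 2) *\<^sub>R op_apply (L x) (E x) $ 2)"
      using E unfolding cell_solution_iff by (intro div_free_lincomb2) blast+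
    then show "div_free (\<lambda>x. op_apply (L x) (op_apply (Q \<otimes>\<^sub>b mat 1) (E x)) $ i)"
      unfolding c op_apply_tensor by simp
  qed
  from effective_tensor_eq[OF this] show ?thesis
    unfolding c integral_op_apply[OF cell_solution_flux_integrable[OF E]] effective_tensor_eq[OF E] .
qed

text \<open>The hypotheses are the operator identity evaluated on a field, so no product of block
  operators has to be formed. The conclusion follows by averaging, as both sides are linear in
  fields with known means.\<close>

lemma effective_tensor_duality:
  fixes a b :: real and C D :: "real^2^2"
  assumes d1: "\<And>E E'. E' = op_apply (C \<otimes>\<^sub>b R_perp) (op_apply L1 E + a *\<^sub>R op_apply T_perp E) \<Longrightarrow>
      op_apply L1 E' + a *\<^sub>R op_apply T_perp E' = b *\<^sub>R op_apply (D \<otimes>\<^sub>b R_perp) E"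
    and d2: "\<And>E E'. E' = op_apply (C \<otimes>\<^sub>b R_perp) (op_apply L2 E + a *\<^sub>R op_apply T_perp E) \<Longrightarrow>
      op_apply L2 E' + a *\<^sub>R op_apply T_perp E' = b *\<^sub>R op_apply (D \<otimes>\<^sub>b R_perp) E"
    and E0': "E0' = op_apply (C \<otimes>\<^sub>b R_perp) (op_apply (effective_tensor L) E0 + a *\<^sub>R op_apply T_perp E0)"
  shows "op_apply (effective_tensor L) E0' + a *\<^sub>R op_apply T_perp E0' = b *\<^sub>R op_apply (D \<otimes>\<^sub>b R_perp) E0"
proof -
  obtain E where E: "cell_solution L E0 E" using cell_solution_exists by blast
  have Egrad: "\<exists>\<phi>. H1_per_grad \<phi> (\<lambda>x. E x $ i - E0 $ i)" for i
    using E unfolding cell_solution_iff by blast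
  have Jdiv: "div_free (\<lambda>x. op_apply (L x) (E x) $ i)" for i
    using E unfolding cell_solution_iff by blast
  have EL: "L2_cell E" by (rule cell_solution_L2[OF E])
  have Emean: "(LINT x|cell_measure. E x) = E0"
    using integral_grad[OF Egrad] by (simp add: vec_eq_iff[of _ E0] integral_T_space_nth[OF L2_cell_integrable[OF EL]])
  \<comment> \<open>\<open>T_perp\<close> swaps the two rows up to sign and rotates each, so it
    sends gradients plus constants to divergence-free fields.\<close>
  have T_div: "div_free (\<lambda>x. op_apply T_perp (F x) $ i)"
    if "\<And>i. \<exists>\<phi>. H1_per_grad \<phi> (\<lambda>x. F x $ i - F0 $ i)" for F :: "real^2 \<Rightarrow> T_space" and F0 :: T_space and i
  proof -
    have "div_free (\<lambda>x. (-1) *\<^sub>R (R_perp *v F x $ 2) + 0 *\<^sub>R (R_perp *v F x $ 1))"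
      by (intro div_free_lincomb2 div_free_rotated[OF that])
    moreover have "div_free (\<lambda>x. R_perp *v F x $ 1)"
      by (rule div_free_rotated[OF that])
    ultimately show ?thesis
      using exhaust_2[of i] by (auto simp: op_apply_T_perp)
  qed
  define J where "J x = op_apply (L x) (E x) + a *\<^sub>R op_apply T_perp (E x)" for x
  define J0 where "J0 = op_apply (effective_tensor L) E0 + a *\<^sub>R op_apply T_perp E0"
  have JL: "L2_cell J"
    unfolding J_def by (intro L2_cell_add L2_flux L2_cell_scaleR L2_cell_linear[OF EL linear_op_apply] EL)
  have J_div: "div_free (\<lambda>x. J x $ i)" for i
    using div_free_lincomb[OF Jdiv[of i] T_div[OF Egrad, of i], of a] by (simp add: J_def)
  have J_mean: "(LINT x|cell_measure. J x) = J0"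
  proof -
    have "(LINT x|cell_measure. J x) = (LINT x|cell_measure. op_apply (L x) (E x)) + a *\<^sub>R (LINT x|cell_measure. op_apply T_perp (E x))"
      unfolding J_def
      using cell_solution_flux_integrable[OF E] L2_cell_integrable[OF L2_cell_linear[OF EL linear_op_apply, of T_perp]]
      by simp
    then show ?thesis
      by (simp add: J0_def effective_tensor_eq[OF E] integral_op_apply[OF L2_cell_integrable[OF EL]] Emean)
  qed
  define E' where "E' x = op_apply (C \<otimes>\<^sub>b R_perp) (J x)" for x
  have E0'_eq: "E0' = op_apply (C \<otimes>\<^sub>b R_perp) J0" by (simp add: E0' J0_def)
  have E'_grad: "\<exists>\<phi>. H1_per_grad \<phi> (\<lambda>x. E' x $ i - E0' $ i)" for i
  proof -
    have r: "\<exists>\<phi>. H1_per_grad \<phi> (\<lambda>x. R_perp *v J x $ j - R_perp *v J0 $ j)" for j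
      using grad_rotated_div_free[OF J_div[of j]]
      by (simp add: integral_T_space_nth[OF L2_cell_integrable[OF JL], symmetric] J_mean)
    from grad_lincomb2[OF r[of 1] r[of 2], of "C $ i $ 1" "C $ i $ 2"]
    show ?thesis by (simp add: E'_def E0'_eq op_apply_tensor algebra_simps)
  qed
  \<comment> \<open>\<open>E'\<close> must solve the problem for the unshifted L. With the shift
    moved to the right, its flux is a combination of rotated gradients plus constants.\<close>
  have flux: "op_apply (L x) (E' x) = b *\<^sub>R op_apply (D \<otimes>\<^sub>b R_perp) (E x) + (- a) *\<^sub>R op_apply T_perp (E' x)" for x
  proof -
    have "op_apply (L x) (E' x) + a *\<^sub>R op_apply T_perp (E' x) = b *\<^sub>R op_apply (D \<otimes>\<^sub>b R_perp) (E x)"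
      using d1[of "E' x" "E x"] d2[of "E' x" "E x"] by (simp add: E'_def J_def flux_if)
    then show ?thesis by (simp add: algebra_simps)
  qed
  have "cell_solution L E0' E'"
    unfolding cell_solution_iff
  proof (intro conjI allI E'_grad)
    fix i
    have "div_free (\<lambda>x. (D $ i $ 1) *\<^sub>R (R_perp *v E x $ 1) + (D $ i $ 2) *\<^sub>R (R_perp *v E x $ 2))"
      by (intro div_free_lincomb2 div_free_rotated[OF Egrad])
    from div_free_lincomb2[OF this T_div[OF E'_grad, of i], of b "- a"]
    show "div_free (\<lambda>x. op_apply (L x) (E' x) $ i)"
      unfolding flux vector_add_component vector_scaleR_component op_apply_tensor .
  qed
  note E' = this
  have E'L: "L2_cell E'" by (rule cell_solution_L2[OF E'])
  have E'mean: "(LINT x|cell_measure. E' x) = E0'"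
    using integral_grad[OF E'_grad] by (simp add: vec_eq_iff[of _ E0'] integral_T_space_nth[OF L2_cell_integrable[OF E'L]])
  have "op_apply (effective_tensor L) E0' = (LINT x|cell_measure. op_apply (L x) (E' x))"
    by (rule effective_tensor_eq[OF E'])
  also have "\<dots> = b *\<^sub>R (LINT x|cell_measure. op_apply (D \<otimes>\<^sub>b R_perp) (E x))
      + (- a) *\<^sub>R (LINT x|cell_measure. op_apply T_perp (E' x))"
    unfolding flux
    using L2_cell_integrable[OF L2_cell_linear[OF EL linear_op_apply, of "D \<otimes>\<^sub>b R_perp"]]
      L2_cell_integrable[OF L2_cell_linear[OF E'L linear_op_apply, of T_perp]]
    by simp
  also have "\<dots> = b *\<^sub>R op_apply (D \<otimes>\<^sub>b R_perp) E0 + (- a) *\<^sub>R op_apply T_perp E0'"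
    by (simp add: integral_op_apply L2_cell_integrable EL E'L Emean E'mean)
  finally show ?thesis by simp
qed

end

section \<open>Algebra of isotropic tensors\<close>

lemma mult_vec_nth: "(M *v v) $ i = M $ i $ 1 * v $ 1 + M $ i $ 2 * v $ 2" for M :: "real^2^2"
  by (simp add: matrix_vector_mult_def sum_2)

lemma R_perp_mult_nth: "(R_perp *v v) $ 1 = - (v $ 2)" "(R_perp *v v) $ 2 = v $ 1"
  by (simp_all add: R_perp_mult)

lemmas op_apply_components = op_apply_add_op op_apply_scaleR_op op_apply_tensor op_apply_T_perp
  mult_vec_nth R_perp_mult_nth

lemma symmetric_matrix2_iff: "transpose S = S \<longleftrightarrow> S $ 2 $ 1 = S $ 1 $ 2" for S :: "real^2^2"
  by (auto simp: vec_eq_iff transpose_def forall_2)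

lemma sym_pos_def_entries:
  assumes "sym_pos_def S"
  shows "S $ 2 $ 1 = S $ 1 $ 2" "0 < S $ 1 $ 1"
proof -
  show "S $ 2 $ 1 = S $ 1 $ 2"
    using assms by (simp add: sym_pos_def_def symmetric_matrix2_iff)
  have "0 < axis 1 1 \<bullet> (S *v axis 1 1)"
    using assms unfolding sym_pos_def_def by (metis axis_eq_0_iff zero_neq_one)
  then have "0 < (S *v axis 1 1) $ 1"
    by (simp only: inner_axis' inner_real_def mult_1)
  then show "0 < S $ 1 $ 1"
    by (simp add: mult_vec_nth axis_def)
qed

lemma isotropic_symmetric:
  assumes "S $ 2 $ 1 = S $ 1 $ 2"
  shows "op_apply (S \<otimes>\<^sub>b mat 1 + r *\<^sub>R T_perp) E \<bullet> F = op_apply (S \<otimes>\<^sub>b mat 1 + r *\<^sub>R T_perp) F \<bullet> E"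
  by (simp add: inner_vec_def sum_2 op_apply_components matrix_vector_mul_lid assms algebra_simps)

text \<open>Completing the square shows that the form is positive when r^2 < det S; compactness of
  the unit sphere then supplies a uniform constant.\<close>

lemma isotropic_coercive:
  fixes S :: "real^2^2"
  assumes S: "S $ 2 $ 1 = S $ 1 $ 2" "0 < S $ 1 $ 1" and r: "r\<^sup>2 < det S"
  obtains \<alpha> where "0 < \<alpha>" "\<forall>E. \<alpha> * (norm E)\<^sup>2 \<le> op_apply (S \<otimes>\<^sub>b mat 1 + r *\<^sub>R T_perp) E \<bullet> E"
proof -
  let ?M = "S \<otimes>\<^sub>b mat 1 + r *\<^sub>R T_perp"
  have pos: "0 < op_apply ?M E \<bullet> E" if "E \<noteq> 0" for E
  proof -
    let ?a = "S $ 1 $ 1" and ?b = "S $ 1 $ 2" and ?c = "S $ 2 $ 2"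
    define p q u v where "p = E $ 1 $ 1" and "q = E $ 1 $ 2" and "u = E $ 2 $ 1" and "v = E $ 2 $ 2"
    have det: "r\<^sup>2 < ?a * ?c - ?b\<^sup>2" using r S(1) by (simp add: det_2 power2_eq_square)
    have "?a * (op_apply ?M E \<bullet> E)
        = (?a * p + ?b * u + r * v)\<^sup>2 + (?a * q + ?b * v - r * u)\<^sup>2 + (?a * ?c - ?b\<^sup>2 - r\<^sup>2) * (u\<^sup>2 + v\<^sup>2)"
      by (simp add: inner_vec_def sum_2 op_apply_components matrix_vector_mul_lid S(1) p_def q_def u_def v_def
          power2_eq_square algebra_simps)
    moreover have "0 < (?a * p + ?b * u + r * v)\<^sup>2 + (?a * q + ?b * v - r * u)\<^sup>2 + (?a * ?c - ?b\<^sup>2 - r\<^sup>2) * (u\<^sup>2 + v\<^sup>2)"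
    proof (cases "u = 0 \<and> v = 0")
      case True
      then have "p \<noteq> 0 \<or> q \<noteq> 0"
        using that by (auto simp: vec_eq_iff forall_2 p_def q_def u_def v_def)
      then show ?thesis
        using True S(2) by (simp add: sum_power2_gt_zero_iff)
    next
      case False
      then have "0 < (?a * ?c - ?b\<^sup>2 - r\<^sup>2) * (u\<^sup>2 + v\<^sup>2)"
        using det by (intro mult_pos_pos) (auto simp: sum_power2_gt_zero_iff)
      then show ?thesis by (intro add_nonneg_pos add_nonneg_nonneg) auto
    qed
    ultimately show ?thesis using S(2) by (metis zero_less_mult_pos)
  qed
  have cont: "continuous_on (sphere 0 1) (\<lambda>E. op_apply ?M E \<bullet> E)"
    using linear_op_apply[of ?M]
    by (intro continuous_intros linear_continuous_on) (simp add: linear_conv_bounded_linear)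
  have "sphere (0 :: T_space) 1 \<noteq> {}"
    by simp
  then obtain E1 where E1: "E1 \<in> sphere 0 1" "\<And>E. E \<in> sphere 0 1 \<Longrightarrow> op_apply ?M E1 \<bullet> E1 \<le> op_apply ?M E \<bullet> E"
    using continuous_attains_inf[OF compact_sphere _ cont] by blast
  define \<alpha> where "\<alpha> = op_apply ?M E1 \<bullet> E1"
  have "0 < \<alpha>" unfolding \<alpha>_def using E1(1) by (intro pos) auto
  moreover have "\<alpha> * (norm E)\<^sup>2 \<le> op_apply ?M E \<bullet> E" for E
  proof (cases "E = 0")
    case False
    let ?n = "norm E" and ?e = "(1 / norm E) *\<^sub>R E"
    have n: "0 < ?n" using False by simp
    have "\<alpha> \<le> op_apply ?M ?e \<bullet> ?e"
      unfolding \<alpha>_def using n by (intro E1(2)) simp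
    also have "\<dots> = (op_apply ?M E \<bullet> E) / ?n\<^sup>2"
      by (simp add: linear_scale[OF linear_op_apply] power2_eq_square)
    finally show ?thesis using n by (simp add: field_simps)
  qed simp
  ultimately show thesis by (intro that[of \<alpha>]) blast+
qed

text \<open>Since R^2 = -I for R = \<open>R_perp\<close>, both products equal \<theta> S R S
  \<otimes> I - r S \<otimes> R.\<close>

lemma isotropic_intertwining:
  fixes S :: "real^2^2"
  assumes "S $ 2 $ 1 = S $ 1 $ 2"
  shows "op_apply ((\<theta> *\<^sub>R S) \<otimes>\<^sub>b mat 1 + r *\<^sub>R T_perp) (op_apply ((R_perp ** S) \<otimes>\<^sub>b mat 1) E)
     = op_apply ((S ** R_perp) \<otimes>\<^sub>b mat 1) (op_apply ((\<theta> *\<^sub>R S) \<otimes>\<^sub>b mat 1 + r *\<^sub>R T_perp) E)"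
  by (simp add: vec_eq_iff forall_2 op_apply_components
      matrix_matrix_mult_def sum_2 assms algebra_simps)

text \<open>
  The next two matrices are the diagonal solutions of \<open>tr (C S) = 0\<close> and \<open>D = R\<^sub>\<perp> C R\<^sub>\<perp>\<close>; the first
  condition makes \<open>S C R\<^sub>\<perp> + R\<^sub>\<perp> C S\<close> vanish, and then \<open>S C S = det S \<cdot> D\<close>.
\<close>

definition dual_C :: "real^2^2 \<Rightarrow> real^2^2" where
  "dual_C S = vector [vector [S $ 2 $ 2, 0], vector [0, - (S $ 1 $ 1)]]"

definition dual_D :: "real^2^2 \<Rightarrow> real^2^2" where
  "dual_D S = vector [vector [S $ 1 $ 1, 0], vector [0, - (S $ 2 $ 2)]]"

lemma dual_nth [simp]:
  "dual_C S $ 1 $ 1 = S $ 2 $ 2" "dual_C S $ 1 $ 2 = 0" "dual_C S $ 2 $ 1 = 0" "dual_C S $ 2 $ 2 = - (S $ 1 $ 1)"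
  "dual_D S $ 1 $ 1 = S $ 1 $ 1" "dual_D S $ 1 $ 2 = 0" "dual_D S $ 2 $ 1 = 0" "dual_D S $ 2 $ 2 = - (S $ 2 $ 2)"
  by (simp_all add: dual_C_def dual_D_def)

text \<open>The sign in b comes from R^3 = -R, which acts in the term quadratic in r + a.\<close>

lemma isotropic_duality:
  fixes S :: "real^2^2"
  assumes S: "S $ 2 $ 1 = S $ 1 $ 2" and b: "b = \<theta>\<^sup>2 * det S - (r + a)\<^sup>2"
    and M: "M = (\<theta> *\<^sub>R S) \<otimes>\<^sub>b mat 1 + r *\<^sub>R T_perp"
    and E': "E' = op_apply (dual_C S \<otimes>\<^sub>b R_perp) (op_apply M E + a *\<^sub>R op_apply T_perp E)"
  shows "op_apply M E' + a *\<^sub>R op_apply T_perp E' = b *\<^sub>R op_apply (dual_D S \<otimes>\<^sub>b R_perp) E"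
  unfolding E' M b
  by (simp add: vec_eq_iff forall_2 op_apply_components S det_2 power2_eq_square algebra_simps)

text \<open>The first block row of the commutation relation makes K22 and K12 + K21 multiples of
  K11. By symmetry K21 is the transpose of K12, so only the antisymmetric part of K12 is free, and
  in dimension two it is a multiple of \<open>R_perp\<close>.\<close>

lemma intertwining_imp_isotropic:
  fixes S :: "real^2^2" and K :: T_op
  assumes S: "S $ 2 $ 1 = S $ 1 $ 2" "0 < S $ 1 $ 1"
    and comm: "\<And>E. op_apply K (op_apply ((R_perp ** S) \<otimes>\<^sub>b mat 1) E) = op_apply ((S ** R_perp) \<otimes>\<^sub>b mat 1) (op_apply K E)"
    and sym: "\<And>E F. op_apply K E \<bullet> F = op_apply K F \<bullet> E"
  obtains M t where "transpose M = M" "K = S \<otimes>\<^sub>b M + t *\<^sub>R T_perp"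
proof -
  let ?a = "S $ 1 $ 1" and ?b = "S $ 1 $ 2" and ?c = "S $ 2 $ 2"
  have K: "op_apply K (axis j (axis q 1)) $ i $ p = K $ i $ j $ p $ q" for i j p q
    using exhaust_2[of j] exhaust_2[of q] by (auto simp: op_apply_nth mult_vec_nth axis_def)
  have s: "K $ i $ j $ p $ q = K $ j $ i $ q $ p" for i j p q
    using sym[of "axis j (axis q 1)" "axis i (axis p 1)"] by (simp add: inner_axis K)
  have e1: "?a * (K $ 1 $ 2 $ p $ q + K $ 2 $ 1 $ p $ q) = 2 * ?b * K $ 1 $ 1 $ p $ q" for p q
    using comm[of "axis 1 (axis q 1)", THEN arg_cong, of "\<lambda>E. E $ 1 $ p"] exhaust_2[of q]
    by (auto simp: op_apply_nth[of K] op_apply_tensor mult_vec_nth axis_def matrix_matrix_mult_def sum_2 S(1) algebra_simps)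
  have e2: "?a * K $ 2 $ 2 $ p $ q = ?c * K $ 1 $ 1 $ p $ q" for p q
    using comm[of "axis 2 (axis q 1)", THEN arg_cong, of "\<lambda>E. E $ 1 $ p"] exhaust_2[of q]
    by (auto simp: op_apply_nth[of K] op_apply_tensor mult_vec_nth axis_def matrix_matrix_mult_def sum_2 S(1) algebra_simps)
  define M where "M = (1 / ?a) *\<^sub>R (K $ 1 $ 1)"
  \<comment> \<open>Block (1,2) of \<open>T_perp\<close> is -R, whose entry (1,2) is +1; hence t is
    the excess of that entry of K12 over its symmetric part.\<close>
  define t where "t = K $ 1 $ 2 $ 1 $ 2 - ?b * M $ 1 $ 2"
  have P: "K $ 1 $ 1 $ p $ q = ?a * M $ p $ q" for p q
    using S(2) by (simp add: M_def)
  have Msym: "M $ 2 $ 1 = M $ 1 $ 2"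
    using s[of 1 1 2 1] by (simp add: M_def)
  have W: "K $ 2 $ 2 $ p $ q = ?c * M $ p $ q" for p q
    using e2[of p q] S(2) by (simp add: P)
  have UV: "K $ 1 $ 2 $ p $ q + K $ 2 $ 1 $ p $ q = 2 * ?b * M $ p $ q" for p q
    using e1[of p q] S(2) by (simp add: P)
  have "K = S \<otimes>\<^sub>b M + t *\<^sub>R T_perp"
    using s[of 1 2 1 1] s[of 1 2 1 2] s[of 1 2 2 1] s[of 1 2 2 2] UV[of 1 1] UV[of 1 2] UV[of 2 1] UV[of 2 2] Msym
    by (simp add: vec_eq_iff forall_2 tensor_def T_perp_def P W S(1) t_def)
      (simp add: algebra_simps)
  moreover have "transpose M = M" using Msym by (simp add: symmetric_matrix2_iff)
  ultimately show thesis using that by blast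
qed

text \<open>For symmetric M one has M R M = det M R with R = \<open>R_perp\<close>. The operator
  identity is thus a scalar one times \<open>dual_D S\<close> \<otimes> R, and a single entry,
  weighted by the nonzero S11, suffices to read it off.\<close>

lemma isotropic_duality_det:
  fixes S M :: "real^2^2"
  assumes S: "S $ 2 $ 1 = S $ 1 $ 2" "0 < S $ 1 $ 1" and M: "M $ 2 $ 1 = M $ 1 $ 2"
    and K: "K = S \<otimes>\<^sub>b M + t *\<^sub>R T_perp"
    and E: "E = axis 1 (axis 1 1)"
    and E': "E' = op_apply (dual_C S \<otimes>\<^sub>b R_perp) (op_apply K E + a *\<^sub>R op_apply T_perp E)"
    and dual: "op_apply K E' + a *\<^sub>R op_apply T_perp E' = b *\<^sub>R op_apply (dual_D S \<otimes>\<^sub>b R_perp) E"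
  shows "det S * det M = (t + a)\<^sup>2 + b"
proof -
  have Ec: "E $ 1 $ 1 = 1" "E $ 1 $ 2 = 0" "E $ 2 = 0"
    by (simp_all add: E axis_def)
  have "S $ 1 $ 1 * (det S * det M - (t + a)\<^sup>2) = S $ 1 $ 1 * b"
    using dual[THEN arg_cong, of "\<lambda>E. E $ 1 $ 2"] unfolding E' K
    by (simp add: op_apply_components
      Ec S(1) M det_2 power2_eq_square algebra_simps)
  then show ?thesis using S(2) by simp
qed

theorem mainTheorem13:
  fixes A1 A2 :: "(real^2) set"
    and \<sigma>0 \<sigma>1 \<sigma>2 :: "real^2^2"
    and \<theta>1 \<theta>2 r1 r2 :: real
    and L1 L2 :: T_op
  assumes "A1 \<in> sets lebesgue" and "A2 \<in> sets lebesgue"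
    and "A1 \<union> A2 = period_cell" and "A1 \<inter> A2 = {}"
    and "sym_pos_def \<sigma>0" and "\<theta>1 > 0" and "\<theta>2 > 0"
    and "\<sigma>1 = \<theta>1 *\<^sub>R \<sigma>0" and "\<sigma>2 = \<theta>2 *\<^sub>R \<sigma>0"
    and "r1\<^sup>2 < det \<sigma>1" and "r2\<^sup>2 < det \<sigma>2"
    and "L1 = \<sigma>1 \<otimes>\<^sub>b mat 1 + r1 *\<^sub>R T_perp"
    and "L2 = \<sigma>2 \<otimes>\<^sub>b mat 1 + r2 *\<^sub>R T_perp"
    and "\<bar>r1 - r2\<bar> > \<bar>\<theta>1 - \<theta>2\<bar> * sqrt (det \<sigma>0)"
  shows "let \<Delta>r = r2 - r1;
             A = (det \<sigma>2 - det \<sigma>1 + r1\<^sup>2 - r2\<^sup>2) / (2 * \<Delta>r);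
             B = (\<Delta>r\<^sup>2 - (sqrt (det \<sigma>1) - sqrt (det \<sigma>2))\<^sup>2)
                   * ((sqrt (det \<sigma>1) + sqrt (det \<sigma>2))\<^sup>2 - \<Delta>r\<^sup>2) / (4 * \<Delta>r\<^sup>2)
         in \<exists>(Lstar :: real^2^2) (tstar :: real).
              transpose Lstar = Lstar \<and>
              effective_tensor (two_phase A1 L1 L2) = \<sigma>1 \<otimes>\<^sub>b Lstar + tstar *\<^sub>R T_perp \<and>
              det \<sigma>1 * det Lstar = (tstar + A)\<^sup>2 + B"
proof -
  define d where "d = det \<sigma>0"
  define \<Delta> where "\<Delta> = r2 - r1"
  define A where "A = (det \<sigma>2 - det \<sigma>1 + r1\<^sup>2 - r2\<^sup>2) / (2 * \<Delta>)"
  define B where "B = (\<Delta>\<^sup>2 - (sqrt (det \<sigma>1) - sqrt (det \<sigma>2))\<^sup>2)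
                   * ((sqrt (det \<sigma>1) + sqrt (det \<sigma>2))\<^sup>2 - \<Delta>\<^sup>2) / (4 * \<Delta>\<^sup>2)"
  have S: "\<sigma>0 $ 2 $ 1 = \<sigma>0 $ 1 $ 2" "0 < \<sigma>0 $ 1 $ 1"
    using sym_pos_def_entries[OF assms(5)] by auto
  have det1: "det \<sigma>1 = \<theta>1\<^sup>2 * d" and det2: "det \<sigma>2 = \<theta>2\<^sup>2 * d"
    by (simp_all add: assms(8,9) d_def det_2 power2_eq_square algebra_simps)
  have pos1: "0 < det \<sigma>1" and pos2: "0 < det \<sigma>2"
    using assms(10,11) zero_le_power2[of r1] zero_le_power2[of r2] by linarith+
  then have "0 < d" using det1 assms(6) by (simp add: zero_less_mult_iff)
  then have "0 \<le> \<bar>\<theta>1 - \<theta>2\<bar> * sqrt (det \<sigma>0)" by (simp add: d_def)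
  \<comment> \<open>The strict inequality has a nonnegative right-hand side, so r1 and r2 differ and
    A and B are genuine quotients.\<close>
  then have \<Delta>: "\<Delta> \<noteq> 0" using assms(14) by (auto simp: \<Delta>_def)
  have B1: "B = det \<sigma>1 - (r1 + A)\<^sup>2" and B2: "B = det \<sigma>2 - (r2 + A)\<^sup>2"
  proof -
    \<comment> \<open>In terms of the square roots, 4 \<Delta>^2 s1^2 - (s2^2 - s1^2 - \<Delta>^2)^2
      is a difference of squares; its two factors are those in the stated B.\<close>
    define s1 s2 where "s1 = sqrt (det \<sigma>1)" and "s2 = sqrt (det \<sigma>2)"
    have s: "det \<sigma>1 = s1\<^sup>2" "det \<sigma>2 = s2\<^sup>2" using pos1 pos2 by (simp_all add: s1_def s2_def)
    have r2: "r2 = r1 + \<Delta>" by (simp add: \<Delta>_def)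
    have a1: "r1 + A = (s2\<^sup>2 - s1\<^sup>2 - \<Delta>\<^sup>2) / (2 * \<Delta>)"
      using \<Delta> by (simp add: A_def s r2 field_simps power2_eq_square)
    have a2: "r2 + A = (s2\<^sup>2 - s1\<^sup>2 + \<Delta>\<^sup>2) / (2 * \<Delta>)"
      using \<Delta> by (simp add: A_def s r2 field_simps power2_eq_square)
    have B: "B = (\<Delta>\<^sup>2 - (s1 - s2)\<^sup>2) * ((s1 + s2)\<^sup>2 - \<Delta>\<^sup>2) / (4 * \<Delta>\<^sup>2)"
      by (simp add: B_def s1_def s2_def)
    show "B = det \<sigma>1 - (r1 + A)\<^sup>2"
      unfolding a1 B s using \<Delta> by (simp add: power_divide field_simps) (simp add: power2_eq_square power4_eq_xxxx algebra_simps)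
    show "B = det \<sigma>2 - (r2 + A)\<^sup>2"
      unfolding a2 B s using \<Delta> by (simp add: power_divide field_simps) (simp add: power2_eq_square power4_eq_xxxx algebra_simps)
  qed
  have S1: "\<sigma>1 $ 2 $ 1 = \<sigma>1 $ 1 $ 2" "0 < \<sigma>1 $ 1 $ 1" and S2: "\<sigma>2 $ 2 $ 1 = \<sigma>2 $ 1 $ 2" "0 < \<sigma>2 $ 1 $ 1"
    using S assms(6,7) by (simp_all add: assms(8,9))
  obtain \<alpha>1 where \<alpha>1: "0 < \<alpha>1" "\<forall>E. \<alpha>1 * (norm E)\<^sup>2 \<le> op_apply L1 E \<bullet> E"
    unfolding assms(12) by (rule isotropic_coercive[OF S1 assms(10)])
  obtain \<alpha>2 where \<alpha>2: "0 < \<alpha>2" "\<forall>E. \<alpha>2 * (norm E)\<^sup>2 \<le> op_apply L2 E \<bullet> E"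
    unfolding assms(13) by (rule isotropic_coercive[OF S2 assms(11)])
  interpret two_phase_problem A1 L1 L2 "min \<alpha>1 \<alpha>2"
  proof
    show "A1 \<in> sets lebesgue" by (rule assms(1))
    show "op_apply L1 E \<bullet> F = op_apply L1 F \<bullet> E" "op_apply L2 E \<bullet> F = op_apply L2 F \<bullet> E" for E F
      unfolding assms(12,13) by (rule isotropic_symmetric, rule S1 S2)+
    show "0 < min \<alpha>1 \<alpha>2" using \<alpha>1 \<alpha>2 by simp
    show "min \<alpha>1 \<alpha>2 * (norm E)\<^sup>2 \<le> op_apply L1 E \<bullet> E" for E
      using \<alpha>1(2) mult_right_mono[OF min.cobounded1 zero_le_power2] order_trans by blast
    show "min \<alpha>1 \<alpha>2 * (norm E)\<^sup>2 \<le> op_apply L2 E \<bullet> E" for E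
      using \<alpha>2(2) mult_right_mono[OF min.cobounded2 zero_le_power2] order_trans by blast
  qed
  have L1: "L1 = (\<theta>1 *\<^sub>R \<sigma>0) \<otimes>\<^sub>b mat 1 + r1 *\<^sub>R T_perp" and L2: "L2 = (\<theta>2 *\<^sub>R \<sigma>0) \<otimes>\<^sub>b mat 1 + r2 *\<^sub>R T_perp"
    by (simp_all add: assms(8,9,12,13))
  have i1: "op_apply L1 (op_apply ((R_perp ** \<sigma>0) \<otimes>\<^sub>b mat 1) E) = op_apply ((\<sigma>0 ** R_perp) \<otimes>\<^sub>b mat 1) (op_apply L1 E)" for E
    unfolding L1 by (rule isotropic_intertwining[OF S(1)])
  have i2: "op_apply L2 (op_apply ((R_perp ** \<sigma>0) \<otimes>\<^sub>b mat 1) E) = op_apply ((\<sigma>0 ** R_perp) \<otimes>\<^sub>b mat 1) (op_apply L2 E)" for E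
    unfolding L2 by (rule isotropic_intertwining[OF S(1)])
  obtain M t where M: "transpose M = M" and K: "effective_tensor L = \<sigma>0 \<otimes>\<^sub>b M + t *\<^sub>R T_perp"
  proof (rule intertwining_imp_isotropic[OF S])
    show "op_apply (effective_tensor L) (op_apply ((R_perp ** \<sigma>0) \<otimes>\<^sub>b mat 1) E)
       = op_apply ((\<sigma>0 ** R_perp) \<otimes>\<^sub>b mat 1) (op_apply (effective_tensor L) E)" for E
      by (rule effective_tensor_intertwining[OF i1 i2])
  qed (rule effective_tensor_sym)
  \<comment> \<open>Both phases are written with the common \<open>\<sigma>0\<close>, so the same
    \<open>dual_C\<close> and \<open>dual_D\<close> serve both, with the common scalar B.\<close>
  have dual1: "op_apply L1 E' + A *\<^sub>R op_apply T_perp E' = B *\<^sub>R op_apply (dual_D \<sigma>0 \<otimes>\<^sub>b R_perp) E"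
    if "E' = op_apply (dual_C \<sigma>0 \<otimes>\<^sub>b R_perp) (op_apply L1 E + A *\<^sub>R op_apply T_perp E)" for E E'
    by (rule isotropic_duality[OF S(1) _ L1 that]) (simp add: B1 det1 d_def)
  have dual2: "op_apply L2 E' + A *\<^sub>R op_apply T_perp E' = B *\<^sub>R op_apply (dual_D \<sigma>0 \<otimes>\<^sub>b R_perp) E"
    if "E' = op_apply (dual_C \<sigma>0 \<otimes>\<^sub>b R_perp) (op_apply L2 E + A *\<^sub>R op_apply T_perp E)" for E E'
    by (rule isotropic_duality[OF S(1) _ L2 that]) (simp add: B2 det2 d_def)
  define E0 :: T_space where "E0 = axis 1 (axis 1 1)"
  define E0' where "E0' = op_apply (dual_C \<sigma>0 \<otimes>\<^sub>b R_perp)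
    (op_apply (effective_tensor L) E0 + A *\<^sub>R op_apply T_perp E0)"
  have M21: "M $ 2 $ 1 = M $ 1 $ 2" using M by (simp add: symmetric_matrix2_iff)
  have "det \<sigma>0 * det M = (t + A)\<^sup>2 + B"
    by (rule isotropic_duality_det[OF S M21 K E0_def E0'_def effective_tensor_duality[OF dual1 dual2 E0'_def]])
  \<comment> \<open>The statement is normalised by \<open>\<sigma>1\<close> rather than
    \<open>\<sigma>0\<close>. Dividing M by \<open>\<theta>1\<close> compensates in the tensor
    product, and the factor \<open>\<theta>1\<close> squared cancels in the determinants.\<close>
  moreover have "det \<sigma>1 * det ((1 / \<theta>1) *\<^sub>R M) = det \<sigma>0 * det M"
    using assms(6) by (simp add: assms(8) det_2 field_simps)
  moreover have "\<sigma>1 \<otimes>\<^sub>b ((1 / \<theta>1) *\<^sub>R M) = \<sigma>0 \<otimes>\<^sub>b M"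
    using assms(6) by (simp add: assms(8) tensor_def)
  moreover have "transpose ((1 / \<theta>1) *\<^sub>R M) = (1 / \<theta>1) *\<^sub>R M"
    using M by (simp add: symmetric_matrix2_iff)
  ultimately show ?thesis
    unfolding Let_def using K by (intro exI[of _ "(1 / \<theta>1) *\<^sub>R M"] exI[of _ t]) (simp add: A_def B_def \<Delta>_def)
qed

end
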